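(* For any $\sigma\in S_n$ and $I\in\mathcal I_\lambda$ there is a unique element $[\widetilde W_{\sigma,I}]\in K_T(T^*\mathcal F_\lambda)$ such that $[\widetilde W_{\sigma,I}]|_{x_J}=\widetilde W_{\sigma,I}(z_J,z,h)$ for all $J\in\mathcal I_\lambda$. Moreover, $\kappa_{\sigma,I}:=[\widetilde W_{\sigma,I}]$ satisfies: (I) $\kappa_{\sigma,I}|_{x_J}$ is divisible by $e^{\mathrm{vert}}_{\sigma,J,-}$ for all $J$; (II) $\kappa_{\sigma,I}|_{x_I}=P_{\sigma,I}e_{\sigma,I}$; (III) $\kappa_{\sigma,I}|_{x_J}$ is $J$-small for all $J\ne I$.
   Context: Fix $N,n$, $\lambda\in\mathbb Z_{\ge0}^N$, $\sum\lambda_k=n$; $\lambda^{(k)}=\lambda_1+\dots+\lambda_k$, $\lambda^{\{1\}}=\sum_{k=1}^{N-1}\lambda^{(k)}$. $\mathcal I_\lambda$ = ordered partitions $I=(I_1,\dots,I_N)$ of $\{1,\dots,n\}$ with $|I_k|=\lambda_k$; $I_1\cup\dots\cup I_k=\{i^{(k)}_1<\dots<i^{(k)}_{\lambda^{(k)}}\}$; $\sigma(I)=(\sigma(I_1),\dots,\sigma(I_N))$. $K_T(T^*\mathcal F_\lambda)=\mathbb C[\Gamma^{\pm1}]^{S_\lambda}\otimes\mathbb C[z^{\pm1},h^{\pm1}]/\langle f(\Gamma)=f(z),\ f\in\mathbb C[z^{\pm1}]^{S_n}\rangle$, $\Gamma=(\gamma_{k,a})_{k\le N,a\le\lambda_k}$,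 $S_\lambda=\prod S_{\lambda_k}$ permuting variables with the same first index. Restriction $[f]|_{x_J}$: substitution $\{\gamma_{k,1},\dots,\gamma_{k,\lambda_k}\}\mapsto\{z_a:a\in J_k\}$. Weight functions: variables $t^{(k)}_a$ ($1\le k\le N-1$), $t^{(N)}_a=z_a$; $U_I=\prod_{k=1}^{N-1}\prod_{a=1}^{\lambda^{(k)}}\Big(\prod_{c:\,i^{(k+1)}_c<i^{(k)}_a}(1-ht^{(k+1)}_c/t^{(k)}_a)\prod_{c:\,i^{(k+1)}_c>i^{(k)}_a}(1-t^{(k+1)}_c/t^{(k)}_a)\prod_{b=a+1}^{\lambda^{(k)}}\frac{1-ht^{(k)}_b/t^{(k)}_a}{1-t^{(k)}_b/t^{(k)}_a}\Big)$ ($c\in\{1..\lambda^{(k+1)}\}$); $W_I=(1-h)^{\lambda^{\{1\}}}\mathrm{Sym}_{t^{(1)}}\cdots\mathrm{Sym}_{t^{(N-1)}}U_I$; $W_{\sigma,I}(t,z,h)=W_{\sigma^{-1}(I)}(t,z_{\sigma(1)},\dots,z_{\sigma(n)},h)$; $E(t,h)=\prod_{k=1}^{N-1}\prod_{a,b}(1-ht^{(k)}_b/t^{(k)}_a)$; $\widetilde W_{\sigma,I}=W_{\sigma,I}/E$; $f(z_J,z,h)$ = substitution $t^{(k)}_a=z_{j^{(k)}_a}$ with $J_1\cup\dots\cup J_k=\{j^{(k)}_1<\dots\}$. $P_{\sigma,I}=\prod_{k<l}\prod_{\sigma(a)\in I_k}\prod_{\sigma(b)\in I_l,b>a}(-z_{\sigma(b)}/z_{\sigma(a)})$;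 $e^{\mathrm{vert}}_{\sigma,I,-}=\prod_{k<l}\prod_{\sigma(a)\in I_k}\prod_{\sigma(b)\in I_l,b<a}(1-hz_{\sigma(b)}/z_{\sigma(a)})$; $e_{\sigma,I}=e^{\mathrm{vert}}_{\sigma,I,-}\prod_{k<l}\prod_{\sigma(a)\in I_k}\prod_{\sigma(b)\in I_l,b>a}(1-z_{\sigma(a)}/z_{\sigma(b)})$. $J$-small: with $N(f)$ the Newton polytope in $z$ (coefficients in $\mathbb C[h^{\pm1}]$) and $\phi_J(\epsilon_a)=k$ for $a\in J_k$, $\phi_J(N(f))\subset[0,\sum_{k<l}\lambda_k\lambda_l(l-k)-1]$. *)

theory Defs
  imports Complex_Main "HOL-Library.Poly_Mapping" "HOL-Combinatorics.Permutations"
begin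

definition lamc :: "(nat \<Rightarrow> nat) \<Rightarrow> nat \<Rightarrow> nat" where
  "lamc lam k = (\<Sum>i\<in>{1..k}. lam i)"

definition lam1 :: "nat \<Rightarrow> (nat \<Rightarrow> nat) \<Rightarrow> nat" where
  "lam1 N lam = (\<Sum>k\<in>{1..N-1}. lamc lam k)"

definition ordpart :: "nat \<Rightarrow> nat \<Rightarrow> (nat \<Rightarrow> nat) \<Rightarrow> (nat \<Rightarrow> nat set) \<Rightarrow> bool" where
  "ordpart N n lam I \<longleftrightarrow>
     (\<forall>k\<in>{1..N}. I k \<subseteq> {1..n} \<and> card (I k) = lam k) \<and>
     (\<forall>k\<in>{1..N}. \<forall>l\<in>{1..N}. k \<noteq> l \<longrightarrow> I k \<inter> I l = {}) \<and>
     (\<Union>k\<in>{1..N}. I k) = {1..n} \<and>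
     (\<forall>k. k \<notin> {1..N} \<longrightarrow> I k = {})"

definition elt :: "nat set \<Rightarrow> nat \<Rightarrow> nat" where
  "elt S a = sorted_list_of_set S ! (a - 1)"

definition cup :: "(nat \<Rightarrow> nat set) \<Rightarrow> nat \<Rightarrow> nat set" where
  "cup I k = (\<Union>l\<in>{1..k}. I l)"

text \<open>T k a = t^(k)_a, where level N is the z variables.\<close>
definition wU :: "nat \<Rightarrow> (nat \<Rightarrow> nat) \<Rightarrow> (nat \<Rightarrow> nat set) \<Rightarrow> (nat \<Rightarrow> nat \<Rightarrow> complex) \<Rightarrow> complex \<Rightarrow> complex" where
  "wU N lam I T h = (\<Prod>k\<in>{1..N-1}. \<Prod>a\<in>{1..lamc lam k}.
      (\<Prod>c\<in>{1..lamc lam (k+1)}.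
          (if elt (cup I (k+1)) c < elt (cup I k) a then 1 - h * T (k+1) c / T k a
           else if elt (cup I (k+1)) c > elt (cup I k) a then 1 - T (k+1) c / T k a
           else 1))
      * (\<Prod>b\<in>{a+1..lamc lam k}. (1 - h * T k b / T k a) / (1 - T k b / T k a)))"

definition tfull :: "nat \<Rightarrow> (nat \<Rightarrow> nat \<Rightarrow> complex) \<Rightarrow> (nat \<Rightarrow> complex) \<Rightarrow> nat \<Rightarrow> nat \<Rightarrow> complex" where
  "tfull N t z k = (if k = N then z else t k)"

definition symperms :: "nat \<Rightarrow> (nat \<Rightarrow> nat) \<Rightarrow> (nat \<Rightarrow> nat \<Rightarrow> nat) set" where
  "symperms N lam = {\<pi>. \<forall>k. \<pi> k permutes (if k \<in> {1..N-1} then {1..lamc lam k} else {})}"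

definition wW :: "nat \<Rightarrow> (nat \<Rightarrow> nat) \<Rightarrow> (nat \<Rightarrow> nat set) \<Rightarrow> (nat \<Rightarrow> nat \<Rightarrow> complex) \<Rightarrow> (nat \<Rightarrow> complex) \<Rightarrow> complex \<Rightarrow> complex" where
  "wW N lam I t z h = (1 - h) ^ lam1 N lam *
     (\<Sum>\<pi>\<in>symperms N lam. wU N lam I (\<lambda>k a. tfull N t z k (\<pi> k a)) h)"

definition wE :: "nat \<Rightarrow> (nat \<Rightarrow> nat) \<Rightarrow> (nat \<Rightarrow> nat \<Rightarrow> complex) \<Rightarrow> complex \<Rightarrow> complex" where
  "wE N lam t h = (\<Prod>k\<in>{1..N-1}. \<Prod>a\<in>{1..lamc lam k}. \<Prod>b\<in>{1..lamc lam k}. 1 - h * t k b / t k a)"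

definition wWt :: "nat \<Rightarrow> (nat \<Rightarrow> nat) \<Rightarrow> (nat \<Rightarrow> nat) \<Rightarrow> (nat \<Rightarrow> nat set) \<Rightarrow> (nat \<Rightarrow> nat set)
                   \<Rightarrow> (nat \<Rightarrow> complex) \<Rightarrow> complex \<Rightarrow> complex" where
  "wWt N lam \<sigma> I J z h =
     (let tJ = (\<lambda>k a. z (elt (cup J k) a))
      in wW N lam (\<lambda>k. inv \<sigma> ` I k) tJ (z \<circ> \<sigma>) h / wE N lam tJ h)"

text \<open>Points (z,h) at which all denominators occurring are nonzero (a Zariski dense set).\<close>
definition gen :: "nat \<Rightarrow> (nat \<Rightarrow> complex) \<Rightarrow> complex \<Rightarrow> bool" where
  "gen n z h \<longleftrightarrow> h \<noteq> 0 \<and> (\<forall>a\<in>{1..n}. z a \<noteq> 0) \<and>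
     (\<forall>a\<in>{1..n}. \<forall>b\<in>{1..n}. a \<noteq> b \<longrightarrow> z a \<noteq> z b) \<and>
     (\<forall>a\<in>{1..n}. \<forall>b\<in>{1..n}. h * z b \<noteq> z a)"

datatype var = Gam nat nat | Z nat | H

type_synonym lpoly = "(var \<Rightarrow>\<^sub>0 int) \<Rightarrow>\<^sub>0 complex"

definition mono_map :: "(var \<Rightarrow> var) \<Rightarrow> (var \<Rightarrow>\<^sub>0 int) \<Rightarrow> (var \<Rightarrow>\<^sub>0 int)" where
  "mono_map g m = (\<Sum>v\<in>Poly_Mapping.keys m. Poly_Mapping.single (g v) (Poly_Mapping.lookup m v))"

definition lsubst :: "(var \<Rightarrow> var) \<Rightarrow> lpoly \<Rightarrow> lpoly" where
  "lsubst g F = (\<Sum>m\<in>Poly_Mapping.keys F. Poly_Mapping.single (mono_map g m) (Poly_Mapping.lookup F m))"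

definition lvars :: "lpoly \<Rightarrow> var set" where
  "lvars F = (\<Union>m\<in>Poly_Mapping.keys F. Poly_Mapping.keys m)"

definition leval :: "lpoly \<Rightarrow> (var \<Rightarrow> complex) \<Rightarrow> complex" where
  "leval F x = (\<Sum>m\<in>Poly_Mapping.keys F. Poly_Mapping.lookup F m * (\<Prod>v\<in>Poly_Mapping.keys m. x v powi Poly_Mapping.lookup m v))"

definition pt :: "(nat \<Rightarrow> complex) \<Rightarrow> complex \<Rightarrow> var \<Rightarrow> complex" where
  "pt z h v = (case v of Z a \<Rightarrow> z a | H \<Rightarrow> h | Gam k a \<Rightarrow> 0)"

definition ex :: "var \<Rightarrow> (var \<Rightarrow>\<^sub>0 int)" where
  "ex v = Poly_Mapping.single v 1"

definition lmon :: "complex \<Rightarrow> (var \<Rightarrow>\<^sub>0 int) \<Rightarrow> lpoly" where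
  "lmon c m = Poly_Mapping.single m c"

definition ZHvars :: "nat \<Rightarrow> var set" where
  "ZHvars n = {Z a | a. a \<in> {1..n}} \<union> {H}"

definition Kvars :: "nat \<Rightarrow> nat \<Rightarrow> (nat \<Rightarrow> nat) \<Rightarrow> var set" where
  "Kvars N n lam = {Gam k a | k a. k \<in> {1..N} \<and> a \<in> {1..lam k}} \<union> ZHvars n"

definition gamperm :: "(nat \<Rightarrow> nat \<Rightarrow> nat) \<Rightarrow> var \<Rightarrow> var" where
  "gamperm \<rho> v = (case v of Gam k a \<Rightarrow> Gam k (\<rho> k a) | _ \<Rightarrow> v)"

text \<open>Elements of C[Gamma^{+-1}]^{S_lambda} (tensor) C[z^{+-1},h^{+-1}]\<close>
definition in_K :: "nat \<Rightarrow> nat \<Rightarrow> (nat \<Rightarrow> nat) \<Rightarrow> lpoly \<Rightarrow> bool" where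
  "in_K N n lam F \<longleftrightarrow> lvars F \<subseteq> Kvars N n lam \<and>
     (\<forall>\<rho>. (\<forall>k\<in>{1..N}. \<rho> k permutes {1..lam k}) \<longrightarrow> lsubst (gamperm \<rho>) F = F)"

definition zperm :: "(nat \<Rightarrow> nat) \<Rightarrow> var \<Rightarrow> var" where
  "zperm \<tau> v = (case v of Z a \<Rightarrow> Z (\<tau> a) | _ \<Rightarrow> v)"

definition symz :: "nat \<Rightarrow> lpoly \<Rightarrow> bool" where
  "symz n f \<longleftrightarrow> lvars f \<subseteq> {Z a | a. a \<in> {1..n}} \<and>
     (\<forall>\<tau>. \<tau> permutes {1..n} \<longrightarrow> lsubst (zperm \<tau>) f = f)"

definition blkidx :: "(nat \<Rightarrow> nat) \<Rightarrow> nat \<Rightarrow> nat" where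
  "blkidx lam i = (LEAST k. i \<le> lamc lam k)"

text \<open>z_i |-> gamma_{k,a} with i = lambda^(k-1) + a; f(Gamma) := lsubst z2gam f\<close>
definition z2gam :: "(nat \<Rightarrow> nat) \<Rightarrow> var \<Rightarrow> var" where
  "z2gam lam v = (case v of Z i \<Rightarrow> Gam (blkidx lam i) (i - lamc lam (blkidx lam i - 1)) | _ \<Rightarrow> v)"

definition in_ideal :: "nat \<Rightarrow> nat \<Rightarrow> (nat \<Rightarrow> nat) \<Rightarrow> lpoly \<Rightarrow> bool" where
  "in_ideal N n lam G \<longleftrightarrow> (\<exists>fs cs. length cs = length fs \<and> (\<forall>f\<in>set fs. symz n f) \<and>
     (\<forall>c\<in>set cs. in_K N n lam c) \<and>
     G = (\<Sum>i<length fs. cs ! i * (lsubst (z2gam lam) (fs ! i) - fs ! i)))"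

text \<open>restriction to the fixed point x_J: {gamma_{k,1..lambda_k}} |-> {z_a : a in J_k}\<close>
definition restr :: "(nat \<Rightarrow> nat set) \<Rightarrow> lpoly \<Rightarrow> lpoly" where
  "restr J F = lsubst (\<lambda>v. case v of Gam k a \<Rightarrow> Z (elt (J k) a) | _ \<Rightarrow> v) F"

definition Pfac :: "nat \<Rightarrow> nat \<Rightarrow> (nat \<Rightarrow> nat) \<Rightarrow> (nat \<Rightarrow> nat set) \<Rightarrow> lpoly" where
  "Pfac N n \<sigma> I = (\<Prod>k\<in>{1..N}. \<Prod>l\<in>{k<..N}. \<Prod>a\<in>{a\<in>{1..n}. \<sigma> a \<in> I k}.
      \<Prod>b\<in>{b\<in>{1..n}. \<sigma> b \<in> I l \<and> a < b}. lmon (-1) (ex (Z (\<sigma> b)) - ex (Z (\<sigma> a))))"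

definition evert :: "nat \<Rightarrow> nat \<Rightarrow> (nat \<Rightarrow> nat) \<Rightarrow> (nat \<Rightarrow> nat set) \<Rightarrow> lpoly" where
  "evert N n \<sigma> I = (\<Prod>k\<in>{1..N}. \<Prod>l\<in>{k<..N}. \<Prod>a\<in>{a\<in>{1..n}. \<sigma> a \<in> I k}.
      \<Prod>b\<in>{b\<in>{1..n}. \<sigma> b \<in> I l \<and> b < a}. 1 - lmon 1 (ex H + ex (Z (\<sigma> b)) - ex (Z (\<sigma> a))))"

definition efac :: "nat \<Rightarrow> nat \<Rightarrow> (nat \<Rightarrow> nat) \<Rightarrow> (nat \<Rightarrow> nat set) \<Rightarrow> lpoly" where
  "efac N n \<sigma> I = evert N n \<sigma> I * (\<Prod>k\<in>{1..N}. \<Prod>l\<in>{k<..N}. \<Prod>a\<in>{a\<in>{1..n}. \<sigma> a \<in> I k}.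
      \<Prod>b\<in>{b\<in>{1..n}. \<sigma> b \<in> I l \<and> a < b}. 1 - lmon 1 (ex (Z (\<sigma> a)) - ex (Z (\<sigma> b))))"

text \<open>Newton polytope in z (coefficients in C[h^{+-1}]): convex hull of the z-parts of exponents\<close>
definition newton :: "lpoly \<Rightarrow> (nat \<Rightarrow> real) set" where
  "newton f = {x. \<exists>c. (\<forall>m\<in>Poly_Mapping.keys f. 0 \<le> c m) \<and> (\<Sum>m\<in>Poly_Mapping.keys f. c m) = 1 \<and>
      x = (\<lambda>a. \<Sum>m\<in>Poly_Mapping.keys f. c m * real_of_int (Poly_Mapping.lookup m (Z a)))}"

definition phiJ :: "nat \<Rightarrow> (nat \<Rightarrow> nat set) \<Rightarrow> (nat \<Rightarrow> real) \<Rightarrow> real" where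
  "phiJ N J x = (\<Sum>k\<in>{1..N}. \<Sum>a\<in>J k. real k * x a)"

definition Dbound :: "nat \<Rightarrow> (nat \<Rightarrow> nat) \<Rightarrow> nat" where
  "Dbound N lam = (\<Sum>k\<in>{1..N}. \<Sum>l\<in>{k<..N}. lam k * lam l * (l - k))"

definition Jsmall :: "nat \<Rightarrow> (nat \<Rightarrow> nat) \<Rightarrow> (nat \<Rightarrow> nat set) \<Rightarrow> lpoly \<Rightarrow> bool" where
  "Jsmall N lam J f \<longleftrightarrow> phiJ N J ` newton f \<subseteq> {0 .. real (Dbound N lam) - 1}"

end

theory Submission
  imports Defs "HOL-Library.Countable" "HOL-Computational_Algebra.Polynomial" "HOL-Combinatorics.Transposition"
begin

text \<open>
  Existence. Restricted to a fixed point \<open>x\<^sub>J\<close>, the symmetrized sum has surviving terms only for chains of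
  injections that are weakly decreasing from level to level, and each of these is divisible by \<open>E\<close> and by the
  vertical Euler class, up to denominators \<open>z\<^sub>a - z\<^sub>b\<close>. The class is the Lagrange interpolation sum
  \<open>\<Sum>\<^sub>J W\<^sub>J \<Prod>\<^sub>k\<^sub><\<^sub>l \<Prod>\<^sub>a\<^sub>,\<^sub>b (\<gamma>\<^sub>k\<^sub>,\<^sub>a - z\<^sub>b) / (z\<^sub>a - z\<^sub>b)\<close> with \<open>b\<close> ranging over \<open>J\<^sub>l\<close>. By the previous remark
  its only poles are at \<open>z\<^sub>a = z\<^sub>b\<close>; on the other hand the weight function itself is a Laurent polynomial, so
  by symmetry the only poles are at \<open>z\<^sub>a = h z\<^sub>b\<close>. Hence there are none.

  Uniqueness. Modulo the ideal every Laurent polynomial in the \<open>\<gamma>\<close> reduces to a combination of staircase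
  monomials, and such a combination vanishing at all permutations of \<open>z\<close> is zero. Averaging over
  \<open>S\<^sub>\<lambda>\<close> makes the coefficients symmetric.

  Smallness. Under \<open>z\<^sub>a \<mapsto> s\<^sup>k z\<^sub>a\<close> for \<open>a \<in> J\<^sub>k\<close> the degree in \<open>s\<close> of every term can be read off; it lies between
  \<open>0\<close> and the bound, which is attained only if \<open>I = J\<close>.
\<close>

section \<open>Laurent polynomials\<close>

text \<open>The weight functions are given as complex functions with divisions, while the claims
  concern Laurent polynomials. Identities are therefore checked at generic points and carried back
  by the density of \<open>gpts\<close>. Divisibility avoids unique factorisation: a factor
  \<open>z_a - z_b\<close> is detected by the specialisation \<open>z_a := z_b\<close>, and a
  polynomial counts as coprime to it if it survives that specialisation. The comparison of poles
  thus takes the form \<open>dpoly N * P = B * Q\<close>, where \<open>P\<close> and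
  \<open>Q\<close> are the polynomials obtained by clearing one kind of pole each, and
  \<open>B\<close> is nonzero under every such specialisation. The bound in the smallness condition
  is a count. A pair of indices in blocks \<open>k < l\<close> contributes degree
  \<open>l - k\<close> exactly once, at level \<open>l - 1\<close>. A term loses degree whenever an
  index of a later block takes, one level up, the position of an index of an earlier block, and some
  such loss occurs in every term unless \<open>I = J\<close>.\<close>

instance var :: countable
  by countable_datatype

text \<open>The order itself is arbitrary. It makes exponent vectors a linearly ordered group, and
  hence Laurent polynomials a ring without zero divisors, on which all cancellations below
  rely.\<close>

instantiation var :: linorder
begin

definition less_eq_var :: "var \<Rightarrow> var \<Rightarrow> bool" where
  "less_eq_var u v \<longleftrightarrow> to_nat u \<le> to_nat v"

definition less_var :: "var \<Rightarrow> var \<Rightarrow> bool" where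
  "less_var u v \<longleftrightarrow> to_nat u < to_nat v"

instance
  by standard (auto simp: less_eq_var_def less_var_def)

end

section \<open>Notation and additive extension from monomials\<close>

abbreviation lk :: "('a \<Rightarrow>\<^sub>0 'b::zero) \<Rightarrow> 'a \<Rightarrow> 'b" where "lk \<equiv> Poly_Mapping.lookup"
abbreviation ks :: "('a \<Rightarrow>\<^sub>0 'b::zero) \<Rightarrow> 'a set" where "ks \<equiv> Poly_Mapping.keys"
abbreviation sg :: "'a \<Rightarrow> 'b::zero \<Rightarrow> ('a \<Rightarrow>\<^sub>0 'b)" where "sg \<equiv> Poly_Mapping.single"

text \<open>Common shape of \<open>leval\<close> and \<open>lsubst\<close>: a sum over monomials of
  a function that is additive in the coefficient. The homomorphism laws are proved once for this
  shape.\<close>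

definition pm_ext :: "('m \<Rightarrow> 'c \<Rightarrow> 'r) \<Rightarrow> ('m \<Rightarrow>\<^sub>0 'c::comm_monoid_add) \<Rightarrow> 'r::comm_monoid_add" where
  "pm_ext \<phi> F = (\<Sum>m\<in>ks F. \<phi> m (lk F m))"

lemma pm_eq_sum_single: "F = (\<Sum>m\<in>ks F. sg m (lk F m))"
proof (rule poly_mapping_eqI)
  fix k
  have "lk (\<Sum>m\<in>ks F. sg m (lk F m)) k = (\<Sum>m\<in>ks F. if m = k then lk F m else 0)"
    by (simp add: lookup_sum lookup_single when_def)
  also have "\<dots> = lk F k" by (simp add: in_keys_iff)
  finally show "lk F k = lk (\<Sum>m\<in>ks F. sg m (lk F m)) k" by simp
qed

context
  fixes \<phi> :: "'m \<Rightarrow> 'c::comm_monoid_add \<Rightarrow> 'r::comm_monoid_add"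
  assumes zero: "\<And>m. \<phi> m 0 = 0" and add: "\<And>m a b. \<phi> m (a + b) = \<phi> m a + \<phi> m b"
begin

lemma pm_ext_superset: "finite A \<Longrightarrow> ks F \<subseteq> A \<Longrightarrow> pm_ext \<phi> F = (\<Sum>m\<in>A. \<phi> m (lk F m))"
  unfolding pm_ext_def by (rule sum.mono_neutral_left) (auto simp: in_keys_iff zero)

lemma pm_ext_add: "pm_ext \<phi> (F + G) = pm_ext \<phi> F + pm_ext \<phi> G"
proof -
  have "ks (F + G) \<subseteq> ks F \<union> ks G" by (rule keys_add)
  then show ?thesis
    by (simp add: pm_ext_superset[of "ks F \<union> ks G"] lookup_add add sum.distrib)
qed

lemma pm_ext_zero: "pm_ext \<phi> 0 = 0"
  by (simp add: pm_ext_def)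

lemma pm_ext_single: "pm_ext \<phi> (sg m c) = \<phi> m c"
  by (simp add: pm_ext_def zero)

lemma pm_ext_sum: "pm_ext \<phi> (\<Sum>i\<in>A. f i) = (\<Sum>i\<in>A. pm_ext \<phi> (f i))"
  by (induction A rule: infinite_finite_induct) (simp_all add: pm_ext_zero pm_ext_add)

end

lemma pm_ext_mult:
  fixes \<phi> :: "'m::comm_monoid_add \<Rightarrow> 'c::comm_semiring_1 \<Rightarrow> 'r::comm_semiring_1"
  assumes zero: "\<And>m. \<phi> m 0 = 0" and add: "\<And>m a b. \<phi> m (a + b) = \<phi> m a + \<phi> m b"
    and mult: "\<And>m m' a b. \<phi> (m + m') (a * b) = \<phi> m a * \<phi> m' b"
  shows "pm_ext \<phi> (F * G) = pm_ext \<phi> F * pm_ext \<phi> G"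
proof -
  have "F * G = (\<Sum>m\<in>ks F. \<Sum>m'\<in>ks G. sg (m + m') (lk F m * lk G m'))"
    by (subst pm_eq_sum_single[of F], subst pm_eq_sum_single[of G])
       (simp add: sum_product mult_single)
  then have "pm_ext \<phi> (F * G) = (\<Sum>m\<in>ks F. \<Sum>m'\<in>ks G. \<phi> (m + m') (lk F m * lk G m'))"
    by (simp add: pm_ext_sum[of \<phi>, OF zero add] pm_ext_single[of \<phi>, OF zero add])
  also have "\<dots> = pm_ext \<phi> F * pm_ext \<phi> G"
    by (simp add: mult pm_ext_def sum_product)
  finally show ?thesis .
qed

subsection \<open>Evaluation\<close>

definition meval :: "(var \<Rightarrow> complex) \<Rightarrow> (var \<Rightarrow>\<^sub>0 int) \<Rightarrow> complex" where
  "meval x m = (\<Prod>v\<in>ks m. x v powi lk m v)"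

lemma meval_superset: "finite A \<Longrightarrow> ks m \<subseteq> A \<Longrightarrow> meval x m = (\<Prod>v\<in>A. x v powi lk m v)"
  unfolding meval_def by (rule prod.mono_neutral_left) (auto simp: in_keys_iff)

text \<open>\<open>powi\<close> turns sums of exponents into products only for a nonzero base, so
  evaluation is treated as a ring homomorphism only at these points. Nonvanishing is asked of all
  variables; \<open>leval_cong\<close> permits changing the values of absent ones to achieve
  it.\<close>

definition torus :: "(var \<Rightarrow> complex) set" where
  "torus = {x. \<forall>v. x v \<noteq> 0}"

lemma torusD: "x \<in> torus \<Longrightarrow> x v \<noteq> 0"
  by (simp add: torus_def)

lemma meval_add:
  assumes "x \<in> torus" shows "meval x (m + m') = meval x m * meval x m'"
proof -
  have "ks (m + m') \<subseteq> ks m \<union> ks m'" by (rule keys_add)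
  then show ?thesis using assms
    by (simp add: meval_superset[of "ks m \<union> ks m'"] lookup_add power_int_add torusD prod.distrib)
qed

lemma meval_zero [simp]: "meval x 0 = 1"
  by (simp add: meval_def)

lemma meval_uminus:
  assumes "x \<in> torus" shows "meval x (- m) = inverse (meval x m)"
proof -
  have "meval x (- m) * meval x m = 1"
    by (simp flip: meval_add[OF assms])
  then show ?thesis by (metis inverse_unique mult.commute)
qed

lemma meval_diff:
  assumes "x \<in> torus" shows "meval x (m - m') = meval x m / meval x m'"
  using meval_add[OF assms, of m "- m'"] meval_uminus[OF assms, of m'] by (simp add: divide_inverse)

lemma meval_single [simp]: "meval x (sg v k) = x v powi k"
  by (cases "k = 0") (simp_all add: meval_def)

lemma meval_ex [simp]: "meval x (ex v) = x v"
  by (simp add: ex_def)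

lemma leval_pm_ext: "leval F x = pm_ext (\<lambda>m c. c * meval x m) F"
  by (simp add: leval_def pm_ext_def meval_def)

lemma leval_zero [simp]: "leval 0 x = 0"
  by (simp add: leval_def)

lemma leval_add [simp]: "leval (F + G) x = leval F x + leval G x"
  unfolding leval_pm_ext by (rule pm_ext_add) (simp_all add: distrib_right)

lemma leval_uminus [simp]: "leval (- F) x = - leval F x"
  using leval_add[of "- F" F x] by (simp add: eq_neg_iff_add_eq_0)

lemma leval_diff [simp]: "leval (F - G) x = leval F x - leval G x"
  using leval_add[of F "- G" x] by simp

lemma leval_sum [simp]: "leval (\<Sum>i\<in>A. f i) x = (\<Sum>i\<in>A. leval (f i) x)"
  by (induction A rule: infinite_finite_induct) simp_all

lemma leval_single [simp]: "leval (sg m c) x = c * meval x m"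
  unfolding leval_pm_ext by (rule pm_ext_single) (simp_all add: distrib_right)

lemma leval_lmon [simp]: "leval (lmon c m) x = c * meval x m"
  by (simp add: lmon_def)

lemma leval_one [simp]: "leval 1 x = 1"
  using leval_single[of 0 1 x] by simp

lemma leval_mult [simp]:
  assumes "x \<in> torus" shows "leval (F * G) x = leval F x * leval G x"
  unfolding leval_pm_ext
  by (rule pm_ext_mult) (simp_all add: distrib_right meval_add[OF assms])

lemma leval_prod [simp]:
  assumes "x \<in> torus" shows "leval (\<Prod>i\<in>A. f i) x = (\<Prod>i\<in>A. leval (f i) x)"
  by (induction A rule: infinite_finite_induct) (simp_all add: assms)

lemma meval_cong: "(\<And>v. v \<in> ks m \<Longrightarrow> x v = y v) \<Longrightarrow> meval x m = meval y m"
  by (simp add: meval_def)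

lemma leval_cong: "(\<And>v. v \<in> lvars F \<Longrightarrow> x v = y v) \<Longrightarrow> leval F x = leval F y"
  unfolding leval_pm_ext pm_ext_def
  by (intro sum.cong refl arg_cong2[of _ _ _ _ "(*)"] meval_cong) (auto simp: lvars_def)

subsection \<open>Substitution of variables\<close>

lemma mono_map_superset:
  "finite A \<Longrightarrow> ks m \<subseteq> A \<Longrightarrow> mono_map g m = (\<Sum>v\<in>A. sg (g v) (lk m v))"
  unfolding mono_map_def by (rule sum.mono_neutral_left) (auto simp: in_keys_iff)

lemma mono_map_add: "mono_map g (m + m') = mono_map g m + mono_map g m'"
proof -
  have "ks (m + m') \<subseteq> ks m \<union> ks m'" by (rule keys_add)
  then show ?thesis
    by (simp add: mono_map_superset[of "ks m \<union> ks m'"] lookup_add single_add sum.distrib)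
qed

lemma mono_map_zero [simp]: "mono_map g 0 = 0"
  by (simp add: mono_map_def)

lemma mono_map_uminus: "mono_map g (- m) = - mono_map g m"
  using mono_map_add[of g m "- m"] by (simp add: eq_neg_iff_add_eq_0 add.commute)

lemma mono_map_diff: "mono_map g (m - m') = mono_map g m - mono_map g m'"
  using mono_map_add[of g m "- m'"] by (simp add: mono_map_uminus)

lemma mono_map_single [simp]: "mono_map g (sg v k) = sg (g v) k"
  by (cases "k = 0") (simp_all add: mono_map_def)

lemma mono_map_ex [simp]: "mono_map g (ex v) = ex (g v)"
  by (simp add: ex_def)

lemma mono_map_sum: "mono_map g (\<Sum>i\<in>A. f i) = (\<Sum>i\<in>A. mono_map g (f i))"
  by (induction A rule: infinite_finite_induct) (simp_all add: mono_map_add)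

lemma mono_map_comp: "mono_map f (mono_map g m) = mono_map (f \<circ> g) m"
  by (simp add: mono_map_def[of g] mono_map_sum) (simp add: mono_map_def)

lemma mono_map_cong: "(\<And>v. v \<in> ks m \<Longrightarrow> f v = g v) \<Longrightarrow> mono_map f m = mono_map g m"
  by (simp add: mono_map_def)

lemma mono_map_ident: "(\<And>v. v \<in> ks m \<Longrightarrow> f v = v) \<Longrightarrow> mono_map f m = m"
  by (simp add: mono_map_def flip: pm_eq_sum_single)

lemma keys_mono_map: "ks (mono_map g m) \<subseteq> g ` ks m"
  unfolding mono_map_def by (rule order_trans[OF keys_sum]) (auto split: if_splits)

lemma meval_mono_map:
  assumes "x \<in> torus" shows "meval x (mono_map g m) = meval (x \<circ> g) m"
proof -
  have "meval x (\<Sum>v\<in>A. sg (g v) (lk m v)) = (\<Prod>v\<in>A. x (g v) powi lk m v)" for A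
    by (induction A rule: infinite_finite_induct) (simp_all add: meval_add[OF assms])
  then show ?thesis by (simp add: mono_map_def meval_def)
qed

lemma lsubst_pm_ext: "lsubst g F = pm_ext (\<lambda>m c. sg (mono_map g m) c) F"
  by (simp add: lsubst_def pm_ext_def)

lemma lsubst_zero [simp]: "lsubst g 0 = 0"
  by (simp add: lsubst_def)

lemma lsubst_add: "lsubst g (F + G) = lsubst g F + lsubst g G"
  unfolding lsubst_pm_ext by (rule pm_ext_add) (simp_all add: single_add)

lemma lsubst_uminus: "lsubst g (- F) = - lsubst g F"
  using lsubst_add[of g "- F" F] by (simp add: eq_neg_iff_add_eq_0)

lemma lsubst_diff: "lsubst g (F - G) = lsubst g F - lsubst g G"
  using lsubst_add[of g F "- G"] by (simp add: lsubst_uminus)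

lemma lsubst_sum: "lsubst g (\<Sum>i\<in>A. f i) = (\<Sum>i\<in>A. lsubst g (f i))"
  by (induction A rule: infinite_finite_induct) (simp_all add: lsubst_add)

lemma lsubst_single [simp]: "lsubst g (sg m c) = sg (mono_map g m) c"
  unfolding lsubst_pm_ext by (rule pm_ext_single) (simp_all add: single_add)

lemma lsubst_lmon [simp]: "lsubst g (lmon c m) = lmon c (mono_map g m)"
  by (simp add: lmon_def)

lemma lsubst_one [simp]: "lsubst g 1 = 1"
  using lsubst_single[of g 0 1] by simp

lemma lsubst_mult: "lsubst g (F * G) = lsubst g F * lsubst g G"
  unfolding lsubst_pm_ext
  by (rule pm_ext_mult) (simp_all add: single_add mult_single mono_map_add)

lemma lsubst_prod: "lsubst g (\<Prod>i\<in>A. f i) = (\<Prod>i\<in>A. lsubst g (f i))"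
  by (induction A rule: infinite_finite_induct) (simp_all add: lsubst_mult)

lemma lsubst_comp: "lsubst f (lsubst g F) = lsubst (f \<circ> g) F"
  by (simp add: lsubst_def[of g] lsubst_sum mono_map_comp) (simp add: lsubst_def)

lemma lsubst_cong: "(\<And>v. v \<in> lvars F \<Longrightarrow> f v = g v) \<Longrightarrow> lsubst f F = lsubst g F"
  unfolding lsubst_def
  by (intro sum.cong refl arg_cong2[of _ _ _ _ sg] mono_map_cong) (auto simp: lvars_def)

lemma lsubst_ident:
  assumes "\<And>v. v \<in> lvars F \<Longrightarrow> f v = v" shows "lsubst f F = F"
proof -
  have "lsubst f F = (\<Sum>m\<in>ks F. sg m (lk F m))"
    unfolding lsubst_def
    by (intro sum.cong refl arg_cong2[of _ _ _ _ sg] mono_map_ident assms) (auto simp: lvars_def)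
  then show ?thesis by (simp flip: pm_eq_sum_single)
qed

lemma leval_lsubst:
  assumes "x \<in> torus" shows "leval (lsubst g F) x = leval F (x \<circ> g)"
  by (simp add: lsubst_def meval_mono_map[OF assms]) (simp add: leval_def meval_def)

subsection \<open>Variables\<close>

lemma lvars_zero [simp]: "lvars 0 = {}"
  by (simp add: lvars_def)

lemma lvars_single: "lvars (sg m c) \<subseteq> ks m"
  by (auto simp: lvars_def split: if_splits)

lemma lvars_lmon: "lvars (lmon c m) \<subseteq> ks m"
  by (simp add: lmon_def lvars_single)

lemma lvars_one [simp]: "lvars 1 = {}"
  by (simp add: lvars_def)

lemma lvars_add: "lvars F \<subseteq> V \<Longrightarrow> lvars G \<subseteq> V \<Longrightarrow> lvars (F + G) \<subseteq> V"
  using keys_add[of F G] unfolding lvars_def by blast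

lemma lvars_uminus [simp]: "lvars (- F) = lvars F"
  by (simp add: lvars_def keys_def)

lemma lvars_diff: "lvars F \<subseteq> V \<Longrightarrow> lvars G \<subseteq> V \<Longrightarrow> lvars (F - G) \<subseteq> V"
  using lvars_add[of F V "- G"] by simp

lemma lvars_mult:
  assumes "lvars F \<subseteq> V" "lvars G \<subseteq> V" shows "lvars (F * G) \<subseteq> V"
proof
  fix v assume "v \<in> lvars (F * G)"
  then obtain m where m: "m \<in> ks (F * G)" "v \<in> ks m" by (auto simp: lvars_def)
  then obtain a b where ab: "a \<in> ks F" "b \<in> ks G" "m = a + b" using keys_mult[of F G] by blast
  then have "v \<in> ks a \<union> ks b" using m keys_add[of a b] by blast
  then show "v \<in> V" using ab assms by (auto simp: lvars_def)
qed

lemma lvars_sum: "(\<And>i. i \<in> A \<Longrightarrow> lvars (f i) \<subseteq> V) \<Longrightarrow> lvars (\<Sum>i\<in>A. f i) \<subseteq> V"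
  by (induction A rule: infinite_finite_induct) (simp_all add: lvars_add)

lemma lvars_prod: "(\<And>i. i \<in> A \<Longrightarrow> lvars (f i) \<subseteq> V) \<Longrightarrow> lvars (\<Prod>i\<in>A. f i) \<subseteq> V"
  by (induction A rule: infinite_finite_induct) (simp_all add: lvars_mult)

lemma lvars_lsubst: "lvars (lsubst g F) \<subseteq> g ` lvars F"
  unfolding lsubst_def
proof (rule lvars_sum)
  fix m assume "m \<in> ks F"
  then have "ks m \<subseteq> lvars F" by (auto simp: lvars_def)
  then show "lvars (sg (mono_map g m) (lk F m)) \<subseteq> g ` lvars F"
    using lvars_single[of "mono_map g m" "lk F m"] keys_mono_map[of g m]
      image_mono[of "ks m" "lvars F" g] by (meson order_trans)
qed

lemma keys_ex [simp]: "ks (ex v) = {v}"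
  by (simp add: ex_def)

subsection \<open>Scaling limits and density of generic points\<close>

definition wdeg :: "(var \<Rightarrow> int) \<Rightarrow> (var \<Rightarrow>\<^sub>0 int) \<Rightarrow> int" where
  "wdeg w m = (\<Sum>v\<in>ks m. w v * lk m v)"

lemma meval_scale:
  assumes "s \<noteq> 0"
  shows "meval (\<lambda>v. x v * s powi w v) m = meval x m * s powi wdeg w m"
proof -
  have "(\<Prod>v\<in>A. s powi (w v * lk m v)) = s powi (\<Sum>v\<in>A. w v * lk m v)" for A
    by (induction A rule: infinite_finite_induct) (simp_all add: assms power_int_add)
  then show ?thesis
    by (simp add: meval_def wdeg_def power_int_mult_distrib prod.distrib flip: power_int_mult)
qed

lemma tendsto_powi_neg:
  assumes "e < 0"
  shows "((\<lambda>s::real. (of_real s :: complex) powi e) \<longlongrightarrow> 0) at_top"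
proof -
  define k where "k = nat (- e)"
  have k: "k > 0" "e = - int k" using assms by (auto simp: k_def)
  have "((\<lambda>s::real. inverse (s ^ k)) \<longlongrightarrow> 0) at_top"
    using k(1) by (intro tendsto_inverse_0_at_top filterlim_pow_at_top filterlim_ident)
  then have "((\<lambda>s::real. of_real (inverse (s ^ k)) :: complex) \<longlongrightarrow> of_real 0) at_top"
    by (rule tendsto_of_real)
  then show ?thesis by (simp add: k(2) power_int_minus)
qed

text \<open>Otherwise the largest exponent \<open>e0\<close> with a nonzero coefficient exceeds
  \<open>d\<close>. Normalised by \<open>s powi (- e0)\<close>, the sum tends to
  \<open>c e0\<close>; but it is also a convergent function times \<open>s powi (d - e0)\<close>,
  which tends to 0.\<close>

lemma laurent_growth_univ:
  fixes c :: "int \<Rightarrow> complex"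
  assumes "finite E"
    and lim: "((\<lambda>s::real. (\<Sum>e\<in>E. c e * of_real s powi e) * of_real s powi (- d)) \<longlongrightarrow> L) at_top"
    and "e \<in> E" "e > d"
  shows "c e = 0"
proof (rule ccontr)
  assume "c e \<noteq> 0"
  define e0 where "e0 = Max {e\<in>E. c e \<noteq> 0}"
  have ne: "{e\<in>E. c e \<noteq> 0} \<noteq> {}" and fin: "finite {e\<in>E. c e \<noteq> 0}"
    using \<open>c e \<noteq> 0\<close> assms by auto
  have e0: "e0 \<in> E" "c e0 \<noteq> 0" using Max_in[OF fin ne] by (auto simp: e0_def)
  have "e \<le> e0" using \<open>c e \<noteq> 0\<close> assms(3) fin by (auto simp: e0_def)
  then have "d < e0" using assms by simp
  have "((\<lambda>s::real. ((\<Sum>e\<in>E. c e * of_real s powi e) * of_real s powi (- d)) * of_real s powi (d - e0))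
      \<longlongrightarrow> L * 0) at_top"
    by (intro tendsto_mult lim tendsto_powi_neg) (use \<open>d < e0\<close> in simp)
  moreover have "\<forall>\<^sub>F s::real in at_top.
      ((\<Sum>e\<in>E. c e * of_real s powi e) * of_real s powi (- d)) * of_real s powi (d - e0)
       = (\<Sum>e\<in>E. c e * of_real s powi (e - e0))"
    using eventually_gt_at_top[of 0]
  proof eventually_elim
    fix s :: real assume "s > 0"
    then have "(of_real s :: complex) powi e * of_real s powi (- d) * of_real s powi (d - e0)
        = of_real s powi (e - e0)" for e
      by (simp flip: power_int_add)
    then show "((\<Sum>e\<in>E. c e * of_real s powi e) * of_real s powi (- d)) * of_real s powi (d - e0)
       = (\<Sum>e\<in>E. c e * of_real s powi (e - e0))"
      by (simp add: sum_distrib_right mult.assoc)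
  qed
  ultimately have "((\<lambda>s::real. \<Sum>e\<in>E. c e * of_real s powi (e - e0)) \<longlongrightarrow> L * 0) at_top"
    by (rule Lim_transform_eventually)
  moreover have "((\<lambda>s::real. \<Sum>e\<in>E. c e * of_real s powi (e - e0)) \<longlongrightarrow>
      (\<Sum>e\<in>E. if e = e0 then c e0 else 0)) at_top"
  proof (rule tendsto_sum)
    fix e assume e: "e \<in> E"
    consider "e = e0" | "c e = 0" "e \<noteq> e0" | "e < e0" "e \<noteq> e0"
      using e fin by (cases "e = e0"; cases "c e = 0") (auto simp: e0_def order_less_le)
    then show "((\<lambda>s::real. c e * of_real s powi (e - e0)) \<longlongrightarrow> (if e = e0 then c e0 else 0)) at_top"
    proof cases
      case 3
      then show ?thesis using tendsto_mult_right_zero[OF tendsto_powi_neg[of "e - e0"]] by simp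
    qed simp_all
  qed
  ultimately have "(\<Sum>e\<in>E. if e = e0 then c e0 else 0) = L * 0"
    by (intro tendsto_unique[OF trivial_limit_at_top_linorder])
  then show False using e0 assms(1) by simp
qed

lemma leval_scale:
  assumes "s \<noteq> 0"
  shows "leval P (\<lambda>v. x v * s powi w v)
    = (\<Sum>e\<in>wdeg w ` ks P. (\<Sum>m | m \<in> ks P \<and> wdeg w m = e. lk P m * meval x m) * s powi e)"
proof -
  have "leval P (\<lambda>v. x v * s powi w v) = (\<Sum>m\<in>ks P. lk P m * meval x m * s powi wdeg w m)"
    by (simp add: leval_pm_ext pm_ext_def meval_scale[OF assms] mult.assoc)
  also have "\<dots> = (\<Sum>e\<in>wdeg w ` ks P. \<Sum>m | m \<in> ks P \<and> wdeg w m = e. lk P m * meval x m * s powi wdeg w m)"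
    by (rule sum.image_gen) simp
  also have "\<dots> = (\<Sum>e\<in>wdeg w ` ks P. (\<Sum>m | m \<in> ks P \<and> wdeg w m = e. lk P m * meval x m) * s powi e)"
    unfolding sum_distrib_right by (intro sum.cong refl) auto
  finally show ?thesis .
qed

text \<open>Along the curve the monomials group by weight, and the components of different weight
  are the coefficients of a Laurent polynomial in \<open>s\<close>. A growth bound therefore kills,
  at the point \<open>x\<close>, every component of larger weight.\<close>

lemma laurent_growth:
  assumes "((\<lambda>s::real. leval P (\<lambda>v. x v * of_real s powi w v) * of_real s powi (- d)) \<longlongrightarrow> L) at_top"
    and "e > d"
  shows "(\<Sum>m | m \<in> ks P \<and> wdeg w m = e. lk P m * meval x m) = 0"
proof (cases "e \<in> wdeg w ` ks P")
  case True
  let ?c = "\<lambda>e. \<Sum>m | m \<in> ks P \<and> wdeg w m = e. lk P m * meval x m"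
  have "\<forall>\<^sub>F s::real in at_top. leval P (\<lambda>v. x v * of_real s powi w v) * of_real s powi (- d)
      = (\<Sum>e\<in>wdeg w ` ks P. ?c e * of_real s powi e) * of_real s powi (- d)"
    using eventually_gt_at_top[of 0] by eventually_elim (simp add: leval_scale)
  then have "((\<lambda>s::real. (\<Sum>e\<in>wdeg w ` ks P. ?c e * of_real s powi e) * of_real s powi (- d)) \<longlongrightarrow> L) at_top"
    using assms(1) by (rule Lim_transform_eventually[rotated])
  from laurent_growth_univ[OF _ this True assms(2)] show ?thesis by simp
next
  case False
  then have "{m. m \<in> ks P \<and> wdeg w m = e} = {}" by auto
  then show ?thesis by (simp only: sum.empty)
qed

text \<open>Small enough to lie in every generic locus used below, yet large enough to detect the
  zero polynomial. The conditions bind all variables at once, so that no index bounds have to be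
  carried along.\<close>

definition gpts :: "(var \<Rightarrow> complex) set" where
  "gpts = {x. (\<forall>v. x v \<noteq> 0) \<and> inj x \<and> (\<forall>u v. x H * x u \<noteq> x v)}"

text \<open>Reading an exponent vector as the coefficients of an integer polynomial
  \<open>p m\<close>, its weight is the value of \<open>p m\<close> at \<open>K\<close>. Finitely
  many nonzero polynomials have finitely many roots, so any large \<open>K\<close> avoids them all.
  The bound 3 serves \<open>power_sum_neq_power\<close>.\<close>

lemma separating_base:
  assumes "finite D" "0 \<notin> D"
  shows "\<exists>K::nat. K \<ge> 3 \<and> (\<forall>m\<in>D. wdeg (\<lambda>v. int K ^ to_nat v) m \<noteq> 0)"
proof -
  define p where "p m = (\<Sum>v\<in>ks m. monom (lk m v) (to_nat v))" for m :: "var \<Rightarrow>\<^sub>0 int"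
  have pp: "poly (p m) (int K) = wdeg (\<lambda>v. int K ^ to_nat v) m" for m K
    by (simp add: p_def wdeg_def poly_sum poly_monom mult.commute)
  have "p m \<noteq> 0" if "m \<noteq> 0" for m
  proof -
    obtain v where v: "v \<in> ks m" using \<open>m \<noteq> 0\<close> by (metis all_not_in_conv keys_eq_empty)
    have "coeff (p m) (to_nat v) = (\<Sum>u\<in>ks m. if u = v then lk m u else 0)"
      by (auto simp: p_def coeff_sum intro!: sum.cong)
    then have "coeff (p m) (to_nat v) \<noteq> 0" using v by (simp add: in_keys_iff)
    then show ?thesis by auto
  qed
  then have fin: "finite (\<Union>m\<in>D. {r. poly (p m) r = 0})"
    using assms by (intro finite_UN_I poly_roots_finite) metis+
  have "finite {K::nat. int K \<in> (\<Union>m\<in>D. {r. poly (p m) r = 0})}"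
    using finite_vimageI[OF fin, of int] by (simp add: vimage_def)
  then obtain K0 where K0: "\<forall>K\<in>{K::nat. int K \<in> (\<Union>m\<in>D. {r. poly (p m) r = 0})}. K \<le> K0"
    using finite_nat_set_iff_bounded_le by blast
  have "\<forall>m\<in>D. poly (p m) (int (K0 + 3)) \<noteq> 0"
    using K0 by (metis (mono_tags, lifting) UN_I mem_Collect_eq not_add_less1 add_lessD1 leD less_add_same_cancel1 zero_less_numeral)
  then show ?thesis unfolding pp by (intro exI[of _ "K0 + 3"]) simp
qed

text \<open>Equality forces \<open>c\<close> to exceed both exponents, and then the right side is at
  least three times the larger summand. Base 2 would fail for \<open>a = b\<close>.\<close>

lemma power_sum_neq_power:
  fixes K :: nat assumes "K \<ge> 3" shows "K ^ a + K ^ b \<noteq> K ^ c"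
proof
  assume eq: "K ^ a + K ^ b = K ^ c"
  let ?m = "max a b"
  have K: "K > 1" using assms by simp
  have pos: "K ^ a > 0" "K ^ b > 0" using assms by auto
  have "K ^ a < K ^ c" "K ^ b < K ^ c" using eq pos by linarith+
  then have "K ^ ?m < K ^ c" by (simp add: max_def)
  then have "?m < c" using K by (simp add: power_strict_increasing_iff)
  then have "K ^ Suc ?m \<le> K ^ c" using K by (intro power_increasing) auto
  then have "3 * K ^ ?m \<le> K ^ c" using mult_right_mono[OF assms, of "K ^ ?m"] by (metis le0 order_trans power_Suc)
  moreover have "K ^ a \<le> K ^ ?m" "K ^ b \<le> K ^ ?m" using K by (auto intro: power_increasing)
  moreover have "K ^ ?m > 0" using assms by simp
  ultimately show False using eq by linarith
qed

text \<open>On this curve \<open>x H * x u = x v\<close> would mean that two powers of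
  \<open>K\<close> add up to a third. The factor 1 gives the point the scaled form that
  \<open>laurent_growth\<close> expects.\<close>

lemma curve_in_gpts:
  fixes K :: nat assumes "K \<ge> 3" "s > (1::real)"
  shows "(\<lambda>v. 1 * complex_of_real s powi (int K ^ to_nat v)) \<in> gpts"
proof -
  have e: "complex_of_real s powi (int K ^ k) = of_real (s ^ (K ^ k))" for k
    by (metis of_nat_power of_real_power power_int_of_nat)
  have inj: "s ^ a = s ^ b \<longleftrightarrow> a = b" for a b
    using assms(2) by (simp add: power_inject_exp)
  have K1: "K ^ a = K ^ b \<longleftrightarrow> a = b" for a b
    using assms(1) by (intro power_inject_exp) auto
  have "s ^ (K ^ a) * s ^ (K ^ b) \<noteq> s ^ (K ^ c)" for a b c
    using power_sum_neq_power[OF assms(1), of a b c] by (simp add: inj flip: power_add)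
  then have "complex_of_real (s ^ (K ^ a)) * of_real (s ^ (K ^ b)) \<noteq> of_real (s ^ (K ^ c))" for a b c
    by (metis of_real_eq_iff of_real_mult)
  moreover have "inj (\<lambda>v::var. complex_of_real (s ^ (K ^ to_nat v)))"
    by (rule injI) (simp only: of_real_eq_iff inj K1 to_nat_split inj_eq[OF inj_to_nat])
  moreover have "complex_of_real (s ^ k) \<noteq> 0" for k using assms(2) by simp
  ultimately show ?thesis unfolding gpts_def e mult_1 by blast
qed

lemma wdeg_diff: "wdeg w (m - m') = wdeg w m - wdeg w m'"
proof -
  have *: "wdeg w m = (\<Sum>v\<in>A. w v * lk m v)" if "finite A" "ks m \<subseteq> A" for m A
    unfolding wdeg_def by (rule sum.mono_neutral_left) (use that in \<open>auto simp: in_keys_iff\<close>)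
  have "ks (m - m') \<subseteq> ks m \<union> ks m'" by (rule keys_diff)
  then show ?thesis
    by (simp add: *[of "ks m \<union> ks m'"] lookup_minus right_diff_distrib sum_subtractf)
qed

text \<open>With a separating base, each weight along the curve of \<open>curve_in_gpts\<close>
  belongs to a single monomial of \<open>P\<close>. As \<open>P\<close> vanishes on the curve,
  \<open>laurent_growth\<close> with a bound just below the weight of \<open>m\<close> kills the
  coefficient of \<open>m\<close>.\<close>

lemma lpoly_eq_0I:
  assumes "\<And>x. x \<in> gpts \<Longrightarrow> leval P x = 0"
  shows "P = 0"
proof (rule ccontr)
  assume "P \<noteq> 0"
  define D where "D = {m - m' |m m'. m \<in> ks P \<and> m' \<in> ks P \<and> m \<noteq> m'}"
  have "D \<subseteq> (\<lambda>(m, m'). m - m') ` (ks P \<times> ks P)" by (auto simp: D_def)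
  then have "finite D" by (rule finite_subset) simp
  moreover have "0 \<notin> D" by (auto simp: D_def)
  ultimately obtain K :: nat where K: "K \<ge> 3" "\<forall>m\<in>D. wdeg (\<lambda>v. int K ^ to_nat v) m \<noteq> 0"
    using separating_base by blast
  define w where "w = (\<lambda>v::var. int K ^ to_nat v)"
  have inj: "wdeg w m = wdeg w m' \<longleftrightarrow> m = m'" if "m \<in> ks P" "m' \<in> ks P" for m m'
    using K(2) that by (force simp: D_def w_def[symmetric] wdeg_diff)
  obtain m where m: "m \<in> ks P" using \<open>P \<noteq> 0\<close> by (metis all_not_in_conv keys_eq_empty)
  have "\<forall>\<^sub>F s::real in at_top. 0 = leval P (\<lambda>v. 1 * of_real s powi w v) * of_real s powi (- (wdeg w m - 1))"
    using eventually_gt_at_top[of 1]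
    by eventually_elim (simp only: assms curve_in_gpts[OF K(1)] w_def mult_zero_left)
  then have "((\<lambda>s::real. leval P (\<lambda>v. 1 * of_real s powi w v) * of_real s powi (- (wdeg w m - 1))) \<longlongrightarrow> 0) at_top"
    by (rule Lim_transform_eventually[OF tendsto_const])
  from laurent_growth[OF this, of "wdeg w m"]
  have "(\<Sum>m' | m' \<in> ks P \<and> wdeg w m' = wdeg w m. lk P m' * meval (\<lambda>_. 1) m') = 0" by simp
  moreover have "{m'. m' \<in> ks P \<and> wdeg w m' = wdeg w m} = {m}" using m inj by auto
  ultimately show False using m by (simp add: meval_def in_keys_iff)
qed

lemma lpoly_eqI:
  assumes "gpts \<subseteq> X" "\<And>x. x \<in> X \<Longrightarrow> leval P x = leval Q x"
  shows "P = Q"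
proof -
  have "P - Q = 0" by (rule lpoly_eq_0I) (use assms in auto)
  then show ?thesis by simp
qed

subsection \<open>Divisibility by differences of variables\<close>

abbreviation lX :: "var \<Rightarrow> lpoly" where "lX v \<equiv> lmon 1 (ex v)"

lemma lvars_lX: "lvars (lX v) \<subseteq> {v}"
  using lvars_lmon[of 1 "ex v"] by simp

lemma lX_diff_nonzero: "u \<noteq> v \<Longrightarrow> lX u - lX v \<noteq> 0"
proof
  assume "u \<noteq> v" "lX u - lX v = 0"
  then have "lk (lX u - lX v) (ex u) = 0" by simp
  moreover have "ex v \<noteq> ex u" using \<open>u \<noteq> v\<close> by (metis keys_ex singleton_inject)
  ultimately show False by (simp add: lmon_def lookup_minus lookup_single)
qed

text \<open>Factor theorem for Laurent polynomials. By linearity it reduces to monomials, and after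
  splitting off the power of \<open>u\<close> to differences of equal powers of two variables.
  Keeping \<open>V\<close> fixed ensures that the quotient needs no new variables.\<close>

lemma lsubst_congruent:
  assumes "lvars R \<subseteq> V" "u \<in> V" "v \<in> V"
  shows "\<exists>Q. lvars Q \<subseteq> V \<and> R - lsubst (id(u := v)) R = (lX u - lX v) * Q"
proof -
  define D where "D = {R. \<exists>Q. lvars Q \<subseteq> V \<and> R = (lX u - lX v) * Q}"
  have add: "R + S \<in> D" if RS: "R \<in> D" "S \<in> D" for R S
  proof -
    obtain Q Q' where "lvars Q \<subseteq> V" "R = (lX u - lX v) * Q" "lvars Q' \<subseteq> V" "S = (lX u - lX v) * Q'"
      using RS unfolding D_def by blast
    then have "lvars (Q + Q') \<subseteq> V \<and> R + S = (lX u - lX v) * (Q + Q')"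
      by (simp add: lvars_add distrib_left)
    then show ?thesis unfolding D_def by blast
  qed
  have mul: "S * R \<in> D" if RS: "R \<in> D" "lvars S \<subseteq> V" for R S
  proof -
    obtain Q where "lvars Q \<subseteq> V" "R = (lX u - lX v) * Q" using RS(1) unfolding D_def by blast
    then have "lvars (S * Q) \<subseteq> V \<and> S * R = (lX u - lX v) * (S * Q)"
      using RS by (simp add: lvars_mult mult.left_commute)
    then show ?thesis unfolding D_def by blast
  qed
  have sum: "(\<Sum>i\<in>A. f i) \<in> D" if "\<And>i. i \<in> A \<Longrightarrow> f i \<in> D" for f and A :: "(var \<Rightarrow>\<^sub>0 int) set"
    using that
  proof (induction A rule: infinite_finite_induct)
    case (insert a A) then show ?case by (simp add: add)
  qed (auto simp: D_def intro!: exI[of _ 0])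
  have sv: "lvars (lmon c (sg a k)) \<subseteq> V" if "a \<in> V" for a k c
    using lvars_lmon[of c "sg a k"] that by (auto split: if_splits)
  have ms: "lmon 1 (sg a k) * lmon 1 (sg a l) = lmon 1 (sg a (k + l))" for a k l
    by (simp add: lmon_def mult_single flip: single_add)
  have nat: "lmon 1 (sg u (int k)) - lmon 1 (sg v (int k)) \<in> D" for k
  proof (induction k)
    case 0
    show ?case by (auto simp: D_def intro!: exI[of _ 0])
  next
    case (Suc k)
    have "lmon 1 (sg u (int (Suc k))) - lmon 1 (sg v (int (Suc k)))
        = lX u * (lmon 1 (sg u (int k)) - lmon 1 (sg v (int k))) + lmon 1 (sg v (int k)) * (lX u - lX v)"
      by (simp add: algebra_simps ex_def ms)
    moreover have "lX u - lX v \<in> D" by (auto simp: D_def intro!: exI[of _ 1])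
    ultimately show ?case using Suc assms sv[of u 1 1] sv[of v 1 "int k"]
      by (simp only: ex_def add mul)
  qed
  have int: "lmon 1 (sg u k) - lmon 1 (sg v k) \<in> D" for k
  proof (cases "k \<ge> 0")
    case True then show ?thesis using nat[of "nat k"] by simp
  next
    case False
    define j where "j = int (nat (- k))"
    have k: "k = - j" using False by (simp add: j_def)
    have one: "lmon 1 (sg a (- j)) * lmon 1 (sg a j) = 1" for a
      by (simp add: ms) (simp add: lmon_def)
    \<comment> \<open>For negative powers:
      \<open>a^(-j) - b^(-j) = - a^(-j) b^(-j) (a^j - b^j)\<close>.\<close>
    have "lmon 1 (sg u k) - lmon 1 (sg v k)
       = - (lmon 1 (sg u (- j)) * lmon 1 (sg v (- j))) * (lmon 1 (sg u j) - lmon 1 (sg v j))"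
      using one[of u] one[of v] unfolding k by algebra
    moreover have "lvars (- (lmon 1 (sg u (- j)) * lmon 1 (sg v (- j)))) \<subseteq> V"
      using sv assms by (simp add: lvars_mult)
    ultimately show ?thesis using mul[OF nat[of "nat (- k)", folded j_def]] by (simp only:)
  qed
  have mono: "sg m c - sg (mono_map (id(u := v)) m) c \<in> D" if "ks m \<subseteq> V" for m c
  proof -
    define m' where "m' = m - sg u (lk m u)"
    have m: "m = m' + sg u (lk m u)" by (simp add: m'_def)
    have "lk m' u = 0" by (simp add: m'_def lookup_minus)
    then have "mono_map (id(u := v)) m' = m'" by (intro mono_map_ident) (auto simp: in_keys_iff)
    then have mm: "mono_map (id(u := v)) m = m' + sg v (lk m u)" by (subst m) (simp add: mono_map_add)
    have "ks m' \<subseteq> V" using keys_diff[of m "sg u (lk m u)"] that assms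
      by (auto simp: m'_def split: if_splits)
    moreover have "sg m c - sg (mono_map (id(u := v)) m) c
        = lmon c m' * (lmon 1 (sg u (lk m u)) - lmon 1 (sg v (lk m u)))"
      unfolding mm by (subst m) (simp add: lmon_def right_diff_distrib mult_single)
    ultimately show ?thesis using mul[OF int] lvars_lmon[of c m'] by auto
  qed
  have "R - lsubst (id(u := v)) R = (\<Sum>m\<in>ks R. sg m (lk R m) - sg (mono_map (id(u := v)) m) (lk R m))"
    by (subst pm_eq_sum_single[of R]) (simp add: lsubst_def sum_subtractf)
  also have "\<dots> \<in> D" using assms by (intro sum mono) (auto simp: lvars_def)
  finally show ?thesis by (simp add: D_def)
qed

lemma lsubst_eq_0_dvd:
  assumes "lsubst (id(u := v)) R = 0" "lvars R \<subseteq> V" "u \<in> V" "v \<in> V"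
  shows "\<exists>Q. lvars Q \<subseteq> V \<and> R = (lX u - lX v) * Q"
  using lsubst_congruent[OF assms(2-4)] assms(1) by simp

text \<open>Setting \<open>u i := v i\<close> kills the left side, hence \<open>B * Q\<close>, and
  since \<open>B\<close> survives, it kills \<open>Q\<close>. So one difference splits off
  \<open>Q\<close> and cancels. The family is indexed, so a pair may be repeated to obtain
  powers.\<close>

lemma coprime_differences_dvd:
  assumes "finite A" "\<And>i. i \<in> A \<Longrightarrow> u i \<in> V \<and> v i \<in> V \<and> u i \<noteq> v i"
    and "\<And>i. i \<in> A \<Longrightarrow> lsubst (id(u i := v i)) B \<noteq> 0"
    and "(\<Prod>i\<in>A. lX (u i) - lX (v i)) * P = B * Q" "lvars Q \<subseteq> V"
  shows "\<exists>Q'. lvars Q' \<subseteq> V \<and> Q = (\<Prod>i\<in>A. lX (u i) - lX (v i)) * Q'"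
  using assms
proof (induction A arbitrary: Q rule: finite_induct)
  case (insert i A)
  let ?\<Delta> = "\<Prod>i\<in>A. lX (u i) - lX (v i)"
  have eq: "(lX (u i) - lX (v i)) * (?\<Delta> * P) = B * Q"
    using insert.prems(3) insert.hyps by (simp add: mult.assoc)
  have "lsubst (id(u i := v i)) ((lX (u i) - lX (v i)) * (?\<Delta> * P)) = 0"
    by (simp only: lsubst_mult lsubst_diff lsubst_lmon mono_map_ex) simp
  then have "lsubst (id(u i := v i)) B * lsubst (id(u i := v i)) Q = 0"
    unfolding eq lsubst_mult .
  then have "lsubst (id(u i := v i)) Q = 0" using insert.prems(2) by simp
  then obtain Q1 where Q1: "lvars Q1 \<subseteq> V" "Q = (lX (u i) - lX (v i)) * Q1"
    using lsubst_eq_0_dvd insert.prems by (metis insertI1)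
  have "?\<Delta> * P = B * Q1" using eq lX_diff_nonzero[of "u i" "v i"] insert.prems(1)[of i]
    by (simp add: Q1(2) mult.left_commute)
  then obtain Q' where "lvars Q' \<subseteq> V" "Q1 = ?\<Delta> * Q'"
    using insert.IH[of Q1] insert.prems Q1 by blast
  then show ?case using insert.hyps Q1 by (auto simp: mult.assoc)
qed auto

subsection \<open>Functions represented by Laurent polynomials\<close>

text \<open>Regularity of a function given with divisions. The set \<open>X\<close> is essential:
  since division by zero yields 0, agreement with a Laurent polynomial can be expected only away
  from the zeros of the denominators.\<close>

definition laur :: "(var \<Rightarrow> complex) set \<Rightarrow> var set \<Rightarrow> ((var \<Rightarrow> complex) \<Rightarrow> complex) \<Rightarrow> bool" where
  "laur X V f \<longleftrightarrow> (\<exists>P. lvars P \<subseteq> V \<and> (\<forall>x\<in>X. f x = leval P x))"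

lemma laurI: "lvars P \<subseteq> V \<Longrightarrow> (\<And>x. x \<in> X \<Longrightarrow> f x = leval P x) \<Longrightarrow> laur X V f"
  by (auto simp: laur_def)

lemma laur_cong: "(\<And>x. x \<in> X \<Longrightarrow> f x = g x) \<Longrightarrow> laur X V f \<longleftrightarrow> laur X V g"
  by (auto simp: laur_def)

lemma laur_const [intro!, simp]: "laur X V (\<lambda>x. c)"
  by (rule laurI[of "lmon c 0"]) (use lvars_lmon[of c 0] in auto)

lemma laur_var [intro!, simp]: "v \<in> V \<Longrightarrow> laur X V (\<lambda>x. x v)"
  by (rule laurI[of "lX v"]) (use lvars_lX[of v] in auto)

lemma laur_add: "laur X V f \<Longrightarrow> laur X V g \<Longrightarrow> laur X V (\<lambda>x. f x + g x)"
  unfolding laur_def by (metis lvars_add leval_add)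

lemma laur_diff: "laur X V f \<Longrightarrow> laur X V g \<Longrightarrow> laur X V (\<lambda>x. f x - g x)"
  unfolding laur_def by (metis lvars_diff leval_diff)

lemma laur_sum: "(\<And>i. i \<in> A \<Longrightarrow> laur X V (f i)) \<Longrightarrow> laur X V (\<lambda>x. \<Sum>i\<in>A. f i x)"
  by (induction A rule: infinite_finite_induct) (simp_all add: laur_add)

context
  fixes X assumes X: "X \<subseteq> torus"
begin

lemma laur_mult: "laur X V f \<Longrightarrow> laur X V g \<Longrightarrow> laur X V (\<lambda>x. f x * g x)"
  unfolding laur_def using X by (metis (no_types, lifting) lvars_mult leval_mult subsetD)

lemma laur_prod: "(\<And>i. i \<in> A \<Longrightarrow> laur X V (f i)) \<Longrightarrow> laur X V (\<lambda>x. \<Prod>i\<in>A. f i x)"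
  by (induction A rule: infinite_finite_induct) (simp_all add: laur_mult)

lemma laur_power: "laur X V f \<Longrightarrow> laur X V (\<lambda>x. f x ^ k)"
  by (induction k) (simp_all add: laur_mult)

lemma laur_divide_var: "laur X V f \<Longrightarrow> v \<in> V \<Longrightarrow> laur X V (\<lambda>x. f x / x v)"
proof -
  assume "laur X V f" "v \<in> V"
  have "lvars (lmon 1 (- ex v)) \<subseteq> V" using lvars_lmon[of 1 "- ex v"] \<open>v \<in> V\<close> by auto
  moreover have "1 / x v = leval (lmon 1 (- ex v)) x" if "x \<in> X" for x
    using that X by (simp add: meval_uminus subsetD inverse_eq_divide)
  ultimately have "laur X V (\<lambda>x. 1 / x v)" by (rule laurI)
  from laur_mult[OF \<open>laur X V f\<close> this] show ?thesis by simp
qed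

lemma laur_subst:
  assumes "laur Y W f" "\<And>x. x \<in> X \<Longrightarrow> x \<circ> g \<in> Y" "g ` W \<subseteq> V"
  shows "laur X V (\<lambda>x. f (x \<circ> g))"
proof -
  obtain P where P: "lvars P \<subseteq> W" "\<forall>y\<in>Y. f y = leval P y" using assms(1) by (auto simp: laur_def)
  have "lvars (lsubst g P) \<subseteq> V" using lvars_lsubst[of g P] P(1) assms(3) by blast
  then show ?thesis using P assms(2) X by (intro laurI[of "lsubst g P"]) (auto simp: leval_lsubst subsetD)
qed

end

text \<open>A difference of two distinct variables collapses under \<open>u := v\<close> only if
  these variables are \<open>u\<close> and \<open>v\<close>.\<close>

lemma prod_differences_subst_nonzero:
  assumes "finite A" "(u, v) \<notin> A" "(v, u) \<notin> A" "\<forall>(a, b)\<in>A. a \<noteq> b"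
  shows "lsubst (id(u := v)) (\<Prod>(a, b)\<in>A. lX a - lX b) \<noteq> 0"
  using assms lX_diff_nonzero
  by (auto simp: lsubst_prod lsubst_diff case_prod_beta split: if_splits; metis)

text \<open>If \<open>f (x\<^sub>u - x\<^sub>v) C\<close> is the Laurent polynomial \<open>R\<close>, then transposing \<open>u\<close> and \<open>v\<close> and
  restricting to \<open>x\<^sub>u = x\<^sub>v\<close> gives \<open>2 R C = 0\<close> there, so the simple pole cancels.\<close>

lemma laur_symmetric_poles:
  assumes "finite A" "X \<subseteq> torus" "gpts \<subseteq> X"
    and "\<forall>(u, v)\<in>A. u \<noteq> v \<and> (v, u) \<notin> A \<and> u \<in> V \<and> v \<in> V"
    and "\<forall>(u, v)\<in>A. \<forall>x\<in>X. x u \<noteq> x v \<and> x \<circ> transpose u v \<in> X \<and> f (x \<circ> transpose u v) = f x"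
    and "laur X V (\<lambda>x. f x * (\<Prod>(u, v)\<in>A. x u - x v))"
  shows "laur X V f"
  using assms(1,4-6)
proof (induction A rule: finite_induct)
  case empty
  then show ?case by simp
next
  case (insert p A)
  obtain u v where p: "p = (u, v)" by (cases p)
  define s where "s = transpose u v"
  define g where "g = (id(u := v) :: var \<Rightarrow> var)"
  define C where "C = (\<Prod>(a, b)\<in>A. lX a - lX b)"
  have uv: "u \<noteq> v" "(v, u) \<notin> A" "(u, v) \<notin> A" "u \<in> V" "v \<in> V"
    using insert.prems(1) insert.hyps p by auto
  have X: "x \<in> torus" if "x \<in> X" for x using assms(2) that by blast
  have C: "leval C x = (\<Prod>(a, b)\<in>A. x a - x b)" if "x \<in> torus" for x
    using that by (simp add: C_def case_prod_beta)
  have sym: "x u \<noteq> x v" "x \<circ> s \<in> X" "f (x \<circ> s) = f x" if "x \<in> X" for x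
    using insert.prems(2) that unfolding p s_def by blast+
  obtain R where R: "lvars R \<subseteq> V" "\<And>x. x \<in> X \<Longrightarrow> f x * ((x u - x v) * leval C x) = leval R x"
    using insert.prems(3) insert.hyps p C X by (auto simp: laur_def)
  have "R * lsubst s C + lsubst s R * C = 0"
  proof (rule lpoly_eqI[OF assms(3)])
    fix x assume x: "x \<in> X"
    have "leval R (x \<circ> s) = f x * ((x v - x u) * leval C (x \<circ> s))"
      using R(2)[of "x \<circ> s"] sym[OF x] by (simp add: s_def)
    then show "leval (R * lsubst s C + lsubst s R * C) x = leval 0 x"
      using X[OF x] by (simp add: leval_lsubst flip: R(2)[OF x]) (simp add: algebra_simps)
  qed
  then have "lsubst g (R * lsubst s C + lsubst s R * C) = 0" by simp
  \<comment> \<open>Once the two variables are identified, transposing them first has no effect.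
    Hence \<open>C\<close> and its transposed version become equal even if other pairs in
    \<open>A\<close> involve \<open>u\<close> or \<open>v\<close>.\<close>
  moreover have "g \<circ> s = g" by (auto simp: g_def s_def fun_eq_iff transpose_def)
  ultimately have "lsubst g R * lsubst g C + lsubst g R * lsubst g C = 0"
    by (simp add: lsubst_add lsubst_mult lsubst_comp)
  then have "lsubst g R * lsubst g C = 0"
    by (simp flip: mult_2)
  moreover have "lsubst g C \<noteq> 0"
    unfolding g_def C_def
    by (rule prod_differences_subst_nonzero) (use insert.hyps insert.prems(1) uv in auto)
  ultimately have "lsubst g R = 0" by simp
  then obtain R' where R': "lvars R' \<subseteq> V" "R = (lX u - lX v) * R'"
    unfolding g_def using lsubst_eq_0_dvd R(1) uv by blast
  have "laur X V (\<lambda>x. f x * (\<Prod>(u, v)\<in>A. x u - x v))"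
  proof (rule laurI[OF R'(1)])
    fix x assume x: "x \<in> X"
    have "(x u - x v) * (f x * leval C x) = (x u - x v) * leval R' x"
      using R(2)[OF x] X[OF x] by (simp add: R'(2) algebra_simps)
    then show "f x * (\<Prod>(u, v)\<in>A. x u - x v) = leval R' x" using sym[OF x] C X[OF x] by simp
  qed
  with insert.IH insert.prems show ?case by auto
qed

lemma lmon_add: "lmon 1 (m + m') = lmon 1 m * lmon 1 m'"
  by (simp add: lmon_def mult_single)

lemma lmon_one: "lmon 1 0 = 1"
  by (simp add: lmon_def)

lemma lmon_sum: "lmon 1 (\<Sum>j\<in>A. f j) = (\<Prod>j\<in>A. lmon 1 (f j))"
  by (induction A rule: infinite_finite_induct) (simp_all add: lmon_add lmon_one)

section \<open>Ordered set partitions\<close>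

text \<open>Two enumerations of a set differ by a permutation of the indices. In this way a renaming
  of the \<open>z\<close> is turned into a permutation of arguments, to which the symmetry of a
  weight function or of a class applies.\<close>

lemma matching_permutation:
  assumes "bij_betw e A S" "bij_betw f A S"
  obtains \<rho> where "\<rho> permutes A" "\<And>a. a \<in> A \<Longrightarrow> e (\<rho> a) = f a"
proof
  define \<rho> where "\<rho> a = (if a \<in> A then inv_into A e (f a) else a)" for a
  have "bij_betw (inv_into A e \<circ> f) A A"
    using assms by (intro bij_betw_trans[OF assms(2)] bij_betw_inv_into)
  then have "bij_betw \<rho> A A" by (rule bij_betw_cong[THEN iffD1, rotated]) (simp add: \<rho>_def)
  then show "\<rho> permutes A" by (rule bij_imp_permutes) (simp add: \<rho>_def)
  show "e (\<rho> a) = f a" if "a \<in> A" for a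
    using assms that by (simp add: \<rho>_def) (metis bij_betw_def f_inv_into_f imageI)
qed

lemma elt_bij: "finite S \<Longrightarrow> bij_betw (elt S) {1..card S} S"
proof -
  assume S: "finite S"
  have "bij_betw (\<lambda>a. a - 1) {1..card S} {..<card S}"
    by (rule bij_betwI[where g = Suc]) auto
  moreover have "bij_betw ((!) (sorted_list_of_set S)) {..<card S} S"
    using bij_betw_nth[of "sorted_list_of_set S"] S by (simp add: lessThan_def)
  ultimately show ?thesis
    using bij_betw_trans by (fastforce simp: elt_def[abs_def] comp_def)
qed

lemma elt_less_iff:
  assumes "finite S" "a \<in> {1..card S}" "b \<in> {1..card S}"
  shows "elt S a < elt S b \<longleftrightarrow> a < b"
proof -
  have *: "elt S a < elt S b" if "a < b" "a \<in> {1..card S}" "b \<in> {1..card S}" for a b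
    using that assms(1) sorted_wrt_nth_less[OF strict_sorted_list_of_set[of S], of "a - 1" "b - 1"]
    by (auto simp: elt_def)
  show ?thesis using *[of a b] *[of b a] assms by (cases a b rule: linorder_cases) auto
qed

text \<open>Outside \<open>K\<close> a component permutes the empty set and is thus the identity, so
  a family is determined by its restriction to \<open>K\<close>.\<close>

lemma finite_perm_families:
  assumes "finite K" "\<And>k. finite (S k)" "\<And>k. k \<notin> K \<Longrightarrow> S k = {}"
  shows "finite {\<pi> :: nat \<Rightarrow> nat \<Rightarrow> nat. \<forall>k. \<pi> k permutes S k}"
proof (rule inj_on_finite)
  show "inj_on (\<lambda>\<pi>. restrict \<pi> K) {\<pi> :: nat \<Rightarrow> nat \<Rightarrow> nat. \<forall>k. \<pi> k permutes S k}"
  proof (rule inj_onI, rule ext)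
    fix \<pi> \<rho> :: "nat \<Rightarrow> nat \<Rightarrow> nat" and k
    assume *: "\<pi> \<in> {\<pi>. \<forall>k. \<pi> k permutes S k}" "\<rho> \<in> {\<pi>. \<forall>k. \<pi> k permutes S k}"
      "restrict \<pi> K = restrict \<rho> K"
    show "\<pi> k = \<rho> k"
    proof (cases "k \<in> K")
      case True then show ?thesis using *(3) by (metis restrict_apply')
    next
      case False
      then have "S k = {}" by (rule assms)
      moreover have "\<pi> k permutes S k" "\<rho> k permutes S k" using * by blast+
      ultimately show ?thesis by (simp add: permutes_empty)
    qed
  qed
  show "(\<lambda>\<pi>. restrict \<pi> K) ` {\<pi> :: nat \<Rightarrow> nat \<Rightarrow> nat. \<forall>k. \<pi> k permutes S k}
      \<subseteq> PiE K (\<lambda>k. {p. p permutes S k})" by auto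
  show "finite (PiE K (\<lambda>k. {p. p permutes S k}))"
    using assms by (intro finite_PiE finite_permutations) auto
qed

lemma perm_families_compose:
  assumes "\<And>k. \<rho> k permutes S k"
  shows "bij_betw (\<lambda>\<pi> k. \<rho> k \<circ> \<pi> k) {\<pi> :: nat \<Rightarrow> nat \<Rightarrow> nat. \<forall>k. \<pi> k permutes S k} {\<pi>. \<forall>k. \<pi> k permutes S k}"
  by (rule bij_betwI[where g = "\<lambda>\<pi> k. inv (\<rho> k) \<circ> \<pi> k"])
     (auto simp: permutes_compose assms permutes_inv o_assoc permutes_inv_o[OF assms])

lemma lamc_0 [simp]: "lamc lam 0 = 0"
  by (simp add: lamc_def)

lemma lamc_Suc [simp]: "lamc lam (Suc k) = lamc lam k + lam (Suc k)"
  by (simp add: lamc_def)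

lemma lamc_mono: "k \<le> l \<Longrightarrow> lamc lam k \<le> lamc lam l"
  unfolding lamc_def by (rule sum_mono2) auto

lemma lamc_pred: "k \<ge> 1 \<Longrightarrow> lamc lam k = lamc lam (k - 1) + lam k"
  using lamc_Suc[of lam "k - 1"] by simp

text \<open>Blocks may be empty, so several partial sums can coincide; the strict lower bound
  singles out the block that really contains \<open>i\<close>.\<close>

lemma blkidx_eq:
  assumes "k \<ge> 1" "lamc lam (k - 1) < i" "i \<le> lamc lam k"
  shows "blkidx lam i = k"
  unfolding blkidx_def
proof (rule Least_equality)
  fix l assume "i \<le> lamc lam l"
  show "k \<le> l"
  proof (rule ccontr)
    assume "\<not> k \<le> l"
    then have "lamc lam l \<le> lamc lam (k - 1)" by (intro lamc_mono) simp
    then show False using \<open>i \<le> lamc lam l\<close> assms by simp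
  qed
qed (fact assms(3))

locale flag_type =
  fixes N n :: nat and lam :: "nat \<Rightarrow> nat"
  assumes N_pos: "1 \<le> N" and sum_lam: "(\<Sum>k\<in>{1..N}. lam k) = n"
begin

lemma lamc_N: "lamc lam N = n"
  unfolding lamc_def by (rule sum_lam)

lemma ordpart_cup:
  assumes "ordpart N n lam J" "k \<le> N"
  shows "cup J k \<subseteq> {1..n}" "finite (cup J k)" "card (cup J k) = lamc lam k"
proof -
  show 1: "cup J k \<subseteq> {1..n}" using assms by (fastforce simp: cup_def ordpart_def)
  then show "finite (cup J k)" by (rule finite_subset) simp
  have fin: "finite (J l)" if "l \<in> {1..k}" for l
    using assms that by (intro finite_subset[of "J l" "{1..n}"]) (auto simp: ordpart_def)
  have "card (cup J k) = (\<Sum>l\<in>{1..k}. card (J l))"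
    unfolding cup_def using assms fin by (intro card_UN_disjoint) (auto simp: ordpart_def)
  then show "card (cup J k) = lamc lam k" using assms by (auto simp: lamc_def ordpart_def)
qed

lemma blkidx_bounds:
  assumes "i \<in> {1..n}"
  shows "blkidx lam i \<in> {1..N}" "lamc lam (blkidx lam i - 1) < i" "i \<le> lamc lam (blkidx lam i)"
proof -
  let ?k = "blkidx lam i"
  have iN: "i \<le> lamc lam N" using assms lamc_N by simp
  show le: "i \<le> lamc lam ?k" unfolding blkidx_def using iN by (rule LeastI)
  have "?k \<le> N" unfolding blkidx_def using iN by (rule Least_le)
  moreover have "?k \<noteq> 0"
  proof
    assume "?k = 0" with le assms show False by simp
  qed
  ultimately show "?k \<in> {1..N}" by simp
  then have "?k - 1 < ?k" by simp
  then have "\<not> i \<le> lamc lam (?k - 1)" unfolding blkidx_def by (rule not_less_Least)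
  then show "lamc lam (?k - 1) < i" by simp
qed

section \<open>Injectivity of localization\<close>

text \<open>The \<gamma> variables listed block after block with a single index, as required by the
  staircase reduction.\<close>

definition gvar :: "nat \<Rightarrow> var" where
  "gvar i = z2gam lam (Z i)"

lemma gvar_lamc_add:
  assumes "k \<in> {1..N}" "a \<in> {1..lam k}"
  shows "lamc lam (k - 1) + a \<in> {1..n}" "gvar (lamc lam (k - 1) + a) = Gam k a"
proof -
  have le: "lamc lam (k - 1) + a \<le> lamc lam k" using assms by (simp add: lamc_pred[of k])
  moreover have "lamc lam k \<le> n" using assms lamc_mono[of k N lam] lamc_N by simp
  ultimately show "lamc lam (k - 1) + a \<in> {1..n}" using assms by auto
  have "blkidx lam (lamc lam (k - 1) + a) = k" using assms le by (intro blkidx_eq) auto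
  then show "gvar (lamc lam (k - 1) + a) = Gam k a" by (simp add: gvar_def z2gam_def)
qed

lemma gvar_cases:
  assumes "i \<in> {1..n}"
  obtains k a where "k \<in> {1..N}" "a \<in> {1..lam k}" "i = lamc lam (k - 1) + a" "gvar i = Gam k a"
proof
  let ?k = "blkidx lam i"
  show 1: "?k \<in> {1..N}" and 2: "i - lamc lam (?k - 1) \<in> {1..lam ?k}"
    and 3: "i = lamc lam (?k - 1) + (i - lamc lam (?k - 1))"
    using blkidx_bounds[OF assms] lamc_pred[of ?k lam] by auto
  show "gvar i = Gam ?k (i - lamc lam (?k - 1))" using gvar_lamc_add(2)[OF 1 2] 3 by simp
qed

abbreviation "gvars \<equiv> {Gam k a | k a. k \<in> {1..N} \<and> a \<in> {1..lam k}}"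

lemma gvar_bij: "bij_betw gvar {1..n} gvars"
proof (rule bij_betwI')
  fix i j assume "i \<in> {1..n}" "j \<in> {1..n}"
  then show "gvar i = gvar j \<longleftrightarrow> i = j" by (metis gvar_cases var.inject(1))
next
  fix i assume "i \<in> {1..n}"
  then show "gvar i \<in> gvars" by (rule gvar_cases) blast
next
  fix v assume "v \<in> gvars"
  then obtain k a where "v = Gam k a" "k \<in> {1..N}" "a \<in> {1..lam k}" by blast
  then show "\<exists>i\<in>{1..n}. v = gvar i" using gvar_lamc_add[of k a] by metis
qed

lemma gvar_in_Kvars: "i \<in> {1..n} \<Longrightarrow> gvar i \<in> Kvars N n lam"
  using bij_betw_apply[OF gvar_bij] by (auto simp: Kvars_def)

lemma Kvars_cases:
  assumes "v \<in> Kvars N n lam"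
  obtains i where "i \<in> {1..n}" "v = gvar i" | "v \<in> ZHvars n"
proof (cases "v \<in> gvars")
  case True
  then have "v \<in> gvar ` {1..n}" using gvar_bij by (simp add: bij_betw_def)
  then show ?thesis using that(1) by blast
next
  case False
  then show ?thesis using assms that(2) by (auto simp: Kvars_def)
qed

lemma ZH_Kvars: "ZHvars n \<subseteq> Kvars N n lam"
  by (auto simp: Kvars_def)

section \<open>The ideal of relations and staircase remainders\<close>

lemma z2gam_Z: "z2gam lam (Z i) = gvar i"
  by (simp add: gvar_def)

definition symrel :: "lpoly \<Rightarrow> lpoly" where
  "symrel f = lsubst (z2gam lam) f - f"

lemma lvars_symrel:
  assumes "symz n f" shows "lvars (symrel f) \<subseteq> Kvars N n lam"
proof -
  have f: "lvars f \<subseteq> Z ` {1..n}" using assms by (auto simp: symz_def)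
  then have "lvars (lsubst (z2gam lam) f) \<subseteq> gvar ` {1..n}"
    using lvars_lsubst[of "z2gam lam" f] by (force simp: gvar_def)
  then have "lvars (lsubst (z2gam lam) f) \<subseteq> Kvars N n lam" using gvar_in_Kvars by blast
  moreover have "lvars f \<subseteq> Kvars N n lam" using f ZH_Kvars by (force simp: ZHvars_def)
  ultimately show ?thesis by (simp add: symrel_def lvars_diff)
qed

text \<open>The ideal generated by the relations in the ring of all Laurent polynomials in \<gamma>,
  \<open>z\<close> and \<open>h\<close>. The coefficients need not be invariant under the block
  permutations, so variables can be reduced one at a time; averaging leads back to
  \<open>in_ideal\<close>.\<close>

inductive_set jid :: "lpoly set" where
  zero: "0 \<in> jid"
| step: "P \<in> jid \<Longrightarrow> lvars c \<subseteq> Kvars N n lam \<Longrightarrow> symz n f \<Longrightarrow> P + c * symrel f \<in> jid"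

lemma jid_add: "P \<in> jid \<Longrightarrow> Q \<in> jid \<Longrightarrow> P + Q \<in> jid"
proof (rotate_tac 1, induction Q rule: jid.induct)
  case (step Q c f)
  then show ?case using jid.step[of "P + Q" c f] by (simp add: add.assoc)
qed simp

lemma jid_mult: "P \<in> jid \<Longrightarrow> lvars Q \<subseteq> Kvars N n lam \<Longrightarrow> Q * P \<in> jid"
proof (induction P rule: jid.induct)
  case (step P c f)
  then show ?case using jid.step[of "Q * P" "Q * c" f]
    by (simp add: lvars_mult distrib_left mult.assoc)
qed (simp add: jid.zero)

lemma jid_gen: "lvars c \<subseteq> Kvars N n lam \<Longrightarrow> symz n f \<Longrightarrow> c * symrel f \<in> jid"
  using jid.step[OF jid.zero, of c f] by simp

lemma jid_sum: "(\<And>i. i \<in> A \<Longrightarrow> f i \<in> jid) \<Longrightarrow> (\<Sum>i\<in>A. f i) \<in> jid"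
  by (induction A rule: infinite_finite_induct) (simp_all add: jid.zero jid_add)

lemma lvars_jid: "P \<in> jid \<Longrightarrow> lvars P \<subseteq> Kvars N n lam"
  by (induction P rule: jid.induct) (simp_all add: lvars_add lvars_mult lvars_symrel)

lemma lvars_power: "lvars F \<subseteq> V \<Longrightarrow> lvars (F ^ d) \<subseteq> V"
  by (induction d) (simp_all add: lvars_mult)

abbreviation gX :: "nat \<Rightarrow> lpoly" where "gX i \<equiv> lX (gvar i)"

text \<open>Modulo the ideal, the \<open>i\<close>-th variable is a root of the monic \<open>tailpoly i\<close> of degree \<open>n - i + 1\<close>,
  whose coefficients reduce to polynomials in the preceding variables. Hence everything reduces to the
  staircase monomials.\<close>

fun stair :: "nat \<Rightarrow> lpoly set" where
  "stair 0 = {P. lvars P \<subseteq> ZHvars n}"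
| "stair (Suc i) = {\<Sum>d\<le>n - Suc i. gX (Suc i) ^ d * y d | y. \<forall>d. y d \<in> stair i}"

definition smod :: "nat \<Rightarrow> lpoly set" where
  "smod i = {P + Q | P Q. P \<in> stair i \<and> Q \<in> jid}"

lemma lvars_gX: "i \<in> {1..n} \<Longrightarrow> lvars (gX i ^ d) \<subseteq> Kvars N n lam"
  using gvar_in_Kvars lvars_lX[of "gvar i"] by (intro lvars_power) auto

text \<open>Ideal elements can be absorbed into the coefficient of degree 0, so adding the ideal at
  the end amounts to adding it to the coefficients.\<close>

lemma smod_Suc:
  assumes "Suc i \<le> n"
  shows "smod (Suc i) = {\<Sum>d\<le>n - Suc i. gX (Suc i) ^ d * x d | x. \<forall>d. x d \<in> smod i}"
proof (intro equalityI subsetI)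
  fix P assume "P \<in> smod (Suc i)"
  then obtain y q where y: "\<forall>d. y d \<in> stair i" "q \<in> jid" "P = (\<Sum>d\<le>n - Suc i. gX (Suc i) ^ d * y d) + q"
    by (auto simp: smod_def)
  define x where "x d = y d + (if d = 0 then q else 0)" for d
  have "x d \<in> smod i" for d using y jid.zero unfolding x_def smod_def by force
  moreover have "P = (\<Sum>d\<le>n - Suc i. gX (Suc i) ^ d * x d)"
    by (simp add: y(3) x_def distrib_left sum.distrib if_distrib[of "(*) _"] cong: if_cong)
  ultimately show "P \<in> {\<Sum>d\<le>n - Suc i. gX (Suc i) ^ d * x d | x. \<forall>d. x d \<in> smod i}" by blast
next
  fix P assume "P \<in> {\<Sum>d\<le>n - Suc i. gX (Suc i) ^ d * x d | x. \<forall>d. x d \<in> smod i}"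
  then obtain x where x: "\<forall>d. x d \<in> smod i" "P = (\<Sum>d\<le>n - Suc i. gX (Suc i) ^ d * x d)" by blast
  have "\<forall>d. \<exists>y q. y \<in> stair i \<and> q \<in> jid \<and> x d = y + q" using x(1) by (force simp: smod_def)
  then obtain y q where yq: "\<And>d. y d \<in> stair i" "\<And>d. q d \<in> jid" "\<And>d. x d = y d + q d" by metis
  have "P = (\<Sum>d\<le>n - Suc i. gX (Suc i) ^ d * y d) + (\<Sum>d\<le>n - Suc i. gX (Suc i) ^ d * q d)"
    by (simp add: x(2) yq(3) distrib_left sum.distrib)
  moreover have "(\<Sum>d\<le>n - Suc i. gX (Suc i) ^ d * y d) \<in> stair (Suc i)" using yq(1) by auto
  moreover have "(\<Sum>d\<le>n - Suc i. gX (Suc i) ^ d * q d) \<in> jid"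
    by (intro jid_sum jid_mult yq lvars_gX) (use assms in auto)
  ultimately show "P \<in> smod (Suc i)" unfolding smod_def by blast
qed

definition tailpoly :: "nat \<Rightarrow> lpoly poly" where
  "tailpoly i = (\<Prod>j\<in>{i..n}. [:- gX j, 1:])"

lemma coeff_linear_mult:
  fixes a :: "'r::comm_ring_1"
  shows "coeff ([:- a, 1:] * p) d = (case d of 0 \<Rightarrow> - a * coeff p 0 | Suc e \<Rightarrow> coeff p e - a * coeff p (Suc e))"
  by (cases d) simp_all

lemma coeff_prod_linear_lsubst:
  "coeff (\<Prod>j\<in>A. [:- lsubst f (a j), 1:]) d = lsubst f (coeff (\<Prod>j\<in>A. [:- a j, 1:]) d)"
proof (induction A arbitrary: d rule: infinite_finite_induct)
  case (insert j A)
  then show ?case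
    unfolding prod.insert[OF insert.hyps] coeff_linear_mult
    by (simp add: lsubst_diff lsubst_mult lsubst_uminus split: nat.split)
qed (simp_all add: coeff_1)

lemma lvars_coeff_prod_linear:
  assumes "\<And>j. j \<in> A \<Longrightarrow> lvars (a j) \<subseteq> V"
  shows "lvars (coeff (\<Prod>j\<in>A. [:- a j, 1:]) d) \<subseteq> V"
  using assms
proof (induction A arbitrary: d rule: infinite_finite_induct)
  case (insert j A)
  then have "lvars (a j) \<subseteq> V" "\<And>d. lvars (coeff (\<Prod>j\<in>A. [:- a j, 1:]) d) \<subseteq> V" by auto
  then show ?case
    unfolding prod.insert[OF insert.hyps] coeff_linear_mult
    by (simp add: lvars_diff lvars_mult split: nat.split)
qed (simp_all add: coeff_1)

lemma symz_coeff: "symz n (coeff (\<Prod>j\<in>{1..n}. [:- lX (Z j), 1:]) d)"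
  unfolding symz_def
proof (intro conjI allI impI)
  show "lvars (coeff (\<Prod>j\<in>{1..n}. [:- lX (Z j), 1:]) d) \<subseteq> {Z a |a. a \<in> {1..n}}"
    by (rule lvars_coeff_prod_linear) (use lvars_lX in blast)
  fix \<tau> assume \<tau>: "\<tau> permutes {1..n}"
  have "lsubst (zperm \<tau>) (coeff (\<Prod>j\<in>{1..n}. [:- lX (Z j), 1:]) d)
      = coeff (\<Prod>j\<in>{1..n}. [:- lX (Z (\<tau> j)), 1:]) d"
    by (simp add: zperm_def flip: coeff_prod_linear_lsubst)
  also have "(\<Prod>j\<in>{1..n}. [:- lX (Z (\<tau> j)), 1:]) = (\<Prod>j\<in>{1..n}. [:- lX (Z j), 1:])"
    using prod.permute[OF \<tau>, of "\<lambda>j. [:- lX (Z j), 1:]"] by (simp add: o_def)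
  finally show "lsubst (zperm \<tau>) (coeff (\<Prod>j\<in>{1..n}. [:- lX (Z j), 1:]) d)
      = coeff (\<Prod>j\<in>{1..n}. [:- lX (Z j), 1:]) d" .
qed

text \<open>\<open>tailpoly 1\<close> has all \<gamma> as roots. Up to sign its coefficients are the
  elementary symmetric functions, which the relations identify with those of the
  \<open>z\<close>.\<close>

lemma coeff_tailpoly_1: "coeff (tailpoly 1) d \<in> smod 0"
proof -
  let ?f = "coeff (\<Prod>j\<in>{1..n}. [:- lX (Z j), 1:]) d"
  have "coeff (tailpoly 1) d = lsubst (z2gam lam) ?f"
    unfolding tailpoly_def by (subst coeff_prod_linear_lsubst[symmetric]) (simp add: z2gam_Z)
  also have "\<dots> = ?f + 1 * symrel ?f" by (simp add: symrel_def)
  finally have "coeff (tailpoly 1) d = ?f + 1 * symrel ?f" .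
  moreover have "1 * symrel ?f \<in> jid" by (rule jid_gen[OF _ symz_coeff]) simp
  moreover have "?f \<in> stair 0" using symz_coeff[of d] by (auto simp: symz_def ZHvars_def)
  ultimately show ?thesis unfolding smod_def by blast
qed

text \<open>One induction for facts that feed each other: the coefficients of
  \<open>tailpoly (Suc i)\<close> give the relation by which the span of powers of the next variable
  is closed under products, and closure lets the next tail polynomial be obtained by dividing off a
  linear factor.\<close>

lemma smod_invariants:
  assumes "i \<le> n"
  shows "(\<forall>P\<in>smod i. \<forall>Q\<in>smod i. P + Q \<in> smod i \<and> P * Q \<in> smod i)
    \<and> {P. lvars P \<subseteq> ZHvars n} \<subseteq> smod i \<and> jid \<subseteq> smod i \<and> (\<forall>j\<in>{1..i}. gX j \<in> smod i)
    \<and> (\<forall>d. coeff (tailpoly (Suc i)) d \<in> smod i)"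
  using assms
proof (induction i)
  case 0
  have "P + Q \<in> smod 0 \<and> P * Q \<in> smod 0" if PQ: "P \<in> smod 0" "Q \<in> smod 0" for P Q
  proof -
    obtain p q where pq: "lvars p \<subseteq> ZHvars n" "q \<in> jid" "P = p + q"
      using PQ(1) unfolding smod_def by auto
    obtain p' q' where pq': "lvars p' \<subseteq> ZHvars n" "q' \<in> jid" "Q = p' + q'"
      using PQ(2) unfolding smod_def by auto
    have K: "lvars p \<subseteq> Kvars N n lam" "lvars p' \<subseteq> Kvars N n lam" "lvars q \<subseteq> Kvars N n lam"
      using pq pq' ZH_Kvars lvars_jid by blast+
    have "P + Q = (p + p') + (q + q')" by (simp add: pq pq')
    moreover have "P * Q = p * p' + (p * q' + p' * q + q * q')"
      by (simp add: pq pq' algebra_simps)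
    moreover have "p * q' + p' * q + q * q' \<in> jid" using K pq pq' by (intro jid_add jid_mult)
    moreover have "lvars (p + p') \<subseteq> ZHvars n" "lvars (p * p') \<subseteq> ZHvars n" "q + q' \<in> jid"
      using pq pq' by (simp_all add: lvars_add lvars_mult jid_add)
    ultimately show ?thesis unfolding smod_def stair.simps by blast
  qed
  moreover have "{P. lvars P \<subseteq> ZHvars n} \<subseteq> smod 0"
    unfolding smod_def stair.simps using jid.zero by force
  moreover have "jid \<subseteq> smod 0" unfolding smod_def stair.simps by (force intro: exI[of _ 0])
  ultimately show ?case using coeff_tailpoly_1 by auto
next
  case (Suc i)
  define k where "k = Suc i"
  define m where "m = n - k"
  define g where "g = gX k"
  have kn: "k \<le> n" "i \<le> n" "Suc m = Suc n - k" using Suc.prems by (auto simp: k_def m_def)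
  have IH: "P + Q \<in> smod i" "P * Q \<in> smod i" if "P \<in> smod i" "Q \<in> smod i" for P Q
    using Suc kn that by blast+
  have R: "P \<in> smod i" if "lvars P \<subseteq> ZHvars n" for P using Suc kn that by blast
  have J: "jid \<subseteq> smod i" and gj: "\<forall>j\<in>{1..i}. gX j \<in> smod i" and co: "coeff (tailpoly k) d \<in> smod i" for d
    using Suc kn by (auto simp: k_def)
  define M where "M = smod k"
  have M: "M = {\<Sum>d\<le>m. g ^ d * x d | x. \<forall>d. x d \<in> smod i}"
    using smod_Suc[of i] kn by (simp add: M_def k_def m_def g_def)
  have z: "0 \<in> smod i" by (rule R) simp
  have neg: "- P \<in> smod i" if "P \<in> smod i" for P
    using IH(2)[OF that R[of "- 1"]] by simp
  have add: "P + Q \<in> M" if PQ: "P \<in> M" "Q \<in> M" for P Q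
  proof -
    obtain x where x: "\<forall>d. x d \<in> smod i" "P = (\<Sum>d\<le>m. g ^ d * x d)" using PQ(1) unfolding M by blast
    obtain y where y: "\<forall>d. y d \<in> smod i" "Q = (\<Sum>d\<le>m. g ^ d * y d)" using PQ(2) unfolding M by blast
    have "P + Q = (\<Sum>d\<le>m. g ^ d * (x d + y d))" by (simp add: x y distrib_left sum.distrib)
    then show ?thesis unfolding M using x y IH by (auto intro!: exI[of _ "\<lambda>d. x d + y d"])
  qed
  have sub: "P \<in> M" if P: "P \<in> smod i" for P
  proof -
    have "P = (\<Sum>d\<le>m. g ^ d * (if d = 0 then P else 0))"
      by (simp add: if_distrib[of "(*) _"] cong: if_cong)
    then show ?thesis unfolding M using P z by (auto intro!: exI[of _ "\<lambda>d. if d = 0 then P else 0"])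
  qed
  have smul: "p * P \<in> M" if pP: "p \<in> smod i" "P \<in> M" for p P
  proof -
    obtain x where x: "\<forall>d. x d \<in> smod i" "P = (\<Sum>d\<le>m. g ^ d * x d)" using pP(2) unfolding M by blast
    have "p * P = (\<Sum>d\<le>m. g ^ d * (p * x d))" by (simp add: x sum_distrib_left mult.left_commute)
    then show ?thesis unfolding M using x IH pP by (auto intro!: exI[of _ "\<lambda>d. p * x d"])
  qed
  have sumM: "(\<Sum>a\<in>A. f a) \<in> M" if "\<And>a. a \<in> A \<Longrightarrow> f a \<in> M" for f and A :: "nat set"
    using that by (induction A rule: infinite_finite_induct) (simp_all add: add sub z)
  have tp: "tailpoly k = [:- g, 1:] * tailpoly (Suc k)"
    using kn by (simp add: tailpoly_def g_def atLeastAtMost_insertL[symmetric])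
  have deg: "degree (tailpoly k) = Suc m \<and> coeff (tailpoly k) (Suc m) = 1"
  proof -
    have "lead_coeff (tailpoly k) = 1" by (simp add: tailpoly_def lead_coeff_prod)
    moreover have "degree (tailpoly k) = (\<Sum>j\<in>{k..n}. degree [:- gX j, 1:])"
      unfolding tailpoly_def by (rule degree_prod_eq_sum_degree) simp
    ultimately show ?thesis using kn by simp
  qed
  have "poly (tailpoly k) g = 0" by (simp add: tp)
  then have "(\<Sum>d\<le>Suc m. coeff (tailpoly k) d * g ^ d) = 0" using deg by (simp add: poly_altdef)
  \<comment> \<open>\<open>Suc m\<close> is the only exponent beyond the staircase that arises on
    multiplication by \<open>g\<close>, so this one relation suffices.\<close>
  then have "g ^ Suc m = (\<Sum>d\<le>m. g ^ d * (- coeff (tailpoly k) d))"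
    using deg by (simp add: sum_negf mult.commute eq_neg_iff_add_eq_0 add.commute)
  then have top: "g ^ Suc m \<in> M" unfolding M
    by (intro CollectI exI[of _ "\<lambda>d. - coeff (tailpoly k) d"]) (simp only: co neg simp_thms)
  have gmul: "g * P \<in> M" if P: "P \<in> M" for P
  proof -
    obtain x where x: "\<forall>d. x d \<in> smod i" "P = (\<Sum>d\<le>m. g ^ d * x d)" using P unfolding M by blast
    define y where "y d = (case d of 0 \<Rightarrow> 0 | Suc e \<Rightarrow> x e)" for d
    have y: "y d \<in> smod i" for d using x z by (simp add: y_def split: nat.split)
    have "g * P = (\<Sum>d\<le>m. g ^ Suc d * y (Suc d))" by (simp add: x y_def sum_distrib_left mult.assoc)
    also have "\<dots> = (\<Sum>d\<le>Suc m. g ^ d * y d)"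
      unfolding sum.atMost_Suc_shift[of "\<lambda>d. g ^ d * y d"] by (simp add: y_def)
    also have "\<dots> = (\<Sum>d\<le>m. g ^ d * y d) + x m * g ^ Suc m" by (simp add: y_def mult.commute)
    also have "\<dots> \<in> M" using x y by (intro add smul top) (auto simp: M)
    finally show ?thesis .
  qed
  have gpow: "g ^ d * P \<in> M" if "P \<in> M" for P d
    using that by (induction d) (simp_all add: gmul mult.assoc)
  have mul: "P * Q \<in> M" if PQ: "P \<in> M" "Q \<in> M" for P Q
  proof -
    obtain x where x: "\<forall>d. x d \<in> smod i" "P = (\<Sum>d\<le>m. g ^ d * x d)" using PQ(1) unfolding M by blast
    have "P * Q = (\<Sum>d\<le>m. g ^ d * (x d * Q))" by (simp add: x sum_distrib_right mult.assoc)
    also have "\<dots> \<in> M" using x PQ(2) by (intro sumM gpow smul) auto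
    finally show ?thesis .
  qed
  have gM: "g \<in> M" using gmul[OF sub[OF R[of 1]]] by simp
  have cM: "coeff (tailpoly (Suc k)) d \<in> M" for d
  proof -
    let ?D = "Suc (degree (tailpoly (Suc k)))"
    \<comment> \<open>Synthetic division by the linear factor, from the top coefficient downwards:
      \<open>e\<close> is the distance to \<open>?D\<close>, one above the degree, where the
      coefficient is 0.\<close>
    have "coeff (tailpoly (Suc k)) d \<in> M" if "d + e = ?D" for d e
      using that
    proof (induction e arbitrary: d)
      case 0 then show ?case using sub z by (simp add: coeff_eq_0)
    next
      case (Suc e)
      have "coeff (tailpoly k) (Suc d) = coeff (tailpoly (Suc k)) d - g * coeff (tailpoly (Suc k)) (Suc d)"
        unfolding tp coeff_linear_mult by simp
      then have "coeff (tailpoly (Suc k)) d = coeff (tailpoly k) (Suc d) + g * coeff (tailpoly (Suc k)) (Suc d)"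
        by simp
      also have "\<dots> \<in> M" by (rule add[OF sub[OF co] gmul[OF Suc.IH]]) (use Suc.prems in simp)
      finally show ?case .
    qed
    from this[of d "?D - d"] show ?thesis
      using sub z by (cases "d \<le> ?D") (simp_all add: coeff_eq_0)
  qed
  have "\<forall>j\<in>{1..k}. gX j \<in> M" using gM gj sub by (auto simp: k_def g_def le_Suc_eq)
  then show ?case using add mul sub R J cM unfolding M_def k_def by blast
qed

text \<open>Since \<open>smod n\<close> is a ring, only the inverses of the \<gamma> need an
  argument: modulo the ideal the product of all \<gamma> equals the product of all \<open>z\<close>,
  which is a unit.\<close>

lemma smod_all:
  assumes "lvars P \<subseteq> Kvars N n lam" shows "P \<in> smod n"
proof -
  note inv = smod_invariants[OF order_refl]
  have add: "P + Q \<in> smod n" and mul: "P * Q \<in> smod n" if "P \<in> smod n" "Q \<in> smod n" for P Q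
    using inv that by blast+
  have R: "P \<in> smod n" if "lvars P \<subseteq> ZHvars n" for P using inv that by blast
  have J: "P \<in> smod n" if "P \<in> jid" for P using inv that by blast
  have g: "gX i \<in> smod n" if "i \<in> {1..n}" for i using inv that by blast
  have sum: "(\<Sum>a\<in>A. f a) \<in> smod n" if "\<And>a. a \<in> A \<Longrightarrow> f a \<in> smod n" for f and A :: "(var \<Rightarrow>\<^sub>0 int) set"
    using that by (induction A rule: infinite_finite_induct) (simp_all add: add R)
  have prod: "(\<Prod>a\<in>A. f a) \<in> smod n" if "\<And>a. a \<in> A \<Longrightarrow> f a \<in> smod n" for f and A :: "'a set"
    using that by (induction A rule: infinite_finite_induct) (simp_all add: mul R)
  have ginv: "lmon 1 (- ex (gvar i)) \<in> smod n" if i: "i \<in> {1..n}" for i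
  proof -
    define e where "e = (\<Sum>j\<in>{1..n}. ex (Z j))"
    define c where "c = lmon 1 (- ex (gvar i)) * lmon 1 (- e)"
    have ke: "ks e \<subseteq> Z ` {1..n}" unfolding e_def by (rule order_trans[OF keys_sum]) auto
    have map: "mono_map f e = (\<Sum>j\<in>{1..n}. ex (f (Z j)))" for f by (simp add: e_def mono_map_sum)
    have sym: "symz n (lmon 1 e)"
      unfolding symz_def
    proof (intro conjI allI impI)
      show "lvars (lmon 1 e) \<subseteq> {Z a |a. a \<in> {1..n}}" using lvars_lmon[of 1 e] ke by blast
      fix \<tau> assume \<tau>: "\<tau> permutes {1..n}"
      show "lsubst (zperm \<tau>) (lmon 1 e) = lmon 1 e"
        unfolding lsubst_lmon map using sum.permute[OF \<tau>, of "\<lambda>j. ex (Z j)"]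
        by (simp add: zperm_def e_def o_def)
    qed
    have eZ: "lvars (lmon 1 (- e)) \<subseteq> ZHvars n"
      using lvars_lmon[of 1 "- e"] ke by (auto simp: ZHvars_def)
    have "lvars (lmon 1 (- ex (gvar i))) \<subseteq> Kvars N n lam"
      using lvars_lmon[of 1 "- ex (gvar i)"] gvar_in_Kvars[OF i] by auto
    then have "lvars c \<subseteq> Kvars N n lam"
      unfolding c_def by (rule lvars_mult) (rule order_trans[OF eZ ZH_Kvars])
    then have "c * symrel (lmon 1 e) \<in> jid" using sym by (rule jid_gen)
    then have "(- 1) * (c * symrel (lmon 1 e)) \<in> smod n" by (intro mul R J) simp_all
    \<comment> \<open>The factor \<open>c\<close> is chosen so that the product of all \<gamma> in
      the relation cancels the first summand, while the product of the \<open>z\<close> leaves the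
      inverse of the \<open>i\<close>-th variable.\<close>
    moreover have "lmon 1 (- ex (gvar i)) = (\<Prod>j\<in>{1..n}-{i}. gX j) * lmon 1 (- e) + (- 1) * (c * symrel (lmon 1 e))"
    proof -
      have ee: "lmon 1 e * lmon 1 (- e) = 1" "lmon 1 (- ex (gvar i)) * gX i = 1"
        by (simp_all add: lmon_def mult_single)
      have "lsubst (z2gam lam) (lmon 1 e) = (\<Prod>j\<in>{1..n}. gX j)" by (simp add: map lmon_sum z2gam_Z)
      also have "\<dots> = gX i * (\<Prod>j\<in>{1..n}-{i}. gX j)" using i by (simp add: prod.remove)
      finally show ?thesis unfolding symrel_def c_def using ee by algebra
    qed
    moreover have "(\<Prod>j\<in>{1..n}-{i}. gX j) * lmon 1 (- e) \<in> smod n"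
      using eZ by (intro mul prod g R) auto
    ultimately show ?thesis by (simp only: add)
  qed
  have pw: "lmon 1 (sg v k) \<in> smod n" if v: "v \<in> Kvars N n lam" for v k
  proof -
    from v show ?thesis
    proof (cases rule: Kvars_cases)
      case (1 i)
      have "sg v (int (Suc d)) = ex v + sg v (int d)" "sg v (- int (Suc d)) = - ex v + sg v (- int d)" for d
        by (rule poly_mapping_eqI; simp add: ex_def lookup_add lookup_minus lookup_single when_def)+
      then have "lmon 1 (sg v (int d)) = gX i ^ d" "lmon 1 (sg v (- int d)) = lmon 1 (- ex (gvar i)) ^ d" for d
        by (induction d) (simp_all only: 1 lmon_add power_Suc, simp_all add: lmon_one)
      moreover have "gX i ^ d \<in> smod n" "lmon 1 (- ex (gvar i)) ^ d \<in> smod n" for d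
        using 1 by (induction d) (simp_all add: mul g ginv R)
      ultimately show ?thesis by (cases k rule: int_cases2) metis+
    next
      case 2
      then show ?thesis using lvars_lmon[of 1 "sg v k"] by (intro R) (auto split: if_splits)
    qed
  qed
  have mono: "sg m c \<in> smod n" if m: "ks m \<subseteq> Kvars N n lam" for m c
  proof -
    have "sg m c = lmon c 0 * lmon 1 m" by (simp add: lmon_def mult_single)
    also have "lmon 1 m = (\<Prod>v\<in>ks m. lmon 1 (sg v (lk m v)))"
      by (subst pm_eq_sum_single[of m]) (rule lmon_sum)
    finally have "sg m c = lmon c 0 * (\<Prod>v\<in>ks m. lmon 1 (sg v (lk m v)))" .
    moreover have "(\<Prod>v\<in>ks m. lmon 1 (sg v (lk m v))) \<in> smod n" using m by (intro prod pw) blast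
    moreover have "lmon c 0 \<in> smod n" using lvars_lmon[of c 0] by (intro R) auto
    ultimately show ?thesis by (simp only: mul)
  qed
  have "P = (\<Sum>m\<in>ks P. sg m (lk P m))" by (rule pm_eq_sum_single)
  also have "\<dots> \<in> smod n" using assms by (intro sum mono) (auto simp: lvars_def)
  finally show ?thesis .
qed

section \<open>Vanishing under all assignments of the \<open>z\<close> to the \<gamma>\<close>

definition zsub :: "(nat \<Rightarrow> nat) \<Rightarrow> var \<Rightarrow> var" where
  "zsub \<tau> v = (case v of Gam k a \<Rightarrow> Z (\<tau> (lamc lam (k - 1) + a)) | _ \<Rightarrow> v)"

lemma zsub_gvar: "i \<in> {1..n} \<Longrightarrow> zsub \<tau> (gvar i) = Z (\<tau> i)"
  by (erule gvar_cases) (simp add: zsub_def)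

lemma zsub_ZH: "v \<in> ZHvars n \<Longrightarrow> zsub \<tau> v = v"
  by (auto simp: ZHvars_def zsub_def)

lemma lvars_stair: "i \<le> n \<Longrightarrow> P \<in> stair i \<Longrightarrow> lvars P \<subseteq> gvar ` {1..i} \<union> ZHvars n"
proof (induction i arbitrary: P)
  case (Suc i)
  then obtain y where y: "\<forall>d. y d \<in> stair i" "P = (\<Sum>d\<le>n - Suc i. gX (Suc i) ^ d * y d)" by auto
  have "lvars (y d) \<subseteq> gvar ` {1..Suc i} \<union> ZHvars n" for d
    using Suc.IH[of "y d"] Suc.prems y(1) by fastforce
  moreover have "lvars (gX (Suc i) ^ d) \<subseteq> gvar ` {1..Suc i} \<union> ZHvars n" for d
    using lvars_lX[of "gvar (Suc i)"] by (intro lvars_power) auto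
  ultimately show ?case unfolding y(2) by (intro lvars_sum lvars_mult) auto
qed simp

text \<open>The coefficients \<open>y d\<close> involve only the first \<open>i\<close> variables.
  Exchanging position \<open>Suc i\<close> with later positions leaves them fixed while the variable
  there runs through \<open>n - i\<close> distinct \<open>z\<close>; a polynomial of degree at most
  \<open>n - Suc i\<close> with that many roots is zero.\<close>

lemma stair_eq_0:
  assumes "i \<le> n" "P \<in> stair i" "\<And>\<tau>. \<tau> permutes {1..n} \<Longrightarrow> lsubst (zsub \<tau>) P = 0"
  shows "P = 0"
  using assms
proof (induction i arbitrary: P)
  case 0
  have "lsubst (zsub id) P = P" using 0 by (intro lsubst_ident zsub_ZH) auto
  then show ?case using 0(3)[OF permutes_id] by simp
next
  case (Suc i)
  then obtain y where y: "\<forall>d. y d \<in> stair i" "P = (\<Sum>d\<le>n - Suc i. gX (Suc i) ^ d * y d)" by auto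
  have "lsubst (zsub \<tau>) (y d) = 0" if \<tau>: "\<tau> permutes {1..n}" and d: "d \<le> n - Suc i" for \<tau> d
  proof -
    define p where "p = (\<Sum>d\<le>n - Suc i. monom (lsubst (zsub \<tau>) (y d)) d)"
    define T where "T = \<tau> ` {Suc i..n}"
    have roots: "poly p (lX (Z t)) = 0" if "t \<in> T" for t
    proof -
      obtain j where j: "j \<in> {Suc i..n}" "t = \<tau> j" using \<open>t \<in> T\<close> by (auto simp: T_def)
      define \<tau>' where "\<tau>' = \<tau> \<circ> transpose (Suc i) j"
      have "\<tau>' permutes {1..n}" unfolding \<tau>'_def
        using j Suc.prems(1) by (intro permutes_compose[OF permutes_swap_id \<tau>]) auto
      then have "lsubst (zsub \<tau>') P = 0" by (rule Suc.prems)
      moreover have "lsubst (zsub \<tau>') (y d) = lsubst (zsub \<tau>) (y d)" for d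
      proof (rule lsubst_cong)
        fix v assume "v \<in> lvars (y d)"
        then have "v \<in> gvar ` {1..i} \<union> ZHvars n" using lvars_stair[of i "y d"] y(1) Suc.prems(1) by auto
        then show "zsub \<tau>' v = zsub \<tau> v"
          using j Suc.prems(1) by (auto simp: zsub_ZH zsub_gvar \<tau>'_def transpose_def)
      qed
      moreover have "lsubst (zsub \<tau>') (gX (Suc i) ^ d) = lX (Z t) ^ d" for d
        using Suc.prems(1) j
        by (induction d) (simp_all add: lsubst_mult zsub_gvar \<tau>'_def)
      ultimately show ?thesis
        by (simp add: y(2) p_def lsubst_sum lsubst_mult poly_sum poly_monom mult.commute)
    qed
    have "p = 0"
    proof (rule ccontr)
      assume "p \<noteq> 0"
      have inj: "inj_on (\<lambda>t. lX (Z t)) T"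
        using lX_diff_nonzero by (intro inj_onI) (metis right_minus_eq var.inject(2))
      have "card T \<le> card {x. poly p x = 0}"
        using roots \<open>p \<noteq> 0\<close> by (intro card_inj_on_le[OF inj] poly_roots_finite) auto
      also have "\<dots> \<le> degree p" using \<open>p \<noteq> 0\<close> by (rule card_poly_roots_bound)
      also have "\<dots> \<le> n - Suc i" unfolding p_def
        by (intro degree_sum_le) (auto intro: order_trans[OF degree_monom_le])
      finally have "card T \<le> n - Suc i" .
      moreover have "card T = card {Suc i..n}" unfolding T_def
        using permutes_inj[OF \<tau>] by (intro card_image) (metis inj_on_subset subset_UNIV)
      ultimately show False using Suc.prems(1) by simp
    qed
    then have "coeff p d = 0" by simp
    then show ?thesis using d by (simp add: p_def coeff_sum)
  qed
  then have "y d = 0" if "d \<le> n - Suc i" for d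
    using Suc.IH[of "y d"] y(1) Suc.prems(1) that by auto
  then show ?case by (simp add: y(2))
qed

lemma lsubst_zsub_symrel:
  assumes "symz n f" "\<tau> permutes {1..n}" shows "lsubst (zsub \<tau>) (symrel f) = 0"
proof -
  have f: "lvars f \<subseteq> Z ` {1..n}" "lsubst (zperm \<tau>) f = f" using assms by (auto simp: symz_def)
  have "lsubst (zsub \<tau> \<circ> z2gam lam) f = lsubst (zperm \<tau>) f"
    by (rule lsubst_cong) (use f(1) in \<open>auto simp: z2gam_Z zsub_gvar zperm_def\<close>)
  moreover have "lsubst (zsub \<tau>) f = f" using f(1) by (intro lsubst_ident) (auto simp: zsub_def)
  ultimately show ?thesis using f(2) by (simp add: symrel_def lsubst_diff lsubst_comp)
qed

text \<open>Relations vanish under each \<open>zsub\<close>, so the staircase remainder of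
  \<open>P\<close> does as well and is therefore zero.\<close>

lemma in_jidI:
  assumes "lvars P \<subseteq> Kvars N n lam" "\<And>\<tau>. \<tau> permutes {1..n} \<Longrightarrow> lsubst (zsub \<tau>) P = 0"
  shows "P \<in> jid"
proof -
  obtain Y q where Yq: "Y \<in> stair n" "q \<in> jid" "P = Y + q"
    using smod_all[OF assms(1)] by (auto simp: smod_def)
  have q: "lsubst (zsub \<tau>) q = 0" if "\<tau> permutes {1..n}" for \<tau>
    using Yq(2) by (induction q rule: jid.induct)
      (simp_all add: lsubst_add lsubst_mult lsubst_zsub_symrel[OF _ that])
  have "Y = 0"
    using Yq assms(2) q by (intro stair_eq_0[OF order_refl Yq(1)]) (simp add: lsubst_add)
  then show ?thesis using Yq by simp
qed

section \<open>Averaging over the block permutations\<close>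

definition gperms :: "(nat \<Rightarrow> nat \<Rightarrow> nat) set" where
  "gperms = {\<rho>. \<forall>k. \<rho> k permutes (if k \<in> {1..N} then {1..lam k} else {})}"

lemma finite_gperms: "finite gperms"
  unfolding gperms_def by (rule finite_perm_families[of "{1..N}"]) auto

lemma gamperm_Kvars:
  assumes "\<And>k. k \<in> {1..N} \<Longrightarrow> \<rho> k permutes {1..lam k}" "v \<in> Kvars N n lam"
  shows "gamperm \<rho> v \<in> Kvars N n lam"
proof -
  have "\<rho> k a \<in> {1..lam k}" if "k \<in> {1..N}" "a \<in> {1..lam k}" for k a
    using permutes_in_image[OF assms(1)[OF that(1)]] that by simp
  then show ?thesis using assms(2) by (auto simp: Kvars_def ZHvars_def gamperm_def)
qed

text \<open>In the linear enumeration a block permutation is a permutation of \<open>{1..n}\<close>,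
  under which a symmetric function is invariant.\<close>

lemma gamperm_gvar:
  assumes "\<rho> \<in> gperms"
  obtains \<tau> where "\<tau> permutes {1..n}" "\<And>i. i \<in> {1..n} \<Longrightarrow> gvar (\<tau> i) = gamperm \<rho> (gvar i)"
proof -
  have \<rho>: "\<rho> k permutes {1..lam k}" if "k \<in> {1..N}" for k
    using assms that by (auto simp: gperms_def split: if_splits dest: spec[of _ k])
  have "bij_betw (gamperm \<rho>) gvars gvars"
  proof (rule bij_betwI[where g = "gamperm (\<lambda>k. inv (\<rho> k))"])
    have "\<rho> k a \<in> {1..lam k} \<and> inv (\<rho> k) a \<in> {1..lam k}" if "k \<in> {1..N}" "a \<in> {1..lam k}" for k a
      using permutes_in_image[OF \<rho>[OF that(1)]] permutes_in_image[OF permutes_inv[OF \<rho>[OF that(1)]]] that by simp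
    then show "gamperm \<rho> \<in> gvars \<rightarrow> gvars" "gamperm (\<lambda>k. inv (\<rho> k)) \<in> gvars \<rightarrow> gvars"
      by (auto simp: gamperm_def)
  qed (auto simp: gamperm_def permutes_inverses[OF \<rho>])
  then have "bij_betw (gamperm \<rho> \<circ> gvar) {1..n} gvars" using gvar_bij bij_betw_trans by blast
  from matching_permutation[OF gvar_bij this] obtain \<tau> where
    "\<tau> permutes {1..n}" "\<And>i. i \<in> {1..n} \<Longrightarrow> gvar (\<tau> i) = (gamperm \<rho> \<circ> gvar) i" by blast
  then show ?thesis by (intro that) (simp_all only: comp_apply)
qed

lemma gamperm_symrel:
  assumes "symz n f" "\<rho> \<in> gperms" shows "lsubst (gamperm \<rho>) (symrel f) = symrel f"
proof -
  obtain \<tau> where \<tau>: "\<tau> permutes {1..n}" "\<And>i. i \<in> {1..n} \<Longrightarrow> gvar (\<tau> i) = gamperm \<rho> (gvar i)"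
    by (rule gamperm_gvar[OF assms(2)], rule that)
  have f: "lvars f \<subseteq> Z ` {1..n}" "lsubst (zperm \<tau>) f = f" using assms \<tau>(1) by (auto simp: symz_def)
  have "lsubst (gamperm \<rho> \<circ> z2gam lam) f = lsubst (z2gam lam \<circ> zperm \<tau>) f"
    by (rule lsubst_cong) (use f(1) \<tau>(2) in \<open>auto simp: z2gam_Z zperm_def\<close>)
  also have "\<dots> = lsubst (z2gam lam) f" by (simp add: f(2) flip: lsubst_comp)
  finally have "lsubst (gamperm \<rho> \<circ> z2gam lam) f = lsubst (z2gam lam) f" .
  moreover have "lsubst (gamperm \<rho>) f = f" using f(1) by (intro lsubst_ident) (auto simp: gamperm_def)
  ultimately show ?thesis by (simp add: symrel_def lsubst_diff lsubst_comp)
qed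

definition gsym :: "lpoly \<Rightarrow> lpoly" where
  "gsym P = (\<Sum>\<rho>\<in>gperms. lsubst (gamperm \<rho>) P)"

lemma gamperm_comp: "gamperm \<rho> \<circ> gamperm \<rho>' = gamperm (\<lambda>k. \<rho> k \<circ> \<rho>' k)"
  by (auto simp: gamperm_def fun_eq_iff split: var.split)

lemma in_K_gsym:
  assumes "lvars c \<subseteq> Kvars N n lam" shows "in_K N n lam (gsym c)"
  unfolding in_K_def
proof (intro conjI allI impI)
  have gp: "\<rho> k permutes {1..lam k}" if "\<rho> \<in> gperms" "k \<in> {1..N}" for \<rho> k
    using that by (auto simp: gperms_def split: if_splits dest: spec[of _ k])
  have lv: "lvars (lsubst (gamperm \<rho>) c) \<subseteq> Kvars N n lam" if "\<rho> \<in> gperms" for \<rho>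
    using lvars_lsubst[of "gamperm \<rho>" c] gamperm_Kvars[of \<rho>] gp[OF that] assms by blast
  show lvg: "lvars (gsym c) \<subseteq> Kvars N n lam" unfolding gsym_def by (rule lvars_sum[OF lv])
  fix \<rho> assume \<rho>: "\<forall>k\<in>{1..N}. \<rho> k permutes {1..lam k}"
  \<comment> \<open>\<open>in_K\<close> leaves \<open>\<rho>\<close> arbitrary outside the block
    indices; it is cut down to the identity there so as to lie in \<open>gperms\<close>, with the
    same effect on the variables that occur.\<close>
  define \<rho>' where "\<rho>' k = (if k \<in> {1..N} then \<rho> k else id)" for k
  have \<rho>': "\<rho>' k permutes (if k \<in> {1..N} then {1..lam k} else {})" for k
    using \<rho> by (auto simp: \<rho>'_def permutes_id)
  have "lsubst (gamperm \<rho>) (gsym c) = lsubst (gamperm \<rho>') (gsym c)"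
    using lvg by (intro lsubst_cong) (auto simp: gamperm_def \<rho>'_def Kvars_def ZHvars_def)
  also have "\<dots> = (\<Sum>\<pi>\<in>gperms. lsubst (gamperm (\<lambda>k. \<rho>' k \<circ> \<pi> k)) c)"
    by (simp add: gsym_def lsubst_sum lsubst_comp gamperm_comp)
  also have "\<dots> = gsym c" unfolding gsym_def gperms_def
    using sum.reindex_bij_betw[OF perm_families_compose[OF \<rho>'], of "\<lambda>\<pi>. lsubst (gamperm \<pi>) c"] by simp
  finally show "lsubst (gamperm \<rho>) (gsym c) = gsym c" .
qed

text \<open>The relations are invariant under the block permutations, so averaging acts on the
  coefficients alone and makes them elements of the invariant ring.\<close>

lemma in_ideal_gsym: "P \<in> jid \<Longrightarrow> in_ideal N n lam (gsym P)"
proof (induction P rule: jid.induct)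
  case zero
  have "gsym 0 = 0" by (simp add: gsym_def)
  then show ?case unfolding in_ideal_def by (intro exI[of _ "[]"]) simp
next
  case (step P c f)
  obtain fs cs where fc: "length cs = length fs" "\<forall>f\<in>set fs. symz n f" "\<forall>c\<in>set cs. in_K N n lam c"
    "gsym P = (\<Sum>i<length fs. cs ! i * (lsubst (z2gam lam) (fs ! i) - fs ! i))"
    using step.IH unfolding in_ideal_def by blast
  have "gsym (P + c * symrel f) = gsym P + gsym c * symrel f"
    using step.hyps by (simp add: gsym_def lsubst_add lsubst_mult gamperm_symrel sum.distrib sum_distrib_right)
  also have "\<dots> = (\<Sum>i<length (f # fs). (gsym c # cs) ! i * (lsubst (z2gam lam) ((f # fs) ! i) - (f # fs) ! i))"
    by (simp add: fc(4) symrel_def lessThan_Suc_eq_insert_0 sum.reindex add.commute)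
  finally show ?case unfolding in_ideal_def using fc step.hyps in_K_gsym[of c]
    by (intro exI[of _ "f # fs"] exI[of _ "gsym c # cs"]) simp
qed

text \<open>For invariant \<open>P\<close> only the images of the blocks under \<open>\<tau>\<close>
  matter: with \<open>J k\<close> the image of the \<open>k\<close>-th block, the two substitutions
  differ by permutations within blocks.\<close>

lemma zsub_restr:
  assumes "in_K N n lam P" "\<tau> permutes {1..n}"
  obtains J where "ordpart N n lam J" "lsubst (zsub \<tau>) P = restr J P"
proof -
  define B where "B k = {lamc lam (k - 1) + 1..lamc lam k}" for k
  define J where "J k = (if k \<in> {1..N} then \<tau> ` B k else {})" for k
  have inj: "inj \<tau>" using assms(2) by (rule permutes_inj)
  have Bn: "B k \<subseteq> {1..n}" if "k \<in> {1..N}" for k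
    using that lamc_mono[of k N lam] lamc_N by (auto simp: B_def)
  have BU: "(\<Union>k\<in>{1..N}. B k) = {1..n}"
  proof
    show "{1..n} \<subseteq> (\<Union>k\<in>{1..N}. B k)"
    proof
      fix i assume "i \<in> {1..n}"
      from blkidx_bounds[OF this] show "i \<in> (\<Union>k\<in>{1..N}. B k)"
        by (intro UN_I[of "blkidx lam i"]) (auto simp: B_def)
    qed
  qed (use Bn in blast)
  have Bd: "B k \<inter> B l = {}" if "k \<in> {1..N}" "l \<in> {1..N}" "k \<noteq> l" for k l
  proof -
    have "k = l" if "i \<in> B k" "i \<in> B l" for i
      using blkidx_eq[of k lam i] blkidx_eq[of l lam i] that \<open>k \<in> _\<close> \<open>l \<in> _\<close> by (auto simp: B_def)
    then show ?thesis using that by blast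
  qed
  have cB: "card (B k) = lam k" if "k \<in> {1..N}" for k
    using that by (simp add: B_def lamc_pred[of k])
  have J: "ordpart N n lam J"
    unfolding ordpart_def
  proof (intro conjI ballI allI impI)
    fix k assume k: "k \<in> {1..N}"
    show "J k \<subseteq> {1..n}" using k Bn[OF k] permutes_image[OF assms(2)] by (auto simp: J_def)
    show "card (J k) = lam k" using k cB[OF k] by (simp add: J_def card_image[OF inj_on_subset[OF inj subset_UNIV]])
    fix l assume l: "l \<in> {1..N}" "k \<noteq> l"
    show "J k \<inter> J l = {}" using k l Bd[OF k l] by (simp add: J_def image_Int[OF inj, symmetric])
  next
    have "(\<Union>k\<in>{1..N}. J k) = \<tau> ` (\<Union>k\<in>{1..N}. B k)" by (auto simp: J_def)
    then show "(\<Union>k\<in>{1..N}. J k) = {1..n}" using BU permutes_image[OF assms(2)] by simp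
  qed (auto simp: J_def)
  have "\<exists>\<rho>. \<rho> permutes {1..lam k} \<and> (\<forall>a\<in>{1..lam k}. elt (J k) (\<rho> a) = \<tau> (lamc lam (k - 1) + a))"
    if k: "k \<in> {1..N}" for k
  proof -
    have "bij_betw (\<lambda>a. lamc lam (k - 1) + a) {1..lam k} (B k)"
      using k by (auto intro!: bij_betwI[where g = "\<lambda>i. i - lamc lam (k - 1)"] simp: B_def lamc_pred[of k])
    moreover have "bij_betw \<tau> (B k) (J k)" using k inj
      by (auto simp: J_def bij_betw_def intro: inj_on_subset)
    ultimately have 1: "bij_betw (\<tau> \<circ> (\<lambda>a. lamc lam (k - 1) + a)) {1..lam k} (J k)"
      by (rule bij_betw_trans)
    have "J k \<subseteq> {1..n}" "card (J k) = lam k" using J k by (auto simp: ordpart_def)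
    then have "finite (J k)" "card (J k) = lam k" by (auto intro: finite_subset)
    then have "bij_betw (elt (J k)) {1..lam k} (J k)" using elt_bij[of "J k"] by simp
    from matching_permutation[OF this 1] show ?thesis by (metis comp_apply)
  qed
  then obtain \<rho> where \<rho>: "\<And>k. k \<in> {1..N} \<Longrightarrow> \<rho> k permutes {1..lam k}"
     "\<And>k a. k \<in> {1..N} \<Longrightarrow> a \<in> {1..lam k} \<Longrightarrow> elt (J k) (\<rho> k a) = \<tau> (lamc lam (k - 1) + a)" by metis
  have "lsubst (zsub \<tau>) P = lsubst ((\<lambda>v. case v of Gam k a \<Rightarrow> Z (elt (J k) a) | _ \<Rightarrow> v) \<circ> gamperm \<rho>) P"
    using assms(1) \<rho>(2)
    by (intro lsubst_cong) (auto simp: in_K_def Kvars_def ZHvars_def zsub_def gamperm_def)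
  also have "\<dots> = restr J (lsubst (gamperm \<rho>) P)" by (simp add: restr_def lsubst_comp)
  also have "lsubst (gamperm \<rho>) P = P" using assms(1) \<rho>(1) by (auto simp: in_K_def)
  finally show ?thesis using that J by blast
qed

text \<open>An invariant element is its own average. Hence membership in \<open>jid\<close> with
  arbitrary coefficients yields membership with invariant ones, the factor \<open>c\<close>
  normalising the sum over \<open>gperms\<close>.\<close>

theorem in_ideal_if_restrictions_vanish:
  assumes "in_K N n lam P" "\<And>J. ordpart N n lam J \<Longrightarrow> restr J P = 0"
  shows "in_ideal N n lam P"
proof -
  define c where "c = lmon (1 / of_nat (card gperms)) 0"
  have "(\<lambda>_. id) \<in> gperms" by (auto simp: gperms_def permutes_id)
  then have ne: "card gperms \<noteq> 0" using finite_gperms by (auto simp: card_eq_0_iff)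
  have "P \<in> jid"
  proof (rule in_jidI)
    show "lvars P \<subseteq> Kvars N n lam" using assms(1) by (simp add: in_K_def)
    show "lsubst (zsub \<tau>) P = 0" if "\<tau> permutes {1..n}" for \<tau>
      by (rule zsub_restr[OF assms(1) that]) (simp add: assms(2))
  qed
  then have "c * P \<in> jid" using lvars_lmon[of _ 0] by (intro jid_mult) (auto simp: c_def)
  then have "in_ideal N n lam (gsym (c * P))" by (rule in_ideal_gsym)
  moreover have "lsubst (gamperm \<rho>) P = P" if "\<rho> \<in> gperms" for \<rho>
  proof -
    have "\<rho> k permutes {1..lam k}" if "k \<in> {1..N}" for k
      using \<open>\<rho> \<in> gperms\<close> that by (auto simp: gperms_def split: if_splits dest: spec[of _ k])
    then show ?thesis using assms(1) by (auto simp: in_K_def)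
  qed
  then have "gsym (c * P) = of_nat (card gperms) * (c * P)"
    by (simp add: gsym_def lsubst_mult c_def)
  moreover have "of_nat (card gperms) * c = 1"
    using ne by (simp add: c_def lmon_def mult_single flip: single_of_nat)
  ultimately show ?thesis by (simp add: mult.assoc[symmetric])
qed

end

section \<open>Localized weight functions as sums of products\<close>

context flag_type
begin

text \<open>On \<open>{1..n}\<close> this is the value of \<phi>_J at a basis vector; membership in
  blocks and their unions becomes comparison of numbers.\<close>

definition blk :: "(nat \<Rightarrow> nat set) \<Rightarrow> nat \<Rightarrow> nat" where
  "blk J j = (THE k. k \<in> {1..N} \<and> j \<in> J k)"

lemma blk_eq:
  assumes "ordpart N n lam J" "k \<in> {1..N}" "j \<in> J k"
  shows "blk J j = k"
  unfolding blk_def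
proof (rule the_equality)
  fix l assume l: "l \<in> {1..N} \<and> j \<in> J l"
  have "l \<noteq> k \<Longrightarrow> J l \<inter> J k = {}" using assms l by (auto simp: ordpart_def)
  then show "l = k" using assms l by blast
qed (use assms in simp)

lemma blk_in:
  assumes "ordpart N n lam J" "j \<in> {1..n}"
  shows "blk J j \<in> {1..N}" "j \<in> J (blk J j)"
proof -
  have "j \<in> (\<Union>k\<in>{1..N}. J k)" using assms by (simp add: ordpart_def)
  then obtain k where k: "k \<in> {1..N}" "j \<in> J k" by blast
  then have "blk J j = k" using assms by (intro blk_eq)
  then show "blk J j \<in> {1..N}" "j \<in> J (blk J j)" using k by simp_all
qed

lemma mem_block_iff:
  assumes "ordpart N n lam J" "j \<in> {1..n}" "k \<in> {1..N}"
  shows "j \<in> J k \<longleftrightarrow> blk J j = k"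
  using blk_eq[OF assms(1,3)] blk_in[OF assms(1,2)] by blast

lemma mem_cup_iff:
  assumes "ordpart N n lam J" "k \<le> N"
  shows "j \<in> cup J k \<longleftrightarrow> j \<in> {1..n} \<and> blk J j \<le> k"
proof
  assume "j \<in> cup J k"
  then obtain l where l: "l \<in> {1..k}" "j \<in> J l" by (auto simp: cup_def)
  then have "blk J j = l" using assms by (intro blk_eq) auto
  then show "j \<in> {1..n} \<and> blk J j \<le> k" using l ordpart_cup(1)[OF assms] \<open>j \<in> cup J k\<close> by auto
next
  assume "j \<in> {1..n} \<and> blk J j \<le> k"
  then show "j \<in> cup J k" using blk_in[OF assms(1), of j] by (auto simp: cup_def)
qed

lemma cup_N: "ordpart N n lam J \<Longrightarrow> cup J N = {1..n}"
  by (simp add: ordpart_def cup_def)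

lemma ordpart_image:
  assumes "ordpart N n lam J" "\<tau> permutes {1..n}"
  shows "ordpart N n lam (\<lambda>k. \<tau> ` J k)"
proof -
  have inj: "inj \<tau>" using assms(2) by (rule permutes_inj)
  have "\<tau> ` J k \<subseteq> {1..n}" if "k \<in> {1..N}" for k
  proof -
    have "J k \<subseteq> {1..n}" using assms(1) that by (simp add: ordpart_def)
    then show ?thesis using permutes_image[OF assms(2)] by blast
  qed
  moreover have "(\<Union>k\<in>{1..N}. \<tau> ` J k) = {1..n}"
    using assms(1) permutes_image[OF assms(2)] by (simp add: ordpart_def flip: image_UN)
  ultimately show ?thesis using assms(1)
    by (simp add: ordpart_def card_image[OF inj_on_subset[OF inj subset_UNIV]] image_Int[OF inj, symmetric])
qed

lemma cup_image: "cup (\<lambda>k. \<tau> ` J k) k = \<tau> ` cup J k"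
  by (auto simp: cup_def)

lemma symperms_permutes: "\<pi> \<in> symperms N lam \<Longrightarrow> k \<in> {1..N-1} \<Longrightarrow> \<pi> k permutes {1..lamc lam k}"
  by (auto simp: symperms_def split: if_splits dest: spec[of _ k])

lemma symperms_id: "\<pi> \<in> symperms N lam \<Longrightarrow> k \<notin> {1..N-1} \<Longrightarrow> \<pi> k = id"
  unfolding symperms_def by (simp add: permutes_empty split: if_splits) metis

lemma finite_symperms: "finite (symperms N lam)"
  unfolding symperms_def by (rule finite_perm_families[of "{1..N-1}"]) auto

end

lemma elt_atLeastAtMost: "c \<in> {1..n} \<Longrightarrow> elt {1..n} c = c"
  by (simp add: elt_def atLeastLessThanSuc_atLeastAtMost[symmetric] sorted_list_of_set_range nth_upt
      del: upt_Suc)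

locale flag_pair = flag_type +
  fixes \<sigma> :: "nat \<Rightarrow> nat" and I J :: "nat \<Rightarrow> nat set"
  assumes \<sigma>: "\<sigma> permutes {1..n}" and I: "ordpart N n lam I" and J: "ordpart N n lam J"
begin

abbreviation "s \<equiv> inv \<sigma>"
abbreviation "I' \<equiv> \<lambda>k. inv \<sigma> ` I k"
abbreviation "\<phi> \<equiv> blk J"

lemma I': "ordpart N n lam I'"
  using ordpart_image[OF I permutes_inv[OF \<sigma>]] .

text \<open>The index \<open>j\<close> such that the variable in slot \<open>a\<close> of level
  \<open>k\<close> takes the value \<open>z j\<close> in the term \<open>\<pi>\<close> after
  localisation at \<open>J\<close>. Level \<open>N\<close> involves \<open>\<sigma>\<close> because
  slot \<open>a\<close> there receives the variable with index \<open>\<sigma> a\<close>.\<close>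

definition qidx :: "(nat \<Rightarrow> nat \<Rightarrow> nat) \<Rightarrow> nat \<Rightarrow> nat \<Rightarrow> nat" where
  "qidx \<pi> k a = (if k = N then \<sigma> a else elt (cup J k) (\<pi> k a))"

text \<open>In the term \<open>\<pi>\<close>, the variable \<open>t\<^sup>(\<^sup>k\<^sup>)\<close> attached to the element \<open>pos \<pi> k j\<close> of \<open>cup I' k\<close>
  takes the value \<open>z j\<close>.\<close>

definition pos :: "(nat \<Rightarrow> nat \<Rightarrow> nat) \<Rightarrow> nat \<Rightarrow> nat \<Rightarrow> nat" where
  "pos \<pi> k j = elt (cup I' k) (inv_into {1..lamc lam k} (qidx \<pi> k) j)"

lemma elt_cup_bij:
  assumes "ordpart N n lam L" "k \<le> N"
  shows "bij_betw (elt (cup L k)) {1..lamc lam k} (cup L k)"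
  using elt_bij[of "cup L k"] ordpart_cup[OF assms] by simp

lemma qidx_bij:
  assumes "\<pi> \<in> symperms N lam" "k \<in> {1..N}"
  shows "bij_betw (qidx \<pi> k) {1..lamc lam k} (cup J k)"
proof (cases "k = N")
  case True
  have "bij_betw \<sigma> {1..n} {1..n}" using \<sigma> by (rule permutes_imp_bij)
  moreover have "qidx \<pi> k = \<sigma>" using True by (simp add: qidx_def fun_eq_iff)
  ultimately show ?thesis using True lamc_N cup_N[OF J] by simp
next
  case False
  then have "bij_betw (\<pi> k) {1..lamc lam k} {1..lamc lam k}"
    using assms by (intro permutes_imp_bij symperms_permutes) auto
  moreover have "bij_betw (elt (cup J k)) {1..lamc lam k} (cup J k)"
    using assms by (intro elt_cup_bij J) auto
  ultimately have "bij_betw (elt (cup J k) \<circ> \<pi> k) {1..lamc lam k} (cup J k)" by (rule bij_betw_trans)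
  moreover have "qidx \<pi> k = elt (cup J k) \<circ> \<pi> k" using False by (simp add: qidx_def fun_eq_iff)
  ultimately show ?thesis by simp
qed

lemma pos_bij:
  assumes "\<pi> \<in> symperms N lam" "k \<in> {1..N}"
  shows "bij_betw (pos \<pi> k) (cup J k) (cup I' k)"
proof -
  have "bij_betw (elt (cup I' k) \<circ> inv_into {1..lamc lam k} (qidx \<pi> k)) (cup J k) (cup I' k)"
    using assms by (intro bij_betw_trans[OF bij_betw_inv_into[OF qidx_bij]] elt_cup_bij I') auto
  moreover have "pos \<pi> k = elt (cup I' k) \<circ> inv_into {1..lamc lam k} (qidx \<pi> k)"
    by (simp add: pos_def fun_eq_iff)
  ultimately show ?thesis by simp
qed

lemma pos_qidx:
  assumes "\<pi> \<in> symperms N lam" "k \<in> {1..N}" "a \<in> {1..lamc lam k}"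
  shows "pos \<pi> k (qidx \<pi> k a) = elt (cup I' k) a"
  using qidx_bij[OF assms(1,2)] assms(3) by (simp add: pos_def bij_betw_def inv_into_f_f)

lemma pos_N:
  assumes "\<pi> \<in> symperms N lam" "j \<in> {1..n}"
  shows "pos \<pi> N j = s j"
proof -
  have sj: "s j \<in> {1..n}" using permutes_in_image[OF permutes_inv[OF \<sigma>]] assms(2) by simp
  then have "pos \<pi> N (qidx \<pi> N (s j)) = elt (cup I' N) (s j)"
    using assms N_pos lamc_N by (intro pos_qidx) auto
  moreover have "qidx \<pi> N (s j) = j" using permutes_inverses(1)[OF \<sigma>] by (simp add: qidx_def)
  ultimately show ?thesis using sj elt_atLeastAtMost cup_N[OF I'] by simp
qed

abbreviation hf :: "(nat \<Rightarrow> complex) \<Rightarrow> complex \<Rightarrow> nat \<Rightarrow> nat \<Rightarrow> complex" where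
  "hf z h j j' \<equiv> 1 - h * z j' / z j"

abbreviation zf :: "(nat \<Rightarrow> complex) \<Rightarrow> nat \<Rightarrow> nat \<Rightarrow> complex" where
  "zf z j j' \<equiv> 1 - z j' / z j"

text \<open>The contribution of an ordered pair of indices to a term of the weight function at level \<open>k\<close>,
  before and after cancelling the denominator \<open>E\<close>.\<close>

definition tfac :: "(nat \<Rightarrow> nat \<Rightarrow> nat) \<Rightarrow> nat \<Rightarrow> nat \<Rightarrow> nat \<Rightarrow> (nat \<Rightarrow> complex) \<Rightarrow> complex \<Rightarrow> complex" where
  "tfac p k j j' z h =
    (if \<phi> j \<le> k \<and> \<phi> j' \<le> k + 1 then
       (if p (k+1) j' < p k j then hf z h j j' else if p (k+1) j' > p k j then zf z j j' else 1) else 1)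
    * (if \<phi> j \<le> k \<and> \<phi> j' \<le> k \<and> p k j < p k j' then hf z h j j' / zf z j j' else 1)"

definition rfac :: "(nat \<Rightarrow> nat \<Rightarrow> nat) \<Rightarrow> nat \<Rightarrow> nat \<Rightarrow> nat \<Rightarrow> (nat \<Rightarrow> complex) \<Rightarrow> complex \<Rightarrow> complex" where
  "rfac p k j j' z h = tfac p k j j' z h / (if \<phi> j \<le> k \<and> \<phi> j' \<le> k \<and> j \<noteq> j' then hf z h j j' else 1)"

lemma prod_cup:
  assumes "k \<le> N"
  shows "(\<Prod>j\<in>cup J k. f j) = (\<Prod>j\<in>{1..n}. if \<phi> j \<le> k then f j else 1)"
proof -
  have "cup J k = {j\<in>{1..n}. \<phi> j \<le> k}" using mem_cup_iff[OF J assms] by blast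
  then show ?thesis by (simp add: prod.inter_filter[symmetric])
qed

text \<open>Slots are replaced by the indices of the \<open>z\<close> they receive, and the order of
  slots by the order of \<open>pos\<close>. Indices absent from a level contribute 1, so that all
  products run over \<open>{1..n}\<close> and can later be regrouped by pairs.\<close>

lemma wU_eq:
  assumes \<pi>: "\<pi> \<in> symperms N lam"
  shows "wU N lam I' (\<lambda>k a. tfull N (\<lambda>k a. z (elt (cup J k) a)) (z \<circ> \<sigma>) k (\<pi> k a)) h
    = (\<Prod>k\<in>{1..N-1}. \<Prod>j\<in>{1..n}. \<Prod>j'\<in>{1..n}. tfac (pos \<pi>) k j j' z h)"
proof -
  define T where "T k a = z (qidx \<pi> k a)" for k a
  have T: "tfull N (\<lambda>k a. z (elt (cup J k) a)) (z \<circ> \<sigma>) k (\<pi> k a) = T k a" for k a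
    using symperms_id[OF \<pi>, of N] N_pos by (auto simp: T_def tfull_def qidx_def)
  show ?thesis
    unfolding wU_def T
  proof (rule prod.cong[OF refl])
    fix k assume k: "k \<in> {1..N-1}"
    then have kN: "k \<in> {1..N}" "k + 1 \<in> {1..N}" "k \<le> N" "k + 1 \<le> N" "k \<noteq> N" by auto
    let ?p = "pos \<pi>"
    let ?C = "\<lambda>k'. cup J k'"
    define A where "A j = (\<Prod>j'\<in>?C (k+1).
         (if ?p (k+1) j' < ?p k j then hf z h j j' else if ?p (k+1) j' > ?p k j then zf z j j' else 1))" for j
    define B where "B j = (\<Prod>j'\<in>?C k. if ?p k j < ?p k j' then hf z h j j' / zf z j j' else 1)" for j
    have a: "(\<Prod>c\<in>{1..lamc lam (k+1)}.
            (if elt (cup I' (k+1)) c < elt (cup I' k) a then 1 - h * T (k+1) c / T k a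
             else if elt (cup I' (k+1)) c > elt (cup I' k) a then 1 - T (k+1) c / T k a
             else 1)) = A (qidx \<pi> k a)" if "a \<in> {1..lamc lam k}" for a
      unfolding A_def prod.reindex_bij_betw[OF qidx_bij[OF \<pi> kN(2)], symmetric] T_def
      using pos_qidx[OF \<pi> kN(1) that] pos_qidx[OF \<pi> kN(2)]
      by (intro prod.cong refl) simp
    have b: "(\<Prod>b\<in>{a+1..lamc lam k}. (1 - h * T k b / T k a) / (1 - T k b / T k a)) = B (qidx \<pi> k a)"
      if a: "a \<in> {1..lamc lam k}" for a
    proof -
      have "{a+1..lamc lam k} = {b\<in>{1..lamc lam k}. a < b}" using a by auto
      then have "(\<Prod>b\<in>{a+1..lamc lam k}. (1 - h * T k b / T k a) / (1 - T k b / T k a))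
          = (\<Prod>b\<in>{1..lamc lam k}. if a < b then (1 - h * T k b / T k a) / (1 - T k b / T k a) else 1)"
        by (simp only: prod.inter_filter finite_atLeastAtMost)
      also have "\<dots> = (\<Prod>b\<in>{1..lamc lam k}. if ?p k (qidx \<pi> k a) < ?p k (qidx \<pi> k b)
          then hf z h (qidx \<pi> k a) (qidx \<pi> k b) / zf z (qidx \<pi> k a) (qidx \<pi> k b) else 1)"
        using a pos_qidx[OF \<pi> kN(1)] elt_less_iff[of "cup I' k" a] ordpart_cup[OF I' kN(3)]
        by (intro prod.cong refl) (simp add: T_def)
      also have "\<dots> = B (qidx \<pi> k a)"
        unfolding B_def by (rule prod.reindex_bij_betw[OF qidx_bij[OF \<pi> kN(1)]])
      finally show ?thesis .
    qed
    have "(\<Prod>a\<in>{1..lamc lam k}.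
        (\<Prod>c\<in>{1..lamc lam (k+1)}.
            (if elt (cup I' (k+1)) c < elt (cup I' k) a then 1 - h * T (k+1) c / T k a
             else if elt (cup I' (k+1)) c > elt (cup I' k) a then 1 - T (k+1) c / T k a
             else 1))
        * (\<Prod>b\<in>{a+1..lamc lam k}. (1 - h * T k b / T k a) / (1 - T k b / T k a)))
      = (\<Prod>a\<in>{1..lamc lam k}. A (qidx \<pi> k a) * B (qidx \<pi> k a))"
      by (intro prod.cong refl arg_cong2[of _ _ _ _ "(*)"] a b)
    also have "\<dots> = (\<Prod>j\<in>?C k. A j * B j)"
      by (rule prod.reindex_bij_betw[OF qidx_bij[OF \<pi> kN(1)]])
    also have "\<dots> = (\<Prod>j\<in>{1..n}. if \<phi> j \<le> k then A j * B j else 1)"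
      by (rule prod_cup[OF kN(3)])
    also have "\<dots> = (\<Prod>j\<in>{1..n}. \<Prod>j'\<in>{1..n}. tfac (pos \<pi>) k j j' z h)"
      unfolding A_def B_def prod_cup[OF kN(3)] prod_cup[OF kN(4)] prod.distrib[symmetric]
      by (intro prod.cong refl) (auto simp: tfac_def intro!: prod.cong)
    finally show "(\<Prod>a\<in>{1..lamc lam k}.
        (\<Prod>c\<in>{1..lamc lam (k+1)}.
            (if elt (cup I' (k+1)) c < elt (cup I' k) a then 1 - h * T (k+1) c / T k a
             else if elt (cup I' (k+1)) c > elt (cup I' k) a then 1 - T (k+1) c / T k a
             else 1))
        * (\<Prod>b\<in>{a+1..lamc lam k}. (1 - h * T k b / T k a) / (1 - T k b / T k a)))
      = (\<Prod>j\<in>{1..n}. \<Prod>j'\<in>{1..n}. tfac (pos \<pi>) k j j' z h)" .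
  qed
qed

lemma wE_eq:
  "wE N lam (\<lambda>k a. z (elt (cup J k) a)) h
    = (\<Prod>k\<in>{1..N-1}. \<Prod>j\<in>{1..n}. \<Prod>j'\<in>{1..n}. if \<phi> j \<le> k \<and> \<phi> j' \<le> k then hf z h j j' else 1)"
  unfolding wE_def
proof (rule prod.cong[OF refl])
  fix k assume "k \<in> {1..N-1}"
  then have kN: "k \<le> N" by auto
  have "(\<Prod>a\<in>{1..lamc lam k}. \<Prod>b\<in>{1..lamc lam k}. 1 - h * z (elt (cup J k) b) / z (elt (cup J k) a))
     = (\<Prod>a\<in>{1..lamc lam k}. \<Prod>j'\<in>cup J k. hf z h (elt (cup J k) a) j')"
    by (intro prod.cong refl prod.reindex_bij_betw[OF elt_cup_bij[OF J kN]])
  also have "\<dots> = (\<Prod>j\<in>cup J k. \<Prod>j'\<in>cup J k. hf z h j j')"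
    by (rule prod.reindex_bij_betw[OF elt_cup_bij[OF J kN]])
  also have "\<dots> = (\<Prod>j\<in>{1..n}. \<Prod>j'\<in>{1..n}. if \<phi> j \<le> k \<and> \<phi> j' \<le> k then hf z h j j' else 1)"
    unfolding prod_cup[OF kN] by (auto intro!: prod.cong)
  finally show "(\<Prod>a\<in>{1..lamc lam k}. \<Prod>b\<in>{1..lamc lam k}. 1 - h * z (elt (cup J k) b) / z (elt (cup J k) a))
     = (\<Prod>j\<in>{1..n}. \<Prod>j'\<in>{1..n}. if \<phi> j \<le> k \<and> \<phi> j' \<le> k then hf z h j j' else 1)" .
qed

text \<open>\<open>E\<close> contains one diagonal factor \<open>1 - h\<close> for each variable.
  The prefactor of the weight function cancels exactly these, and is therefore placed on the pairs
  \<open>(j, j)\<close>.\<close>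

lemma one_minus_h_power:
  "(1 - h) ^ lam1 N lam = (\<Prod>k\<in>{1..N-1}. \<Prod>j\<in>{1..n}. \<Prod>j'\<in>{1..n}. if \<phi> j \<le> k \<and> j' = j then 1 - h else (1::complex))"
proof -
  have "(1 - h) ^ lamc lam k = (\<Prod>j\<in>{1..n}. \<Prod>j'\<in>{1..n}. if \<phi> j \<le> k \<and> j' = j then 1 - h else 1)"
    if k: "k \<in> {1..N-1}" for k
  proof -
    have kN: "k \<le> N" using k by auto
    have "(1 - h) ^ lamc lam k = (\<Prod>j\<in>cup J k. 1 - h)" using ordpart_cup[OF J kN] by simp
    also have "\<dots> = (\<Prod>j\<in>{1..n}. \<Prod>j'\<in>{1..n}. if j' = j then (if \<phi> j \<le> k then 1 - h else 1) else 1)"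
      unfolding prod_cup[OF kN] by (intro prod.cong refl) simp
    also have "\<dots> = (\<Prod>j\<in>{1..n}. \<Prod>j'\<in>{1..n}. if \<phi> j \<le> k \<and> j' = j then 1 - h else 1)"
      by (intro prod.cong refl) auto
    finally show ?thesis .
  qed
  then show ?thesis by (simp add: lam1_def power_sum)
qed

lemma genD:
  assumes "gen n z h" "a \<in> {1..n}" "b \<in> {1..n}"
  shows "z a \<noteq> 0" "h * z b \<noteq> z a" "a \<noteq> b \<Longrightarrow> z a \<noteq> z b"
  using assms unfolding gen_def by blast+

lemma hf_nonzero:
  assumes "gen n z h" "a \<in> {1..n}" "b \<in> {1..n}" shows "hf z h a b \<noteq> 0"
  using genD[OF assms] by (simp add: field_simps)

lemma zf_nonzero:
  assumes "gen n z h" "a \<in> {1..n}" "b \<in> {1..n}" "a \<noteq> b" shows "zf z a b \<noteq> 0"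
  using genD[OF assms(1-3)] assms(4) by (simp add: field_simps)

lemma wWt_eq:
  assumes "gen n z h"
  shows "wWt N lam \<sigma> I J z h
    = (\<Sum>\<pi>\<in>symperms N lam. \<Prod>k\<in>{1..N-1}. \<Prod>j\<in>{1..n}. \<Prod>j'\<in>{1..n}. rfac (pos \<pi>) k j j' z h)"
proof -
  let ?o = "\<lambda>k j j'. if \<phi> j \<le> k \<and> j' = j then 1 - h else 1"
  let ?e = "\<lambda>k j j'. if \<phi> j \<le> k \<and> \<phi> j' \<le> k then hf z h j j' else 1"
  have r: "?o k j j' * tfac p k j j' z h / ?e k j j' = rfac p k j j' z h"
    if "j \<in> {1..n}" "j' \<in> {1..n}" for p k j j'
  proof (cases "j = j'")
    case True
    \<comment> \<open>Genericity with two equal indices excludes \<open>h = 1\<close>.\<close>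
    have "z j \<noteq> 0" "1 - h \<noteq> 0" using genD[OF assms that(1) that(1)] by auto
    then show ?thesis unfolding True rfac_def tfac_def by simp
  next
    case False
    then show ?thesis unfolding rfac_def tfac_def by simp
  qed
  have "wWt N lam \<sigma> I J z h = (\<Sum>\<pi>\<in>symperms N lam. \<Prod>k\<in>{1..N-1}. \<Prod>j\<in>{1..n}. \<Prod>j'\<in>{1..n}.
      ?o k j j' * tfac (pos \<pi>) k j j' z h / ?e k j j')"
    unfolding wWt_def Let_def wW_def wE_eq one_minus_h_power prod.distrib prod_dividef
      sum_distrib_left sum_divide_distrib
    by (intro sum.cong refl) (simp add: wU_eq)
  also have "\<dots> = (\<Sum>\<pi>\<in>symperms N lam. \<Prod>k\<in>{1..N-1}. \<Prod>j\<in>{1..n}. \<Prod>j'\<in>{1..n}. rfac (pos \<pi>) k j j' z h)"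
    by (intro sum.cong prod.cong refl r)
  finally show ?thesis .
qed

text \<open>Brings the factors of the three axioms, written over blocks and positions, to the form
  of the localised weight function: a product over pairs of \<open>z\<close> indices, with positions
  read through \<open>inv \<sigma>\<close>.\<close>

lemma block_prod:
  fixes g :: "nat \<Rightarrow> nat \<Rightarrow> 'a::comm_monoid_mult"
  shows "(\<Prod>k\<in>{1..N}. \<Prod>l\<in>{k<..N}. \<Prod>a\<in>{a\<in>{1..n}. \<sigma> a \<in> J k}.
      \<Prod>b\<in>{b\<in>{1..n}. \<sigma> b \<in> J l \<and> R a b}. g (\<sigma> a) (\<sigma> b))
    = (\<Prod>j\<in>{1..n}. \<Prod>j'\<in>{1..n}. if \<phi> j < \<phi> j' \<and> R (s j) (s j') then g j j' else 1)"
proof -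
  have \<sigma>n: "\<sigma> a \<in> {1..n}" if "a \<in> {1..n}" for a using permutes_in_image[OF \<sigma>] that by simp
  have bl: "\<sigma> a \<in> J k \<longleftrightarrow> \<phi> (\<sigma> a) = k" if "a \<in> {1..n}" "k \<in> {1..N}" for a k
    using mem_block_iff[OF J \<sigma>n[OF that(1)] that(2)] .
  have inner: "(\<Prod>l\<in>{k<..N}. \<Prod>b\<in>{b\<in>{1..n}. \<sigma> b \<in> J l \<and> R a b}. g (\<sigma> a) (\<sigma> b))
      = (\<Prod>b\<in>{1..n}. if k < \<phi> (\<sigma> b) \<and> R a b then g (\<sigma> a) (\<sigma> b) else 1)" for k a
  proof -
    let ?S = "{b\<in>{1..n}. k < \<phi> (\<sigma> b) \<and> R a b}"
    have "(\<Prod>l\<in>{k<..N}. \<Prod>b\<in>{b\<in>{1..n}. \<sigma> b \<in> J l \<and> R a b}. g (\<sigma> a) (\<sigma> b))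
      = (\<Prod>l\<in>{k<..N}. \<Prod>b\<in>{b\<in>?S. \<phi> (\<sigma> b) = l}. g (\<sigma> a) (\<sigma> b))"
      using bl by (intro prod.cong refl) auto
    also have "\<dots> = (\<Prod>b\<in>?S. g (\<sigma> a) (\<sigma> b))"
      using blk_in(1)[OF J \<sigma>n] by (intro prod.group) auto
    also have "\<dots> = (\<Prod>b\<in>{1..n}. if k < \<phi> (\<sigma> b) \<and> R a b then g (\<sigma> a) (\<sigma> b) else 1)"
      by (rule prod.inter_filter) simp
    finally show ?thesis .
  qed
  have "(\<Prod>k\<in>{1..N}. \<Prod>l\<in>{k<..N}. \<Prod>a\<in>{a\<in>{1..n}. \<sigma> a \<in> J k}.
      \<Prod>b\<in>{b\<in>{1..n}. \<sigma> b \<in> J l \<and> R a b}. g (\<sigma> a) (\<sigma> b))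
    = (\<Prod>k\<in>{1..N}. \<Prod>a\<in>{a\<in>{1..n}. \<sigma> a \<in> J k}. \<Prod>b\<in>{1..n}. if k < \<phi> (\<sigma> b) \<and> R a b then g (\<sigma> a) (\<sigma> b) else 1)"
    by (subst prod.swap) (simp only: inner)
  also have "\<dots> = (\<Prod>k\<in>{1..N}. \<Prod>a\<in>{a\<in>{1..n}. \<phi> (\<sigma> a) = k}.
      \<Prod>b\<in>{1..n}. if \<phi> (\<sigma> a) < \<phi> (\<sigma> b) \<and> R a b then g (\<sigma> a) (\<sigma> b) else 1)"
    using bl by (intro prod.cong refl) auto
  also have "\<dots> = (\<Prod>a\<in>{1..n}. \<Prod>b\<in>{1..n}. if \<phi> (\<sigma> a) < \<phi> (\<sigma> b) \<and> R a b then g (\<sigma> a) (\<sigma> b) else 1)"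
    using blk_in(1)[OF J \<sigma>n] by (intro prod.group) auto
  also have "\<dots> = (\<Prod>a\<in>{1..n}. \<Prod>j'\<in>{1..n}. if \<phi> (\<sigma> a) < \<phi> j' \<and> R a (s j') then g (\<sigma> a) j' else 1)"
    using prod.permute[OF \<sigma>, of "\<lambda>j'. if \<phi> (\<sigma> a) < \<phi> j' \<and> R a (s j') then g (\<sigma> a) j' else 1" for a]
    by (simp add: o_def permutes_inverses(2)[OF \<sigma>])
  also have "\<dots> = (\<Prod>j\<in>{1..n}. \<Prod>j'\<in>{1..n}. if \<phi> j < \<phi> j' \<and> R (s j) (s j') then g j j' else 1)"
    using prod.permute[OF \<sigma>, of "\<lambda>j. \<Prod>j'\<in>{1..n}. if \<phi> j < \<phi> j' \<and> R (s j) (s j') then g j j' else 1"]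
    by (simp add: o_def permutes_inverses(2)[OF \<sigma>])
  finally show ?thesis .
qed

end

subsection \<open>Divisibility by the vertical Euler class\<close>

context flag_type
begin

definition gens :: "(var \<Rightarrow> complex) set" where
  "gens = {x \<in> torus. gen n (\<lambda>a. x (Z a)) (x H)}"

lemma gens_torus: "gens \<subseteq> torus"
  by (auto simp: gens_def)

lemma gpts_gens: "gpts \<subseteq> gens"
  by (auto simp: gpts_def gens_def torus_def gen_def inj_def)

text \<open>Within a term an ordered pair of indices has at most one denominator \<open>zf\<close>
  per level, and there are \<open>N - 1\<close> levels.\<close>

definition zdiff :: "(var \<Rightarrow> complex) \<Rightarrow> complex" where
  "zdiff x = (\<Prod>j\<in>{1..n}. \<Prod>j'\<in>{1..n}. if j = j' then 1 else (x (Z j) - x (Z j')) ^ (N - 1))"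

lemma Z_ZHvars: "a \<in> {1..n} \<Longrightarrow> Z a \<in> ZHvars n"
  by (simp add: ZHvars_def)

lemma H_ZHvars: "H \<in> ZHvars n"
  by (simp add: ZHvars_def)

end

context flag_pair
begin

text \<open>In all other terms some factor \<open>1 - z j / z j\<close> occurs.\<close>

definition descending :: "(nat \<Rightarrow> nat \<Rightarrow> nat) \<Rightarrow> bool" where
  "descending \<pi> \<longleftrightarrow> (\<forall>k\<in>{1..N-1}. \<forall>j\<in>{1..n}. \<phi> j \<le> k \<longrightarrow> pos \<pi> (k+1) j \<le> pos \<pi> k j)"

lemma term_eq_0:
  assumes "gen n z h" "\<not> descending \<pi>"
  shows "(\<Prod>k\<in>{1..N-1}. \<Prod>j\<in>{1..n}. \<Prod>j'\<in>{1..n}. rfac (pos \<pi>) k j j' z h) = 0"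
proof -
  obtain k j where kj: "k \<in> {1..N-1}" "j \<in> {1..n}" "\<phi> j \<le> k" "pos \<pi> (k+1) j > pos \<pi> k j"
    using assms(2) unfolding descending_def by (meson not_le)
  have "zf z j j = 0" using genD(1)[OF assms(1) kj(2,2)] by simp
  then have "rfac (pos \<pi>) k j j z h = 0" using kj unfolding rfac_def tfac_def by simp
  then have "(\<Prod>j'\<in>{1..n}. rfac (pos \<pi>) k j j' z h) = 0" using kj(2) by (intro prod_zero) auto
  then have "(\<Prod>j\<in>{1..n}. \<Prod>j'\<in>{1..n}. rfac (pos \<pi>) k j j' z h) = 0" using kj(2) by (intro prod_zero) blast+
  then show ?thesis using kj(1) by (intro prod_zero) blast+
qed

lemma pos_inj:
  assumes "\<pi> \<in> symperms N lam" "k \<in> {1..N}" "j \<in> {1..n}" "j' \<in> {1..n}" "\<phi> j \<le> k" "\<phi> j' \<le> k"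
    "pos \<pi> k j = pos \<pi> k j'"
  shows "j = j'"
proof -
  have "j \<in> cup J k" "j' \<in> cup J k" using assms mem_cup_iff[OF J, of k] by auto
  then show ?thesis using pos_bij[OF assms(1,2)] assms(7) by (auto simp: bij_betw_def inj_on_def)
qed

text \<open>At level \<open>k\<close>, \<open>hf z h j j'\<close> occurs \<open>na + nb\<close> times in the numerator and \<open>nc\<close> times in \<open>E\<close>,
  while \<open>zf z j j'\<close> occurs \<open>nd\<close> times in the numerator and \<open>nb\<close> times in the denominator.\<close>

definition na :: "(nat \<Rightarrow> nat \<Rightarrow> nat) \<Rightarrow> nat \<Rightarrow> nat \<Rightarrow> nat \<Rightarrow> nat" where
  "na \<pi> j j' k = of_bool (\<phi> j \<le> k \<and> \<phi> j' \<le> k + 1 \<and> pos \<pi> (k+1) j' < pos \<pi> k j)"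

definition nb :: "(nat \<Rightarrow> nat \<Rightarrow> nat) \<Rightarrow> nat \<Rightarrow> nat \<Rightarrow> nat \<Rightarrow> nat" where
  "nb \<pi> j j' k = of_bool (\<phi> j \<le> k \<and> \<phi> j' \<le> k \<and> pos \<pi> k j < pos \<pi> k j')"

definition nc :: "nat \<Rightarrow> nat \<Rightarrow> nat \<Rightarrow> nat" where
  "nc j j' k = of_bool (\<phi> j \<le> k \<and> \<phi> j' \<le> k \<and> j \<noteq> j')"

definition nd :: "(nat \<Rightarrow> nat \<Rightarrow> nat) \<Rightarrow> nat \<Rightarrow> nat \<Rightarrow> nat \<Rightarrow> nat" where
  "nd \<pi> j j' k = of_bool (\<phi> j \<le> k \<and> \<phi> j' \<le> k + 1 \<and> pos \<pi> (k+1) j' > pos \<pi> k j)"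

text \<open>If \<open>j\<close> precedes \<open>j'\<close> at level \<open>k\<close>, then
  \<open>nb\<close> counts the pair. Otherwise \<open>j'\<close> precedes \<open>j\<close>, its
  position one level up is no larger, and \<open>na\<close> counts the pair.\<close>

lemma nc_le:
  assumes "\<pi> \<in> symperms N lam" "descending \<pi>" "k \<in> {1..N-1}" "j \<in> {1..n}" "j' \<in> {1..n}"
  shows "nc j j' k \<le> na \<pi> j j' k + nb \<pi> j j' k"
proof (cases "\<phi> j \<le> k \<and> \<phi> j' \<le> k \<and> j \<noteq> j'")
  case True
  moreover have "k \<in> {1..N}" using assms by auto
  ultimately have "pos \<pi> k j \<noteq> pos \<pi> k j'" using pos_inj[of \<pi> k j j'] assms by blast
  moreover have "pos \<pi> (k+1) j' \<le> pos \<pi> k j'" using assms True by (auto simp: descending_def)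
  ultimately show ?thesis using True by (auto simp: na_def nb_def nc_def)
qed (auto simp: nc_def)

text \<open>The positions of \<open>j\<close> and \<open>j'\<close> must cross on the way up to level \<open>N\<close>, and each crossing contributes
  one factor more than \<open>E\<close> removes.\<close>

lemma vert_surplus:
  assumes \<pi>: "\<pi> \<in> symperms N lam" and desc: "descending \<pi>" and jj: "j \<in> {1..n}" "j' \<in> {1..n}"
    and lt: "\<phi> j < \<phi> j'" "s j' < s j"
  shows "\<exists>m\<in>{1..N-1}. nc j j' m < na \<pi> j j' m + nb \<pi> j j' m"
proof (rule ccontr)
  assume neg: "\<not> ?thesis"
  define l where "l = \<phi> j'"
  have l: "l \<ge> 2" "l \<le> N" "\<phi> j \<le> l - 1"
    using blk_in(1)[OF J jj(1)] blk_in(1)[OF J jj(2)] lt by (auto simp: l_def)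
  have ne: "j \<noteq> j'" using lt by auto
  have l1: "l - 1 \<in> {1..N-1}" "l - 1 + 1 = l" using l by auto
  \<comment> \<open>Level \<open>l - 1\<close> is the last one without \<open>j'\<close>, so
    \<open>E\<close> removes nothing there and absence of a surplus forces \<open>na\<close> to
    vanish. This fixes the order of the two positions at level \<open>l\<close>; it then persists up
    to level \<open>N\<close>, contrary to the order of \<open>s j\<close> and
    \<open>s j'\<close>.\<close>
  have "na \<pi> j j' (l - 1) = 0"
  proof -
    have "nc j j' (l - 1) = 0" using l by (auto simp: nc_def l_def)
    then show ?thesis using neg l1 by (metis add_gr_0 not_gr_zero)
  qed
  then have "pos \<pi> (l - 1) j \<le> pos \<pi> l j'" using l l1 by (auto simp: na_def l_def)
  moreover have "pos \<pi> l j \<le> pos \<pi> (l - 1) j"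
    using desc l l1 jj unfolding descending_def by (metis l1(2))
  moreover have "l \<in> {1..N}" "\<phi> j \<le> l" "\<phi> j' \<le> l" using l by (auto simp: l_def)
  then have "pos \<pi> l j \<noteq> pos \<pi> l j'" using pos_inj[OF \<pi>, of l j j'] jj ne by blast
  ultimately have base: "pos \<pi> l j < pos \<pi> l j'" by simp
  have "pos \<pi> m j < pos \<pi> m j'" if "l \<le> m" "m \<le> N" for m
    using that
  proof (induction m rule: dec_induct)
    case (step m)
    have m: "m \<in> {1..N-1}" "\<phi> j \<le> m" "\<phi> j' \<le> m" using step l by (auto simp: l_def)
    have "nb \<pi> j j' m = 1" "nc j j' m = 1" using step m ne by (auto simp: nb_def nc_def)
    moreover have "\<not> nc j j' m < na \<pi> j j' m + nb \<pi> j j' m" using neg m(1) by blast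
    ultimately have "na \<pi> j j' m = 0" by simp
    then have "pos \<pi> m j \<le> pos \<pi> (m + 1) j'" using m by (auto simp: na_def)
    moreover have "pos \<pi> (m + 1) j \<le> pos \<pi> m j" using desc m jj by (auto simp: descending_def)
    moreover have "m + 1 \<in> {1..N}" "\<phi> j \<le> m + 1" "\<phi> j' \<le> m + 1" using m by auto
    then have "pos \<pi> (m + 1) j \<noteq> pos \<pi> (m + 1) j'" using pos_inj[OF \<pi>, of "m + 1" j j'] jj ne by blast
    ultimately show ?case by simp
  qed (use base in simp)
  from this[OF l(2) order_refl] show False using pos_N[OF \<pi>] jj lt by simp
qed

lemma prod_if_power:
  fixes u v :: complex and l m :: nat
  shows "(if A \<and> A' then (if l < m then u else if l > m then v else 1) else 1) * (if B then u / v else 1) / (if C then u else 1)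
    = u ^ of_bool (A \<and> A' \<and> l < m) * v ^ of_bool (A \<and> A' \<and> l > m) * (u ^ of_bool B / v ^ of_bool B) / u ^ of_bool C"
  by (cases "A \<and> A'"; cases B; cases C; cases l m rule: linorder_cases) auto

lemma rfac_eq:
  assumes "\<pi> \<in> symperms N lam" "descending \<pi>" "k \<in> {1..N-1}" "j \<in> {1..n}" "j' \<in> {1..n}" "gen n z h"
  shows "rfac (pos \<pi>) k j j' z h = hf z h j j' ^ (na \<pi> j j' k + nb \<pi> j j' k - nc j j' k)
     * (zf z j j' ^ nd \<pi> j j' k / zf z j j' ^ nb \<pi> j j' k)"
proof -
  have h: "hf z h j j' \<noteq> 0" using hf_nonzero assms by blast
  have "rfac (pos \<pi>) k j j' z h = hf z h j j' ^ na \<pi> j j' k * zf z j j' ^ nd \<pi> j j' k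
      * (hf z h j j' ^ nb \<pi> j j' k / zf z j j' ^ nb \<pi> j j' k) / hf z h j j' ^ nc j j' k"
    unfolding rfac_def tfac_def na_def nb_def nc_def nd_def by (rule prod_if_power)
  also have "\<dots> = hf z h j j' ^ (na \<pi> j j' k + nb \<pi> j j' k) / hf z h j j' ^ nc j j' k
      * (zf z j j' ^ nd \<pi> j j' k / zf z j j' ^ nb \<pi> j j' k)"
    by (simp add: power_add mult_ac)
  also have "hf z h j j' ^ (na \<pi> j j' k + nb \<pi> j j' k) / hf z h j j' ^ nc j j' k
      = hf z h j j' ^ (na \<pi> j j' k + nb \<pi> j j' k - nc j j' k)"
    using power_diff[OF h nc_le[OF assms(1-5)]] by simp
  finally show ?thesis .
qed

abbreviation "vert j j' \<equiv> \<phi> j < \<phi> j' \<and> s j' < s j"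

text \<open>The exponents of \<open>hf\<close> add up over the levels to \<open>e\<close>, which is
  positive for vertical pairs, so one \<open>hf\<close> can be extracted. The \<open>N - 1\<close>
  differences are dealt out one per level, where they cancel a possible denominator
  \<open>zf\<close>.\<close>

lemma pair_factor:
  assumes "\<pi> \<in> symperms N lam" "descending \<pi>" "j \<in> {1..n}" "j' \<in> {1..n}"
  shows "\<exists>L. laur gens (ZHvars n) L \<and> (\<forall>x\<in>gens.
      (\<Prod>k\<in>{1..N-1}. rfac (pos \<pi>) k j j' (\<lambda>a. x (Z a)) (x H)) * (if j = j' then 1 else (x (Z j) - x (Z j')) ^ (N - 1))
      = (if vert j j' then hf (\<lambda>a. x (Z a)) (x H) j j' else 1) * L x)"
proof -
  define e where "e = (\<Sum>k\<in>{1..N-1}. na \<pi> j j' k + nb \<pi> j j' k - nc j j' k)"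
  define h1 where "h1 x = 1 - x H * x (Z j') / x (Z j)" for x :: "var \<Rightarrow> complex"
  define z1 where "z1 x = 1 - x (Z j') / x (Z j)" for x :: "var \<Rightarrow> complex"
  \<comment> \<open>What remains of the difference assigned to level \<open>k\<close>: dividing it
    by \<open>zf\<close> leaves \<open>z j\<close>; without a denominator it stays whole.\<close>
  define g where "g k x = (if j = j' then 1 else if nb \<pi> j j' k = 1 then x (Z j) else x (Z j) - x (Z j'))"
    for k and x :: "var \<Rightarrow> complex"
  define L where "L x = h1 x ^ (e - of_bool (vert j j')) * (\<Prod>k\<in>{1..N-1}. z1 x ^ nd \<pi> j j' k * g k x)" for x
  have ZH: "Z j \<in> ZHvars n" "Z j' \<in> ZHvars n" using assms Z_ZHvars by auto
  have l1: "laur gens (ZHvars n) h1" "laur gens (ZHvars n) z1"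
    unfolding h1_def z1_def using ZH H_ZHvars
    by (intro laur_diff laur_const laur_divide_var laur_mult laur_var gens_torus; simp)+
  have "laur gens (ZHvars n) (g k)" for k
    unfolding g_def using ZH
    by (cases "j = j'"; cases "nb \<pi> j j' k = 1") (simp_all add: laur_diff)
  then have "laur gens (ZHvars n) L"
    unfolding L_def by (intro laur_mult laur_power laur_prod gens_torus l1)
  moreover have "(\<Prod>k\<in>{1..N-1}. rfac (pos \<pi>) k j j' (\<lambda>a. x (Z a)) (x H)) * (if j = j' then 1 else (x (Z j) - x (Z j')) ^ (N - 1))
      = (if vert j j' then hf (\<lambda>a. x (Z a)) (x H) j j' else 1) * L x" if x: "x \<in> gens" for x
  proof -
    have gen: "gen n (\<lambda>a. x (Z a)) (x H)" using x by (simp add: gens_def)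
    have v1: "e \<ge> 1" if v: "vert j j'"
    proof -
      obtain m where m: "m \<in> {1..N-1}" "nc j j' m < na \<pi> j j' m + nb \<pi> j j' m"
        using vert_surplus[OF assms] v by blast
      then have "na \<pi> j j' m + nb \<pi> j j' m - nc j j' m \<le> e" unfolding e_def by (intro member_le_sum) auto
      then show ?thesis using m by simp
    qed
    have "(\<Prod>k\<in>{1..N-1}. rfac (pos \<pi>) k j j' (\<lambda>a. x (Z a)) (x H))
       = (\<Prod>k\<in>{1..N-1}. h1 x ^ (na \<pi> j j' k + nb \<pi> j j' k - nc j j' k) * (z1 x ^ nd \<pi> j j' k / z1 x ^ nb \<pi> j j' k))"
      using rfac_eq[OF assms(1,2) _ assms(3,4) gen] by (intro prod.cong refl) (simp add: h1_def z1_def)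
    also have "\<dots> = h1 x ^ e * (\<Prod>k\<in>{1..N-1}. z1 x ^ nd \<pi> j j' k / z1 x ^ nb \<pi> j j' k)"
      unfolding prod.distrib e_def power_sum ..
    also have "h1 x ^ e = (if vert j j' then h1 x else 1) * h1 x ^ (e - of_bool (vert j j'))"
      using v1 by (cases "vert j j'") (auto simp: power_Suc[symmetric] simp del: power_Suc)
    finally have 1: "(\<Prod>k\<in>{1..N-1}. rfac (pos \<pi>) k j j' (\<lambda>a. x (Z a)) (x H))
      = (if vert j j' then h1 x else 1) * h1 x ^ (e - of_bool (vert j j')) * (\<Prod>k\<in>{1..N-1}. z1 x ^ nd \<pi> j j' k / z1 x ^ nb \<pi> j j' k)" .
    have d: "(if j = j' then 1 else (x (Z j) - x (Z j')) ^ (N - 1))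
        = (\<Prod>k\<in>{1..N-1}. if j = j' then 1 else x (Z j) - x (Z j'))" by simp
    have "z1 x ^ nd \<pi> j j' k / z1 x ^ nb \<pi> j j' k * (if j = j' then 1 else x (Z j) - x (Z j'))
       = z1 x ^ nd \<pi> j j' k * g k x" for k
    proof (cases "j = j'")
      case True then show ?thesis by (simp add: nb_def g_def)
    next
      case False
      have "z1 x \<noteq> 0" "x (Z j) \<noteq> 0"
        using zf_nonzero[OF gen assms(3,4) False] genD(1)[OF gen assms(3,4)] by (auto simp: z1_def)
      moreover have "x (Z j) - x (Z j') = z1 x * x (Z j)" using \<open>x (Z j) \<noteq> 0\<close> by (simp add: z1_def field_simps)
      ultimately show ?thesis using False by (simp add: nb_def g_def)
    qed
    then have "(\<Prod>k\<in>{1..N-1}. z1 x ^ nd \<pi> j j' k / z1 x ^ nb \<pi> j j' k) * (if j = j' then 1 else (x (Z j) - x (Z j')) ^ (N - 1))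
      = (\<Prod>k\<in>{1..N-1}. z1 x ^ nd \<pi> j j' k * g k x)"
      unfolding d prod.distrib[symmetric] by simp
    then show ?thesis unfolding 1 L_def by (simp add: h1_def mult.assoc)
  qed
  ultimately show ?thesis by blast
qed

lemma leval_evert:
  assumes "x \<in> torus"
  shows "leval (evert N n \<sigma> J) x
    = (\<Prod>j\<in>{1..n}. \<Prod>j'\<in>{1..n}. if vert j j' then hf (\<lambda>a. x (Z a)) (x H) j j' else 1)"
  using block_prod[where R = "\<lambda>a b. b < a" and g = "\<lambda>j j'. hf (\<lambda>a. x (Z a)) (x H) j j'"]
  by (simp add: evert_def assms meval_add meval_diff)

lemma prod3_rotate:
  "(\<Prod>k\<in>A. \<Prod>j\<in>B. \<Prod>j'\<in>C. f k j j') = (\<Prod>j\<in>B. \<Prod>j'\<in>C. \<Prod>k\<in>A. (f k j j' :: 'a::comm_monoid_mult))"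
  by (subst prod.swap) (intro prod.cong refl prod.swap)

lemma term_vert:
  assumes "\<pi> \<in> symperms N lam"
  shows "\<exists>L. laur gens (ZHvars n) L \<and> (\<forall>x\<in>gens.
      (\<Prod>k\<in>{1..N-1}. \<Prod>j\<in>{1..n}. \<Prod>j'\<in>{1..n}. rfac (pos \<pi>) k j j' (\<lambda>a. x (Z a)) (x H)) * zdiff x
      = leval (evert N n \<sigma> J) x * L x)"
proof (cases "descending \<pi>")
  case False
  have "(\<Prod>k\<in>{1..N-1}. \<Prod>j\<in>{1..n}. \<Prod>j'\<in>{1..n}. rfac (pos \<pi>) k j j' (\<lambda>a. x (Z a)) (x H)) = 0"
    if "x \<in> gens" for x
    using that by (intro term_eq_0[OF _ False]) (simp add: gens_def)
  then show ?thesis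
    by (intro exI[of _ "\<lambda>_. 0"] conjI ballI laur_const) (simp only: mult_zero_left mult_zero_right)
next
  case True
  have "\<forall>j\<in>{1..n}. \<forall>j'\<in>{1..n}. \<exists>L. laur gens (ZHvars n) L \<and> (\<forall>x\<in>gens.
      (\<Prod>k\<in>{1..N-1}. rfac (pos \<pi>) k j j' (\<lambda>a. x (Z a)) (x H)) * (if j = j' then 1 else (x (Z j) - x (Z j')) ^ (N - 1))
      = (if vert j j' then hf (\<lambda>a. x (Z a)) (x H) j j' else 1) * L x)"
    using pair_factor[OF assms True] by blast
  then obtain L where L: "\<And>j j'. j \<in> {1..n} \<Longrightarrow> j' \<in> {1..n} \<Longrightarrow> laur gens (ZHvars n) (L j j')"
    "\<And>j j' x. j \<in> {1..n} \<Longrightarrow> j' \<in> {1..n} \<Longrightarrow> x \<in> gens \<Longrightarrow>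
      (\<Prod>k\<in>{1..N-1}. rfac (pos \<pi>) k j j' (\<lambda>a. x (Z a)) (x H)) * (if j = j' then 1 else (x (Z j) - x (Z j')) ^ (N - 1))
      = (if vert j j' then hf (\<lambda>a. x (Z a)) (x H) j j' else 1) * L j j' x"
    unfolding bchoice_iff by metis
  have "laur gens (ZHvars n) (\<lambda>x. \<Prod>j\<in>{1..n}. \<Prod>j'\<in>{1..n}. L j j' x)"
    by (intro laur_prod gens_torus L(1))
  moreover have "(\<Prod>k\<in>{1..N-1}. \<Prod>j\<in>{1..n}. \<Prod>j'\<in>{1..n}. rfac (pos \<pi>) k j j' (\<lambda>a. x (Z a)) (x H)) * zdiff x
      = leval (evert N n \<sigma> J) x * (\<Prod>j\<in>{1..n}. \<Prod>j'\<in>{1..n}. L j j' x)" if x: "x \<in> gens" for x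
    unfolding prod3_rotate[where A = "{1..N-1}"] zdiff_def leval_evert[OF subsetD[OF gens_torus x]] prod.distrib[symmetric]
    by (intro prod.cong refl L(2) x)
  ultimately show ?thesis by blast
qed

text \<open>Divisibility is first stated up to \<open>zdiff\<close>, since single terms may have
  poles at equal \<open>z\<close>. The factor is removed once the restriction is known to be a
  Laurent polynomial, by coprimality with \<open>evert\<close>.\<close>

lemma wWt_vert:
  "\<exists>P. lvars P \<subseteq> ZHvars n \<and> (\<forall>x\<in>gens.
      wWt N lam \<sigma> I J (\<lambda>a. x (Z a)) (x H) * zdiff x = leval (evert N n \<sigma> J) x * leval P x)"
proof -
  obtain L where L: "\<And>\<pi>. \<pi> \<in> symperms N lam \<Longrightarrow> laur gens (ZHvars n) (L \<pi>)"
    "\<And>\<pi> x. \<pi> \<in> symperms N lam \<Longrightarrow> x \<in> gens \<Longrightarrow>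
      (\<Prod>k\<in>{1..N-1}. \<Prod>j\<in>{1..n}. \<Prod>j'\<in>{1..n}. rfac (pos \<pi>) k j j' (\<lambda>a. x (Z a)) (x H)) * zdiff x
      = leval (evert N n \<sigma> J) x * L \<pi> x"
    using term_vert by metis
  have "laur gens (ZHvars n) (\<lambda>x. \<Sum>\<pi>\<in>symperms N lam. L \<pi> x)" by (intro laur_sum L(1))
  then obtain P where P: "lvars P \<subseteq> ZHvars n" "\<And>x. x \<in> gens \<Longrightarrow> (\<Sum>\<pi>\<in>symperms N lam. L \<pi> x) = leval P x"
    by (auto simp: laur_def)
  have "wWt N lam \<sigma> I J (\<lambda>a. x (Z a)) (x H) * zdiff x = leval (evert N n \<sigma> J) x * leval P x"
    if x: "x \<in> gens" for x
  proof -
    have gen: "gen n (\<lambda>a. x (Z a)) (x H)" using x by (simp add: gens_def)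
    show ?thesis unfolding wWt_eq[OF gen] sum_distrib_right P(2)[OF x, symmetric] sum_distrib_left
      by (intro sum.cong refl L(2) x)
  qed
  then show ?thesis using P(1) by blast
qed

subsection \<open>The diagonal restriction\<close>

text \<open>Descent from level \<open>N\<close> gives \<open>s j \<le> pos \<pi> k j\<close>. For
  \<open>J = I\<close> both sides enumerate the same set as \<open>j\<close> runs over
  \<open>cup J k\<close>, so their sums agree and every inequality is an equality.\<close>

lemma descending_diagonal:
  assumes "J = I" "\<pi> \<in> symperms N lam" "descending \<pi>" "k \<in> {1..N}" "j \<in> cup J k"
  shows "pos \<pi> k j = s j"
proof -
  have le: "s j \<le> pos \<pi> k j" if "k \<le> N" "1 \<le> k" "j \<in> cup J k" for k j
    using that
  proof (induction k rule: inc_induct)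
    case base
    then show ?case using pos_N[OF assms(2)] cup_N[OF J] by simp
  next
    case (step k)
    have j: "j \<in> {1..n}" "\<phi> j \<le> k" using step mem_cup_iff[OF J, of k j] by auto
    then have "j \<in> cup J (Suc k)" using step mem_cup_iff[OF J, of "Suc k" j] by simp
    then have "s j \<le> pos \<pi> (Suc k) j" using step by simp
    moreover have "pos \<pi> (Suc k) j \<le> pos \<pi> k j"
    proof -
      have "k \<in> {1..N-1}" using step.hyps step.prems by auto
      then show ?thesis using assms(3) j unfolding descending_def by (metis Suc_eq_plus1)
    qed
    ultimately show ?case by simp
  qed
  have s: "inj s" using permutes_inj[OF permutes_inv[OF \<sigma>]] .
  have "(\<Sum>j\<in>cup J k. pos \<pi> k j) = (\<Sum>i\<in>cup I' k. i)"
    by (rule sum.reindex_bij_betw[OF pos_bij[OF assms(2,4)]])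
  also have "cup I' k = s ` cup J k" by (simp add: cup_image assms(1))
  also have "(\<Sum>i\<in>s ` cup J k. i) = (\<Sum>j\<in>cup J k. s j)"
    by (simp add: sum.reindex[OF inj_on_subset[OF s subset_UNIV]])
  finally have "(\<Sum>j\<in>cup J k. s j) = (\<Sum>j\<in>cup J k. pos \<pi> k j)" by simp
  then have "s j = pos \<pi> k j"
  proof (rule sum_mono_inv)
    show "s i \<le> pos \<pi> k i" if "i \<in> cup J k" for i using le[of k i] assms(4) that by simp
    show "finite (cup J k)" using ordpart_cup(2)[OF J, of k] assms(4) by simp
  qed (fact assms(5))
  then show ?thesis by simp
qed

text \<open>The condition says that \<open>pos\<close> is \<open>inv \<sigma>\<close> at every
  level. It describes the only term that survives in the diagonal restriction.\<close>

lemma diagonal_perm: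
  assumes "J = I"
  shows "\<exists>!\<pi>. \<pi> \<in> symperms N lam \<and> (\<forall>k\<in>{1..N-1}. \<forall>a\<in>{1..lamc lam k}. elt (cup J k) (\<pi> k a) = \<sigma> (elt (cup I' k) a))"
proof (rule ex_ex1I)
  have "\<exists>\<rho>. \<rho> permutes {1..lamc lam k} \<and> (\<forall>a\<in>{1..lamc lam k}. elt (cup J k) (\<rho> a) = \<sigma> (elt (cup I' k) a))"
    if k: "k \<in> {1..N-1}" for k
  proof -
    have kN: "k \<le> N" using k by auto
    have "\<sigma> ` cup I' k = cup J k"
      using permutes_surj[OF \<sigma>] by (simp add: cup_image assms image_f_inv_f)
    moreover have "inj_on \<sigma> (cup I' k)" using permutes_inj[OF \<sigma>] by (rule inj_on_subset) simp
    ultimately have "bij_betw \<sigma> (cup I' k) (cup J k)" by (simp add: bij_betw_def)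
    from matching_permutation[OF elt_cup_bij[OF J kN] bij_betw_trans[OF elt_cup_bij[OF I' kN] this]]
    show ?thesis by (metis comp_apply)
  qed
  then obtain \<rho> where \<rho>: "\<And>k. k \<in> {1..N-1} \<Longrightarrow> \<rho> k permutes {1..lamc lam k}"
    "\<And>k a. k \<in> {1..N-1} \<Longrightarrow> a \<in> {1..lamc lam k} \<Longrightarrow> elt (cup J k) (\<rho> k a) = \<sigma> (elt (cup I' k) a)" by metis
  show "\<exists>\<pi>. \<pi> \<in> symperms N lam \<and> (\<forall>k\<in>{1..N-1}. \<forall>a\<in>{1..lamc lam k}. elt (cup J k) (\<pi> k a) = \<sigma> (elt (cup I' k) a))"
    using \<rho> by (intro exI[of _ "\<lambda>k. if k \<in> {1..N-1} then \<rho> k else id"]) (auto simp: symperms_def permutes_id)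
next
  fix \<pi> \<rho>
  assume \<pi>: "\<pi> \<in> symperms N lam \<and> (\<forall>k\<in>{1..N-1}. \<forall>a\<in>{1..lamc lam k}. elt (cup J k) (\<pi> k a) = \<sigma> (elt (cup I' k) a))"
    and \<rho>: "\<rho> \<in> symperms N lam \<and> (\<forall>k\<in>{1..N-1}. \<forall>a\<in>{1..lamc lam k}. elt (cup J k) (\<rho> k a) = \<sigma> (elt (cup I' k) a))"
  show "\<pi> = \<rho>"
  proof (rule ext)
    fix k
    show "\<pi> k = \<rho> k"
    proof (cases "k \<in> {1..N-1}")
      case True
      then have kN: "k \<le> N" by auto
      have pp: "\<pi> k permutes {1..lamc lam k}" "\<rho> k permutes {1..lamc lam k}"
        using \<pi> \<rho> True symperms_permutes by blast+
      show ?thesis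
      proof
        fix a show "\<pi> k a = \<rho> k a"
        proof (cases "a \<in> {1..lamc lam k}")
          case a: True
          have "elt (cup J k) (\<pi> k a) = \<sigma> (elt (cup I' k) a)" "elt (cup J k) (\<rho> k a) = \<sigma> (elt (cup I' k) a)"
            using \<pi> \<rho> True a by blast+
          then have "elt (cup J k) (\<pi> k a) = elt (cup J k) (\<rho> k a)" by simp
          moreover have "\<pi> k a \<in> {1..lamc lam k}" "\<rho> k a \<in> {1..lamc lam k}"
            using pp[THEN permutes_in_image] a by blast+
          ultimately show ?thesis using inj_onD[OF bij_betw_imp_inj_on[OF elt_cup_bij[OF J kN]]] by blast
        next
          case False
          then show ?thesis using pp by (simp add: permutes_not_in)
        qed
      qed
    next
      case False
      then show ?thesis using \<pi> \<rho> symperms_id by metis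
    qed
  qed
qed

text \<open>In the surviving term, the factors of a pair present at level \<open>k\<close> cancel
  completely against \<open>E\<close>. What is left comes from level \<open>\<phi> j' - 1\<close>,
  where \<open>j\<close> is present and \<open>j'\<close> is about to enter.\<close>

lemma wWt_diagonal:
  assumes "J = I" "gen n z h"
  shows "wWt N lam \<sigma> I J z h
    = (\<Prod>j\<in>{1..n}. \<Prod>j'\<in>{1..n}. if \<phi> j < \<phi> j' then (if s j' < s j then hf z h j j' else zf z j j') else 1)"
proof -
  define T where "T \<pi> = (\<Prod>k\<in>{1..N-1}. \<Prod>j\<in>{1..n}. \<Prod>j'\<in>{1..n}. rfac (pos \<pi>) k j j' z h)" for \<pi>
  define G where "G \<pi> \<longleftrightarrow> (\<forall>k\<in>{1..N-1}. \<forall>a\<in>{1..lamc lam k}. elt (cup J k) (\<pi> k a) = \<sigma> (elt (cup I' k) a))" for \<pi>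
  obtain \<pi>0 where \<pi>0: "\<pi>0 \<in> symperms N lam" "G \<pi>0" "\<And>\<pi>. \<pi> \<in> symperms N lam \<Longrightarrow> G \<pi> \<Longrightarrow> \<pi> = \<pi>0"
    using diagonal_perm[OF assms(1), folded G_def] by (elim ex1E) blast
  have "T \<pi> = 0" if \<pi>: "\<pi> \<in> symperms N lam" "\<pi> \<noteq> \<pi>0" for \<pi>
  proof -
    have "\<not> descending \<pi>"
    proof
      assume d: "descending \<pi>"
      have "G \<pi>" unfolding G_def
      proof (intro ballI)
        fix k a assume k: "k \<in> {1..N-1}" and a: "a \<in> {1..lamc lam k}"
        have kN: "k \<in> {1..N}" "k \<noteq> N" using k by auto
        have q: "qidx \<pi> k a = elt (cup J k) (\<pi> k a)" using kN by (simp add: qidx_def)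
        have "qidx \<pi> k a \<in> cup J k" by (rule bij_betw_apply[OF qidx_bij[OF \<pi>(1) kN(1)] a])
        then have "pos \<pi> k (qidx \<pi> k a) = s (qidx \<pi> k a)"
          by (rule descending_diagonal[OF assms(1) \<pi>(1) d kN(1)])
        then have "elt (cup I' k) a = s (elt (cup J k) (\<pi> k a))"
          using pos_qidx[OF \<pi>(1) kN(1) a] q by simp
        then show "elt (cup J k) (\<pi> k a) = \<sigma> (elt (cup I' k) a)"
          by (simp add: permutes_inverses(1)[OF \<sigma>])
      qed
      then show False using \<pi>0(3) \<pi> by blast
    qed
    then show ?thesis unfolding T_def by (rule term_eq_0[OF assms(2)])
  qed
  then have "(\<Sum>\<pi>\<in>symperms N lam. T \<pi>) = (\<Sum>\<pi>\<in>{\<pi>0}. T \<pi>)"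
    using \<pi>0(1) finite_symperms by (intro sum.mono_neutral_right) auto
  then have "wWt N lam \<sigma> I J z h = T \<pi>0" using wWt_eq[OF assms(2)] by (simp add: T_def)
  have pos0: "pos \<pi>0 k j = s j" if k: "k \<in> {1..N}" and j: "j \<in> {1..n}" "\<phi> j \<le> k" for k j
  proof (cases "k = N")
    case True then show ?thesis using pos_N[OF \<pi>0(1)] j by simp
  next
    case False
    then have k': "k \<in> {1..N-1}" using k by auto
    have "j \<in> cup J k" using j k mem_cup_iff[OF J, of k] by auto
    then obtain a where a: "a \<in> {1..lamc lam k}" "j = qidx \<pi>0 k a"
      using qidx_bij[OF \<pi>0(1) k] by (metis bij_betw_def imageE)
    have "j = \<sigma> (elt (cup I' k) a)" using \<pi>0(2) k' a False by (simp add: G_def qidx_def)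
    then have "s j = elt (cup I' k) a" by (simp add: permutes_inverses(2)[OF \<sigma>])
    then show ?thesis using pos_qidx[OF \<pi>0(1) k a(1)] a(2) by simp
  qed
  have s: "inj s" using permutes_inj[OF permutes_inv[OF \<sigma>]] .
  have r: "rfac (pos \<pi>0) k j j' z h
      = (if k = \<phi> j' - 1 then (if \<phi> j < \<phi> j' then (if s j' < s j then hf z h j j' else zf z j j') else 1) else 1)"
    if k: "k \<in> {1..N-1}" and j: "j \<in> {1..n}" "j' \<in> {1..n}" for k j j'
  proof -
    have b: "\<phi> j' \<ge> 1" using blk_in(1)[OF J j(2)] by simp
    have kN: "k \<in> {1..N}" "k + 1 \<in> {1..N}" using k by auto
    consider "\<not> \<phi> j \<le> k" | "\<phi> j \<le> k" "\<not> \<phi> j' \<le> k + 1" | "\<phi> j \<le> k" "\<phi> j' = k + 1"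
      | "\<phi> j \<le> k" "\<phi> j' \<le> k" "j = j'" | "\<phi> j \<le> k" "\<phi> j' \<le> k" "j \<noteq> j'" by linarith
    then show ?thesis
    proof cases
      case 1
      then show ?thesis using b by (auto simp: rfac_def tfac_def)
    next
      case 2
      then show ?thesis by (auto simp: rfac_def tfac_def)
    next
      case 3
      then have "j \<noteq> j'" by auto
      then have "s j \<noteq> s j'" using s by (auto simp: inj_def)
      then show ?thesis using 3 pos0[OF kN(1) j(1)] pos0[OF kN(2) j(2)] by (auto simp: rfac_def tfac_def)
    next
      case 4
      then show ?thesis using b pos0[OF kN(1) j(1)] pos0[OF kN(2) j(2)] by (auto simp: rfac_def tfac_def)
    next
      case 5
      have "s j \<noteq> s j'" using s 5 by (auto simp: inj_def)
      moreover have "hf z h j j' \<noteq> 0" "zf z j j' \<noteq> 0"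
        using hf_nonzero[OF assms(2) j] zf_nonzero[OF assms(2) j] 5 by auto
      ultimately show ?thesis using 5 b pos0[OF kN(1) j(1)] pos0[OF kN(1) j(2)] pos0[OF kN(2) j(2)]
        by (auto simp: rfac_def tfac_def)
    qed
  qed
  have "T \<pi>0 = (\<Prod>j\<in>{1..n}. \<Prod>j'\<in>{1..n}. \<Prod>k\<in>{1..N-1}. if k = \<phi> j' - 1 then (if \<phi> j < \<phi> j' then (if s j' < s j then hf z h j j' else zf z j j') else 1) else 1)"
    unfolding T_def prod3_rotate[where A = "{1..N-1}"] by (intro prod.cong refl r)
  also have "\<dots> = (\<Prod>j\<in>{1..n}. \<Prod>j'\<in>{1..n}. if \<phi> j < \<phi> j' then (if s j' < s j then hf z h j j' else zf z j j') else 1)"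
  proof (intro prod.cong refl)
    fix j j' assume j: "j \<in> {1..n}" "j' \<in> {1..n}"
    have "\<phi> j < \<phi> j' \<Longrightarrow> \<phi> j' - 1 \<in> {1..N-1}"
      using blk_in(1)[OF J j(1)] blk_in(1)[OF J j(2)] by auto
    then show "(\<Prod>k\<in>{1..N-1}. if k = \<phi> j' - 1 then (if \<phi> j < \<phi> j' then (if s j' < s j then hf z h j j' else zf z j j') else 1) else 1)
      = (if \<phi> j < \<phi> j' then (if s j' < s j then hf z h j j' else zf z j j') else 1)"
      by (simp add: prod.delta)
  qed
  finally show ?thesis using \<open>wWt N lam \<sigma> I J z h = T \<pi>0\<close> by simp
qed

text \<open>The role of \<open>Pfac\<close> is the identity
  \<open>- (b / a) * (1 - a / b) = 1 - b / a\<close>, which turns the horizontal factors of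
  \<open>efac\<close> into those of the weight function.\<close>

lemma leval_Pfac_efac:
  assumes "x \<in> gens"
  shows "leval (Pfac N n \<sigma> J * efac N n \<sigma> J) x
    = (\<Prod>j\<in>{1..n}. \<Prod>j'\<in>{1..n}. if \<phi> j < \<phi> j' then
         (if s j' < s j then hf (\<lambda>a. x (Z a)) (x H) j j' else zf (\<lambda>a. x (Z a)) j j') else 1)"
proof -
  have x: "x \<in> torus" and gen: "gen n (\<lambda>a. x (Z a)) (x H)" using assms by (auto simp: gens_def)
  have P: "leval (Pfac N n \<sigma> J) x
      = (\<Prod>j\<in>{1..n}. \<Prod>j'\<in>{1..n}. if \<phi> j < \<phi> j' \<and> s j < s j' then - (x (Z j') / x (Z j)) else 1)"
    using block_prod[where R = "(<)" and g = "\<lambda>j j'. - (x (Z j') / x (Z j))"]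
    by (simp add: Pfac_def x meval_diff)
  have e: "leval (\<Prod>k\<in>{1..N}. \<Prod>l\<in>{k<..N}. \<Prod>a\<in>{a\<in>{1..n}. \<sigma> a \<in> J k}.
      \<Prod>b\<in>{b\<in>{1..n}. \<sigma> b \<in> J l \<and> a < b}. 1 - lmon 1 (ex (Z (\<sigma> a)) - ex (Z (\<sigma> b)))) x
      = (\<Prod>j\<in>{1..n}. \<Prod>j'\<in>{1..n}. if \<phi> j < \<phi> j' \<and> s j < s j' then 1 - x (Z j) / x (Z j') else 1)"
    using block_prod[where R = "(<)" and g = "\<lambda>j j'. 1 - x (Z j) / x (Z j')"]
    by (simp add: x meval_diff)
  have s: "s j = s j' \<Longrightarrow> j = j'" for j j'
    using permutes_inj[OF permutes_inv[OF \<sigma>]] by (simp add: inj_eq)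
  show ?thesis
    unfolding efac_def leval_mult[OF x] P e leval_evert[OF x] prod.distrib[symmetric]
    using x s by (intro prod.cong refl) (auto simp: field_simps torusD not_less_iff_gr_or_eq)
qed

end

subsection \<open>Smallness\<close>

text \<open>\<open>L\<close> may be 0, so \<open>e\<close> is in general only an upper bound for the
  order of growth. It is the exact order if \<open>L\<close> is nonzero, which is what division
  requires.\<close>

definition asymp_pow :: "(real \<Rightarrow> complex) \<Rightarrow> int \<Rightarrow> complex \<Rightarrow> bool" where
  "asymp_pow f e L \<longleftrightarrow> ((\<lambda>s. f s * of_real s powi (- e)) \<longlongrightarrow> L) at_top"

lemma asymp_const: "asymp_pow (\<lambda>_. c) 0 c"
  by (simp add: asymp_pow_def)

lemma asymp_eventually: "\<forall>\<^sub>F s in at_top. f s = g s \<Longrightarrow> asymp_pow f e L \<Longrightarrow> asymp_pow g e L"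
  unfolding asymp_pow_def by (erule Lim_transform_eventually) (erule eventually_mono, simp)

lemma powi_minus_add:
  "s > (0::real) \<Longrightarrow> (of_real s :: complex) powi (- (a + b)) = of_real s powi (- a) * of_real s powi (- b)"
  by (simp flip: power_int_add)

lemma asymp_mult:
  assumes "asymp_pow f a L" "asymp_pow g b M" shows "asymp_pow (\<lambda>s. f s * g s) (a + b) (L * M)"
proof -
  have "((\<lambda>s. (f s * of_real s powi (- a)) * (g s * of_real s powi (- b))) \<longlongrightarrow> L * M) at_top"
    using assms unfolding asymp_pow_def by (rule tendsto_mult)
  moreover have "\<forall>\<^sub>F s in at_top. (f s * of_real s powi (- a)) * (g s * of_real s powi (- b))
      = f s * g s * of_real s powi (- (a + b))"
    using eventually_gt_at_top[of 0] by eventually_elim (simp only: powi_minus_add mult_ac)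
  ultimately show ?thesis unfolding asymp_pow_def by (rule Lim_transform_eventually)
qed

lemma asymp_inverse:
  assumes "asymp_pow f a L" "L \<noteq> 0" shows "asymp_pow (\<lambda>s. inverse (f s)) (- a) (inverse L)"
proof -
  have "((\<lambda>s. inverse (f s * of_real s powi (- a))) \<longlongrightarrow> inverse L) at_top"
    using assms unfolding asymp_pow_def by (rule tendsto_inverse)
  moreover have "\<forall>\<^sub>F s in at_top. inverse (f s * of_real s powi (- a)) = inverse (f s) * of_real s powi (- (- a))"
    by (simp add: power_int_minus)
  ultimately show ?thesis unfolding asymp_pow_def by (rule Lim_transform_eventually)
qed

lemma asymp_divide:
  assumes "asymp_pow f a L" "asymp_pow g b M" "M \<noteq> 0" shows "asymp_pow (\<lambda>s. f s / g s) (a - b) (L / M)"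
  using asymp_mult[OF assms(1) asymp_inverse[OF assms(2,3)]] by (simp add: divide_inverse)

lemma asymp_prod:
  assumes "\<And>i. i \<in> A \<Longrightarrow> \<exists>L. asymp_pow (f i) (e i) L"
  shows "\<exists>L. asymp_pow (\<lambda>s. \<Prod>i\<in>A. f i s) (\<Sum>i\<in>A. e i) L"
  using assms
proof (induction A rule: infinite_finite_induct)
  case (insert i A)
  then obtain L M where "asymp_pow (f i) (e i) L" "asymp_pow (\<lambda>s. \<Prod>i\<in>A. f i s) (\<Sum>i\<in>A. e i) M" by blast
  from asymp_mult[OF this] show ?case using insert.hyps by auto
qed (auto intro: asymp_const)

lemma asymp_mono:
  assumes "asymp_pow f a L" "a \<le> b" shows "\<exists>M. asymp_pow f b M"
proof (cases "a = b")
  case False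
  then have "asymp_pow (\<lambda>_. 1) (b - a) 0" using assms(2) tendsto_powi_neg[of "- (b - a)"] by (simp add: asymp_pow_def)
  from asymp_mult[OF assms(1) this] show ?thesis by auto
qed (use assms in blast)

lemma asymp_sum:
  assumes "\<And>i. i \<in> A \<Longrightarrow> \<exists>L. asymp_pow (f i) e L"
  shows "\<exists>L. asymp_pow (\<lambda>s. \<Sum>i\<in>A. f i s) e L"
proof -
  obtain L where "\<And>i. i \<in> A \<Longrightarrow> asymp_pow (f i) e (L i)" using assms by metis
  then have "asymp_pow (\<lambda>s. \<Sum>i\<in>A. f i s) e (\<Sum>i\<in>A. L i)"
    unfolding asymp_pow_def sum_distrib_right by (rule tendsto_sum)
  then show ?thesis by blast
qed

lemma asymp_nonzero:
  assumes "asymp_pow f e L" "L \<noteq> 0" shows "\<forall>\<^sub>F s in at_top. f s \<noteq> 0"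
proof -
  have "\<forall>\<^sub>F s in at_top. f s * of_real s powi (- e) \<noteq> 0"
    using assms unfolding asymp_pow_def by (rule tendsto_imp_eventually_ne)
  then show ?thesis by (rule eventually_mono) auto
qed

text \<open>\<open>c \<noteq> 0\<close> keeps the leading coefficient nonzero for positive
  \<open>d\<close>, and \<open>c \<noteq> 1\<close> prevents cancellation for
  \<open>d = 0\<close>.\<close>

lemma asymp_one_minus:
  assumes "c \<noteq> 0" "c \<noteq> 1"
  shows "\<exists>L. L \<noteq> 0 \<and> asymp_pow (\<lambda>s. 1 - c * of_real s powi d) (max d 0) L"
proof -
  consider "d > 0" | "d = 0" | "d < 0" by linarith
  then show ?thesis
  proof cases
    case 1
    have "((\<lambda>s::real. (of_real s :: complex) powi (- d) - c) \<longlongrightarrow> 0 - c) at_top"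
      using 1 by (intro tendsto_diff tendsto_powi_neg tendsto_const) auto
    moreover have "\<forall>\<^sub>F s::real in at_top. of_real s powi (- d) - c = (1 - c * of_real s powi d) * of_real s powi (- max d 0)"
      using eventually_gt_at_top[of 0] by eventually_elim (use 1 in \<open>simp add: algebra_simps flip: power_int_add\<close>)
    ultimately have "asymp_pow (\<lambda>s. 1 - c * of_real s powi d) (max d 0) (0 - c)"
      unfolding asymp_pow_def by (rule Lim_transform_eventually)
    then show ?thesis using assms by (intro exI[of _ "0 - c"]) simp
  next
    case 2
    then show ?thesis using assms asymp_const[of "1 - c"] by (intro exI[of _ "1 - c"]) simp
  next
    case 3
    have "((\<lambda>s::real. 1 - c * (of_real s :: complex) powi d) \<longlongrightarrow> 1 - c * 0) at_top"
      using 3 by (intro tendsto_diff tendsto_mult tendsto_powi_neg tendsto_const) auto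
    then have "asymp_pow (\<lambda>s. 1 - c * of_real s powi d) (max d 0) 1" using 3 by (simp add: asymp_pow_def)
    then show ?thesis by (intro exI[of _ 1]) simp
  qed
qed

text \<open>The growth estimate annihilates a weight component only at individual points. Collecting
  the component in \<open>Q\<close>, density makes its coefficients vanish.\<close>

lemma wdeg_bound:
  assumes "\<And>x. x \<in> gpts \<Longrightarrow> \<exists>L. asymp_pow (\<lambda>s. leval P (\<lambda>v. x v * of_real s powi w v)) d L"
    and "m \<in> ks P"
  shows "wdeg w m \<le> d"
proof (rule ccontr)
  assume gt: "\<not> wdeg w m \<le> d"
  let ?A = "{m'. m' \<in> ks P \<and> wdeg w m' = wdeg w m}"
  define Q where "Q = (\<Sum>m'\<in>?A. sg m' (lk P m'))"
  have "Q = 0"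
  proof (rule lpoly_eq_0I)
    fix x assume "x \<in> gpts"
    then obtain L where "asymp_pow (\<lambda>s. leval P (\<lambda>v. x v * of_real s powi w v)) d L" using assms(1) by blast
    from laurent_growth[OF this[unfolded asymp_pow_def], of "wdeg w m"] gt
    show "leval Q x = 0" by (simp add: Q_def)
  qed
  have fin: "finite ?A" by (rule finite_subset[of _ "ks P"]) auto
  have "lk Q m = (\<Sum>m'\<in>?A. if m' = m then lk P m' else 0)"
    by (simp add: Q_def lookup_sum lookup_single when_def)
  also have "\<dots> = lk P m" using fin assms(2) by simp
  finally show False using \<open>Q = 0\<close> assms(2) by (simp add: in_keys_iff)
qed

context flag_type
begin

text \<open>Both filtrations have the same cardinalities, so one-sided inclusions are equalities,
  and a filtration determines its blocks.\<close>

lemma ordpart_eqI: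
  assumes I: "ordpart N n lam I" and J: "ordpart N n lam J"
    and sub: "\<And>k. k \<in> {1..N} \<Longrightarrow> cup I k \<subseteq> cup J k"
  shows "J = I"
proof -
  have cups: "cup I k = cup J k" if k: "k \<in> {1..N}" for k
    using ordpart_cup[OF J, of k] ordpart_cup[OF I, of k] k by (intro card_subset_eq sub) auto
  have bl: "blk I i = blk J i" if i: "i \<in> {1..n}" for i
  proof -
    have "blk I i \<le> k \<longleftrightarrow> blk J i \<le> k" if k: "k \<in> {1..N}" for k
      using cups[OF k] mem_cup_iff[OF I, of k i] mem_cup_iff[OF J, of k i] k i by auto
    from this[OF blk_in(1)[OF I i]] this[OF blk_in(1)[OF J i]] show ?thesis by auto
  qed
  show "J = I"
  proof
    fix k show "J k = I k"
    proof (cases "k \<in> {1..N}")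
      case True
      have "J k \<subseteq> {1..n}" "I k \<subseteq> {1..n}" using I J True by (auto simp: ordpart_def)
      then have "j \<in> J k \<longleftrightarrow> j \<in> I k" for j
        using bl[of j] mem_block_iff[OF I _ True, of j] mem_block_iff[OF J _ True, of j] by (cases "j \<in> {1..n}") auto
      then show ?thesis by blast
    next
      case False
      then show ?thesis using I J by (auto simp: ordpart_def)
    qed
  qed
qed

end

context flag_pair
begin

section \<open>Order of growth under scaling of the \<open>z\<close>\<close>

definition scale :: "(nat \<Rightarrow> int) \<Rightarrow> (nat \<Rightarrow> complex) \<Rightarrow> real \<Rightarrow> nat \<Rightarrow> complex" where
  "scale w z t j = z j * of_real t powi w j"

definition pdeg :: "(nat \<Rightarrow> int) \<Rightarrow> nat \<Rightarrow> nat \<Rightarrow> int" where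
  "pdeg w j j' = max (w j' - w j) 0"

lemma asymp_hf:
  assumes "gen n z h" "j \<in> {1..n}" "j' \<in> {1..n}"
  shows "\<exists>L. L \<noteq> 0 \<and> asymp_pow (\<lambda>t. hf (scale w z t) h j j') (pdeg w j j') L"
proof -
  have z: "z j \<noteq> 0" "z j' \<noteq> 0" "h \<noteq> 0" "h * z j' \<noteq> z j" using assms unfolding gen_def by blast+
  then have "h * z j' / z j \<noteq> 0" "h * z j' / z j \<noteq> 1" by simp_all
  then obtain L where L: "L \<noteq> 0" "asymp_pow (\<lambda>t. 1 - (h * z j' / z j) * of_real t powi (w j' - w j)) (pdeg w j j') L"
    unfolding pdeg_def using asymp_one_minus[of "h * z j' / z j" "w j' - w j"] by metis
  have "\<forall>\<^sub>F t in at_top. 1 - (h * z j' / z j) * of_real t powi (w j' - w j) = hf (scale w z t) h j j'"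
    using eventually_gt_at_top[of "0::real"]
    by eventually_elim (simp add: scale_def power_int_diff)
  from asymp_eventually[OF this L(2)] show ?thesis using L(1) by blast
qed

lemma asymp_zf:
  assumes "gen n z h" "j \<in> {1..n}" "j' \<in> {1..n}" "j \<noteq> j'"
  shows "\<exists>L. L \<noteq> 0 \<and> asymp_pow (\<lambda>t. zf (scale w z t) j j') (pdeg w j j') L"
proof -
  have z: "z j \<noteq> 0" "z j' \<noteq> 0" "z j' \<noteq> z j"
    using genD(1)[OF assms(1,2,3)] genD(1)[OF assms(1,3,2)] genD(3)[OF assms(1,3,2)] assms(4) by auto
  then have "z j' / z j \<noteq> 0" "z j' / z j \<noteq> 1" by simp_all
  then obtain L where L: "L \<noteq> 0" "asymp_pow (\<lambda>t. 1 - (z j' / z j) * of_real t powi (w j' - w j)) (pdeg w j j') L"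
    unfolding pdeg_def using asymp_one_minus[of "z j' / z j" "w j' - w j"] by metis
  have "\<forall>\<^sub>F t in at_top. 1 - (z j' / z j) * of_real t powi (w j' - w j) = zf (scale w z t) j j'"
    using eventually_gt_at_top[of "0::real"]
    by eventually_elim (simp add: scale_def power_int_diff)
  from asymp_eventually[OF this L(2)] show ?thesis using L(1) by blast
qed

lemma eventually_gen_scale:
  assumes "gen n z h" shows "\<forall>\<^sub>F t in at_top. gen n (scale w z t) h"
proof -
  have "\<forall>\<^sub>F t in at_top. \<forall>a\<in>{1..n}. \<forall>b\<in>{1..n}. hf (scale w z t) h a b \<noteq> 0"
  proof (intro eventually_ball_finite ballI finite_atLeastAtMost)
    fix a b assume ab: "a \<in> {1..n}" "b \<in> {1..n}"
    show "\<forall>\<^sub>F t in at_top. hf (scale w z t) h a b \<noteq> 0"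
      using asymp_hf[OF assms ab, of w] asymp_nonzero by blast
  qed
  moreover have "\<forall>\<^sub>F t in at_top. \<forall>a\<in>{1..n}. \<forall>b\<in>{1..n}. a \<noteq> b \<longrightarrow> zf (scale w z t) a b \<noteq> 0"
  proof (intro eventually_ball_finite ballI finite_atLeastAtMost)
    fix a b assume ab: "a \<in> {1..n}" "b \<in> {1..n}"
    show "\<forall>\<^sub>F t in at_top. a \<noteq> b \<longrightarrow> zf (scale w z t) a b \<noteq> 0"
    proof (cases "a = b")
      case False
      then have "\<forall>\<^sub>F t in at_top. zf (scale w z t) a b \<noteq> 0"
        using asymp_zf[OF assms ab, of w] asymp_nonzero by blast
      then show ?thesis by (rule eventually_mono) blast
    qed simp
  qed
  ultimately show ?thesis using eventually_gt_at_top[of "0::real"]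
  proof eventually_elim
    fix t :: real
    assume *: "\<forall>a\<in>{1..n}. \<forall>b\<in>{1..n}. hf (scale w z t) h a b \<noteq> 0"
      "\<forall>a\<in>{1..n}. \<forall>b\<in>{1..n}. a \<noteq> b \<longrightarrow> zf (scale w z t) a b \<noteq> 0" "0 < t"
    have nz: "scale w z t a \<noteq> 0" if "a \<in> {1..n}" for a
      using genD(1)[OF assms that that] *(3) by (simp add: scale_def)
    show "gen n (scale w z t) h"
      unfolding gen_def
    proof (intro conjI ballI impI)
      show "h \<noteq> 0" using assms by (simp add: gen_def)
      fix a assume a: "a \<in> {1..n}"
      show "scale w z t a \<noteq> 0" by (rule nz[OF a])
      fix b assume b: "b \<in> {1..n}"
      show "h * scale w z t b \<noteq> scale w z t a" using *(1) a b nz[OF a] by (metis div_self right_minus_eq)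
      assume "a \<noteq> b"
      then show "scale w z t a \<noteq> scale w z t b" using *(2) a b nz[OF a] by (metis div_self right_minus_eq)
    qed
  qed
qed

text \<open>The degree of \<open>rfac\<close> in \<open>t\<close> after the scaling \<open>z j \<mapsto> z j t^(w j)\<close>; the weights \<open>w = \<plusminus>\<phi>\<close> bound the
  Newton polytope from both sides.\<close>

definition rdeg :: "(nat \<Rightarrow> int) \<Rightarrow> (nat \<Rightarrow> nat \<Rightarrow> nat) \<Rightarrow> nat \<Rightarrow> nat \<Rightarrow> nat \<Rightarrow> int" where
  "rdeg w \<pi> k j j' =
    (if \<phi> j \<le> k \<and> \<phi> j' \<le> k + 1 \<and> pos \<pi> (k+1) j' \<noteq> pos \<pi> k j then pdeg w j j' else 0)
    - (if \<phi> j \<le> k \<and> \<phi> j' \<le> k then pdeg w j j' else 0)"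

lemma pdeg_same [simp]: "pdeg w j j = 0"
  by (simp add: pdeg_def)

text \<open>\<open>hf\<close> and \<open>zf\<close> grow equally, so the quotient in
  \<open>Y\<close> has degree 0 and drops out of \<open>rdeg\<close>. Coinciding positions
  contribute the factor 1, which is where degree is lost. For \<open>j = j'\<close> the factor
  \<open>zf\<close> vanishes, which is compatible with order 0.\<close>

lemma asymp_rfac:
  assumes "gen n z h" "j \<in> {1..n}" "j' \<in> {1..n}"
  shows "\<exists>L. asymp_pow (\<lambda>t. rfac (pos \<pi>) k j j' (scale w z t) h) (rdeg w \<pi> k j j') L"
proof -
  define X where "X t = (if \<phi> j \<le> k \<and> \<phi> j' \<le> k + 1 then
       (if pos \<pi> (k+1) j' < pos \<pi> k j then hf (scale w z t) h j j'
        else if pos \<pi> (k+1) j' > pos \<pi> k j then zf (scale w z t) j j' else 1) else 1)" for t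
  define Y where "Y t = (if \<phi> j \<le> k \<and> \<phi> j' \<le> k \<and> pos \<pi> k j < pos \<pi> k j'
      then hf (scale w z t) h j j' / zf (scale w z t) j j' else 1)" for t
  define W where "W t = (if \<phi> j \<le> k \<and> \<phi> j' \<le> k \<and> j \<noteq> j' then hf (scale w z t) h j j' else 1)" for t
  obtain Lh where Lh: "Lh \<noteq> 0" "asymp_pow (\<lambda>t. hf (scale w z t) h j j') (pdeg w j j') Lh"
    using asymp_hf[OF assms] by blast
  have zf: "\<exists>L. asymp_pow (\<lambda>t. zf (scale w z t) j j') (pdeg w j j') L"
  proof (cases "j = j'")
    case True
    have "\<forall>\<^sub>F t in at_top. 0 = zf (scale w z t) j j"
      using eventually_gt_at_top[of "0::real"]
      by eventually_elim (simp add: scale_def genD(1)[OF assms(1,2,2)])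
    from asymp_eventually[OF this asymp_const] show ?thesis using True by auto
  next
    case False
    then show ?thesis using asymp_zf[OF assms] by blast
  qed
  have "\<exists>L. asymp_pow X (if \<phi> j \<le> k \<and> \<phi> j' \<le> k + 1 \<and> pos \<pi> (k+1) j' \<noteq> pos \<pi> k j then pdeg w j j' else 0) L"
    unfolding X_def using Lh(2) zf asymp_const[of 1]
    by (cases "\<phi> j \<le> k \<and> \<phi> j' \<le> k + 1"; cases "pos \<pi> (k+1) j'" "pos \<pi> k j" rule: linorder_cases) auto
  then obtain LX where LX: "asymp_pow X (if \<phi> j \<le> k \<and> \<phi> j' \<le> k + 1 \<and> pos \<pi> (k+1) j' \<noteq> pos \<pi> k j then pdeg w j j' else 0) LX"
    by blast
  have "\<exists>L. asymp_pow Y 0 L"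
  proof (cases "\<phi> j \<le> k \<and> \<phi> j' \<le> k \<and> pos \<pi> k j < pos \<pi> k j'")
    case True
    then have "j \<noteq> j'" by auto
    then obtain L where "L \<noteq> 0" "asymp_pow (\<lambda>t. zf (scale w z t) j j') (pdeg w j j') L"
      using asymp_zf[OF assms] by blast
    from asymp_divide[OF Lh(2) this(2,1)] show ?thesis using True by (auto simp: Y_def[abs_def])
  next
    case False
    then have "Y = (\<lambda>_. 1)" by (auto simp: Y_def)
    then show ?thesis using asymp_const by auto
  qed
  then obtain LY where LY: "asymp_pow Y 0 LY" by blast
  have "\<exists>L. L \<noteq> 0 \<and> asymp_pow W (if \<phi> j \<le> k \<and> \<phi> j' \<le> k then pdeg w j j' else 0) L"
  proof (cases "\<phi> j \<le> k \<and> \<phi> j' \<le> k \<and> j \<noteq> j'")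
    case True
    then show ?thesis using Lh by (auto simp: W_def[abs_def])
  next
    case False
    then have "W = (\<lambda>_. 1)" "(if \<phi> j \<le> k \<and> \<phi> j' \<le> k then pdeg w j j' else 0) = 0" by (auto simp: W_def)
    then show ?thesis using asymp_const[of 1] by (auto intro!: exI[of _ 1])
  qed
  then obtain LW where LW: "LW \<noteq> 0" "asymp_pow W (if \<phi> j \<le> k \<and> \<phi> j' \<le> k then pdeg w j j' else 0) LW" by blast
  from asymp_divide[OF asymp_mult[OF LX LY] LW(2,1)]
  show ?thesis by (auto simp: rfac_def tfac_def rdeg_def X_def Y_def W_def)
qed

lemma asymp_wWt:
  assumes "gen n z h"
    and "\<And>\<pi>. \<pi> \<in> symperms N lam \<Longrightarrow> (\<Sum>k\<in>{1..N-1}. \<Sum>j\<in>{1..n}. \<Sum>j'\<in>{1..n}. rdeg w \<pi> k j j') \<le> d"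
  shows "\<exists>L. asymp_pow (\<lambda>t. wWt N lam \<sigma> I J (scale w z t) h) d L"
proof -
  have "\<exists>L. asymp_pow (\<lambda>t. \<Prod>k\<in>{1..N-1}. \<Prod>j\<in>{1..n}. \<Prod>j'\<in>{1..n}. rfac (pos \<pi>) k j j' (scale w z t) h)
      (\<Sum>k\<in>{1..N-1}. \<Sum>j\<in>{1..n}. \<Sum>j'\<in>{1..n}. rdeg w \<pi> k j j') L" for \<pi>
    by (intro asymp_prod asymp_rfac assms(1))
  then have "\<exists>L. asymp_pow (\<lambda>t. \<Prod>k\<in>{1..N-1}. \<Prod>j\<in>{1..n}. \<Prod>j'\<in>{1..n}. rfac (pos \<pi>) k j j' (scale w z t) h) d L"
    if "\<pi> \<in> symperms N lam" for \<pi>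
    using asymp_mono[OF _ assms(2)[OF that]] by metis
  then have "\<exists>L. asymp_pow (\<lambda>t. \<Sum>\<pi>\<in>symperms N lam.
      \<Prod>k\<in>{1..N-1}. \<Prod>j\<in>{1..n}. \<Prod>j'\<in>{1..n}. rfac (pos \<pi>) k j j' (scale w z t) h) d L"
    by (rule asymp_sum)
  then obtain L where L: "asymp_pow (\<lambda>t. \<Sum>\<pi>\<in>symperms N lam.
      \<Prod>k\<in>{1..N-1}. \<Prod>j\<in>{1..n}. \<Prod>j'\<in>{1..n}. rfac (pos \<pi>) k j j' (scale w z t) h) d L" ..
  have ev: "\<forall>\<^sub>F t in at_top. (\<Sum>\<pi>\<in>symperms N lam.
      \<Prod>k\<in>{1..N-1}. \<Prod>j\<in>{1..n}. \<Prod>j'\<in>{1..n}. rfac (pos \<pi>) k j j' (scale w z t) h) = wWt N lam \<sigma> I J (scale w z t) h"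
    using eventually_gen_scale[OF assms(1), of w] by (rule eventually_mono) (simp only: wWt_eq)
  show ?thesis using asymp_eventually[OF ev L] ..
qed

text \<open>For pairs already present at level \<open>k\<close> the numerator and \<open>E\<close>
  cancel. There remain the pairs in which \<open>j'\<close> enters at level \<open>k + 1\<close>,
  minus the losses at coinciding positions.\<close>

lemma rdeg_eq:
  "rdeg w \<pi> k j j' = (if \<phi> j \<le> k \<and> \<phi> j' = k + 1 then pdeg w j j' else 0)
    - (if \<phi> j \<le> k \<and> \<phi> j' \<le> k + 1 \<and> pos \<pi> (k+1) j' = pos \<pi> k j then pdeg w j j' else 0)"
  unfolding rdeg_def by (cases "\<phi> j \<le> k"; cases "\<phi> j' \<le> k"; cases "\<phi> j' = k + 1") auto

text \<open>With reversed weights an entering \<open>j'\<close> has the smaller weight, so its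
  factor contributes no degree. This yields the lower end 0 of the interval.\<close>

lemma rdeg_neg: "(\<Sum>k\<in>{1..N-1}. \<Sum>j\<in>{1..n}. \<Sum>j'\<in>{1..n}. rdeg (\<lambda>j. - int (\<phi> j)) \<pi> k j j') \<le> 0"
  by (intro sum_nonpos) (auto simp: rdeg_eq pdeg_def)

text \<open>The premise says that no degree is lost. Following a fixed position upwards, the block
  number of its occupant then never increases, and at level \<open>N\<close> the occupant is
  \<open>\<sigma>\<close> of the position. Hence \<open>cup I k\<close> lies in
  \<open>cup J k\<close>.\<close>

lemma same_parts:
  assumes \<pi>: "\<pi> \<in> symperms N lam"
    and step: "\<And>k j j'. k \<in> {1..N-1} \<Longrightarrow> j \<in> {1..n} \<Longrightarrow> j' \<in> {1..n} \<Longrightarrow> \<phi> j \<le> k \<Longrightarrow> \<phi> j' \<le> k + 1 \<Longrightarrow>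
      pos \<pi> (k+1) j' = pos \<pi> k j \<Longrightarrow> \<phi> j' \<le> \<phi> j"
  shows "J = I"
proof -
  have chain: "\<phi> (\<sigma> (pos \<pi> k j)) \<le> \<phi> j" if "k \<le> N" "1 \<le> k" "j \<in> cup J k" for k j
    using that
  proof (induction k arbitrary: j rule: inc_induct)
    case base
    then show ?case using pos_N[OF \<pi>, of j] cup_N[OF J] permutes_inverses(1)[OF \<sigma>] by simp
  next
    case (step k)
    have k: "k \<in> {1..N-1}" "k \<in> {1..N}" "k + 1 \<in> {1..N}" "k \<le> N" "k + 1 \<le> N" using step by auto
    have j: "j \<in> {1..n}" "\<phi> j \<le> k" using step mem_cup_iff[OF J k(4)] by auto
    have "pos \<pi> k j \<in> cup I' k" using bij_betw_apply[OF pos_bij[OF \<pi> k(2)]] step by blast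
    then have "pos \<pi> k j \<in> cup I' (k + 1)" by (auto simp: cup_def)
    then obtain j' where j': "j' \<in> cup J (k + 1)" "pos \<pi> (k + 1) j' = pos \<pi> k j"
      using pos_bij[OF \<pi> k(3)] by (metis bij_betw_def imageE)
    have j'2: "j' \<in> {1..n}" "\<phi> j' \<le> k + 1" using j'(1) mem_cup_iff[OF J k(5)] by auto
    have "\<phi> (\<sigma> (pos \<pi> (k + 1) j')) \<le> \<phi> j'" using step.IH[of j'] j'(1) by simp
    also have "\<phi> j' \<le> \<phi> j" by (rule assms(2)[OF k(1) j(1) j'2(1) j(2) j'2(2) j'(2)])
    finally show ?case unfolding j'(2) .
  qed
  have cups: "cup I k \<subseteq> cup J k" if k: "k \<in> {1..N}" for k
  proof -
    have kN: "k \<le> N" using k by simp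
    show ?thesis
    proof
      fix i assume i: "i \<in> cup I k"
      then have "s i \<in> cup I' k" by (simp add: cup_image)
      then obtain j where j: "j \<in> cup J k" "pos \<pi> k j = s i"
        using pos_bij[OF \<pi> k] by (metis bij_betw_def imageE)
      have "\<phi> i \<le> \<phi> j" using chain[OF kN _ j(1)] k j(2) permutes_inverses(1)[OF \<sigma>] by simp
      moreover have "\<phi> j \<le> k" using j(1) mem_cup_iff[OF J kN] by blast
      moreover have "i \<in> {1..n}" using i ordpart_cup(1)[OF I kN] by blast
      ultimately show "i \<in> cup J k" using mem_cup_iff[OF J kN] by auto
    qed
  qed
  show ?thesis by (rule ordpart_eqI[OF I J]) (simp add: cups)
qed

section \<open>Counting degrees over blocks\<close>

lemma sum_blocks:
  fixes f :: "nat \<Rightarrow> int"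
  shows "(\<Sum>j\<in>{1..n}. f (\<phi> j)) = (\<Sum>k\<in>{1..N}. int (lam k) * f k)"
proof -
  have "(\<Sum>j\<in>{1..n}. f (\<phi> j)) = (\<Sum>k\<in>{1..N}. \<Sum>j\<in>{j\<in>{1..n}. \<phi> j = k}. f (\<phi> j))"
    using blk_in(1)[OF J] by (intro sum.group[symmetric]) auto
  also have "\<dots> = (\<Sum>k\<in>{1..N}. int (lam k) * f k)"
  proof (intro sum.cong refl)
    fix k assume k: "k \<in> {1..N}"
    have Jk: "J k \<subseteq> {1..n}" "card (J k) = lam k" using J k by (auto simp: ordpart_def)
    then have "{j\<in>{1..n}. \<phi> j = k} = J k" using mem_block_iff[OF J _ k] by blast
    then show "(\<Sum>j\<in>{j\<in>{1..n}. \<phi> j = k}. f (\<phi> j)) = int (lam k) * f k"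
      using Jk(2) by (subst sum.cong[OF refl, where h = "\<lambda>_. f k"]) auto
  qed
  finally show ?thesis .
qed

text \<open>A pair with \<open>\<phi> j < \<phi> j'\<close> contributes at the single level
  \<open>\<phi> j' - 1\<close>, by the difference of the block numbers; there are
  \<open>lam k * lam l\<close> such pairs for blocks \<open>k\<close> and \<open>l\<close>.\<close>

lemma sum_pdeg_Dbound:
  "(\<Sum>k\<in>{1..N-1}. \<Sum>j\<in>{1..n}. \<Sum>j'\<in>{1..n}. if \<phi> j \<le> k \<and> \<phi> j' = k + 1 then pdeg (\<lambda>j. int (\<phi> j)) j j' else 0)
    = int (Dbound N lam)"
proof -
  define f where "f k l = (if k < l then int l - int k else 0)" for k l :: nat
  have "(\<Sum>k\<in>{1..N-1}. \<Sum>j\<in>{1..n}. \<Sum>j'\<in>{1..n}. if \<phi> j \<le> k \<and> \<phi> j' = k + 1 then pdeg (\<lambda>j. int (\<phi> j)) j j' else 0)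
    = (\<Sum>j\<in>{1..n}. \<Sum>j'\<in>{1..n}. \<Sum>k\<in>{1..N-1}. if \<phi> j \<le> k \<and> \<phi> j' = k + 1 then pdeg (\<lambda>j. int (\<phi> j)) j j' else 0)"
    by (subst sum.swap) (intro sum.cong refl sum.swap)
  also have "\<dots> = (\<Sum>j\<in>{1..n}. \<Sum>j'\<in>{1..n}. f (\<phi> j) (\<phi> j'))"
  proof (intro sum.cong refl)
    fix j j' assume j: "j \<in> {1..n}" "j' \<in> {1..n}"
    have b: "\<phi> j \<ge> 1" "\<phi> j' \<ge> 1" "\<phi> j' \<le> N" using blk_in(1)[OF J] j by auto
    have "(\<Sum>k\<in>{1..N-1}. if \<phi> j \<le> k \<and> \<phi> j' = k + 1 then pdeg (\<lambda>j. int (\<phi> j)) j j' else 0)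
       = (\<Sum>k\<in>{1..N-1}. if k = \<phi> j' - 1 then f (\<phi> j) (\<phi> j') else 0)"
      using b by (intro sum.cong refl) (auto simp: f_def pdeg_def)
    also have "\<dots> = f (\<phi> j) (\<phi> j')" using b by (auto simp: sum.delta f_def)
    finally show "(\<Sum>k\<in>{1..N-1}. if \<phi> j \<le> k \<and> \<phi> j' = k + 1 then pdeg (\<lambda>j. int (\<phi> j)) j j' else 0) = f (\<phi> j) (\<phi> j')" .
  qed
  also have "\<dots> = (\<Sum>k\<in>{1..N}. int (lam k) * (\<Sum>l\<in>{1..N}. int (lam l) * f k l))"
    by (simp only: sum_blocks[of "\<lambda>l. f _ l"] sum_blocks[of "\<lambda>k. \<Sum>l\<in>{1..N}. int (lam l) * f k l"])
  also have "\<dots> = (\<Sum>k\<in>{1..N}. \<Sum>l\<in>{1..N}. if l \<in> {k<..N} then int (lam k * lam l * (l - k)) else 0)"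
    unfolding sum_distrib_left by (intro sum.cong refl) (auto simp: f_def)
  also have "\<dots> = (\<Sum>k\<in>{1..N}. \<Sum>l\<in>{k<..N}. int (lam k * lam l * (l - k)))"
  proof (rule sum.cong[OF refl])
    fix k
    have "{l\<in>{1..N}. l \<in> {k<..N}} = {k<..N}" by auto
    then show "(\<Sum>l\<in>{1..N}. if l \<in> {k<..N} then int (lam k * lam l * (l - k)) else 0)
      = (\<Sum>l\<in>{k<..N}. int (lam k * lam l * (l - k)))"
      by (simp only: sum.inter_filter[symmetric] finite_atLeastAtMost)
  qed
  also have "\<dots> = int (Dbound N lam)" by (simp add: Dbound_def)
  finally show ?thesis .
qed

text \<open>For \<open>J \<noteq> I\<close> some coincidence of positions loses degree by
  \<open>same_parts\<close>, and by integrality at least 1. This is the 1 subtracted from the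
  bound.\<close>

lemma rdeg_pos:
  assumes "J \<noteq> I" "\<pi> \<in> symperms N lam"
  shows "(\<Sum>k\<in>{1..N-1}. \<Sum>j\<in>{1..n}. \<Sum>j'\<in>{1..n}. rdeg (\<lambda>j. int (\<phi> j)) \<pi> k j j') \<le> int (Dbound N lam) - 1"
proof -
  define g where "g k j j' = (if \<phi> j \<le> k \<and> \<phi> j' \<le> k + 1 \<and> pos \<pi> (k+1) j' = pos \<pi> k j
      then pdeg (\<lambda>j. int (\<phi> j)) j j' else 0)" for k j j'
  have nn: "g k j j' \<ge> 0" for k j j' by (simp add: g_def pdeg_def)
  obtain k j j' where k: "k \<in> {1..N-1}" "j \<in> {1..n}" "j' \<in> {1..n}" and gt: "g k j j' \<ge> 1"
  proof (rule ccontr)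
    assume neg: "\<not> thesis"
    have "J = I"
    proof (rule same_parts[OF assms(2)])
      fix k j j' assume a: "k \<in> {1..N-1}" "j \<in> {1..n}" "j' \<in> {1..n}" "\<phi> j \<le> k" "\<phi> j' \<le> k + 1"
        "pos \<pi> (k+1) j' = pos \<pi> k j"
      have "\<not> g k j j' \<ge> 1" using neg that a(1-3) by blast
      then show "\<phi> j' \<le> \<phi> j" using a by (auto simp: g_def pdeg_def)
    qed
    then show False using assms(1) by simp
  qed
  have "1 \<le> g k j j'" by (fact gt)
  also have "\<dots> \<le> (\<Sum>j'\<in>{1..n}. g k j j')" using k nn by (intro member_le_sum) auto
  also have "\<dots> \<le> (\<Sum>j\<in>{1..n}. \<Sum>j'\<in>{1..n}. g k j j')"
    using k nn by (intro member_le_sum[of j _ "\<lambda>j. \<Sum>j'\<in>{1..n}. g k j j'"]) (auto intro: sum_nonneg)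
  also have "\<dots> \<le> (\<Sum>k\<in>{1..N-1}. \<Sum>j\<in>{1..n}. \<Sum>j'\<in>{1..n}. g k j j')"
    using k nn by (intro member_le_sum[of k _ "\<lambda>k. \<Sum>j\<in>{1..n}. \<Sum>j'\<in>{1..n}. g k j j'"]) (auto intro!: sum_nonneg)
  finally have "1 \<le> (\<Sum>k\<in>{1..N-1}. \<Sum>j\<in>{1..n}. \<Sum>j'\<in>{1..n}. g k j j')" .
  moreover have "(\<Sum>k\<in>{1..N-1}. \<Sum>j\<in>{1..n}. \<Sum>j'\<in>{1..n}. rdeg (\<lambda>j. int (\<phi> j)) \<pi> k j j')
     = int (Dbound N lam) - (\<Sum>k\<in>{1..N-1}. \<Sum>j\<in>{1..n}. \<Sum>j'\<in>{1..n}. g k j j')"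
    unfolding rdeg_eq sum_subtractf sum_pdeg_Dbound g_def ..
  ultimately show ?thesis by simp
qed

text \<open>The functional \<phi>_J as a weight, with \<open>c = 1\<close> for the upper and
  \<open>c = - 1\<close> for the lower bound. Outside \<open>{1..n}\<close> it is set to 0, as
  \<open>blk\<close> has no meaning there.\<close>

definition wJ :: "int \<Rightarrow> var \<Rightarrow> int" where
  "wJ c v = (case v of Z a \<Rightarrow> if a \<in> {1..n} then c * int (\<phi> a) else 0 | _ \<Rightarrow> 0)"

lemma wdeg_wJ:
  "real_of_int (wdeg (wJ c) m) = real_of_int c * (\<Sum>k\<in>{1..N}. \<Sum>a\<in>J k. real k * real_of_int (lk m (Z a)))"
proof -
  have "wdeg (wJ c) m = (\<Sum>v\<in>ks m \<union> Z ` {1..n}. wJ c v * lk m v)"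
    unfolding wdeg_def by (rule sum.mono_neutral_left) (auto simp: in_keys_iff)
  also have "\<dots> = (\<Sum>v\<in>Z ` {1..n}. wJ c v * lk m v)"
    by (rule sum.mono_neutral_right) (auto simp: wJ_def image_iff split: var.splits)
  also have "\<dots> = (\<Sum>a\<in>{1..n}. c * int (\<phi> a) * lk m (Z a))"
    by (subst sum.reindex) (auto simp: inj_on_def wJ_def intro!: sum.cong)
  also have "\<dots> = (\<Sum>k\<in>{1..N}. \<Sum>a\<in>{a\<in>{1..n}. \<phi> a = k}. c * int (\<phi> a) * lk m (Z a))"
    using blk_in(1)[OF J] by (intro sum.group[symmetric]) auto
  also have "\<dots> = (\<Sum>k\<in>{1..N}. \<Sum>a\<in>J k. c * int k * lk m (Z a))"
  proof (rule sum.cong[OF refl])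
    fix k assume k: "k \<in> {1..N}"
    have "J k \<subseteq> {1..n}" using J k by (auto simp: ordpart_def)
    then have "{a\<in>{1..n}. \<phi> a = k} = J k" using mem_block_iff[OF J _ k] by blast
    then show "(\<Sum>a\<in>{a\<in>{1..n}. \<phi> a = k}. c * int (\<phi> a) * lk m (Z a)) = (\<Sum>a\<in>J k. c * int k * lk m (Z a))"
      by (intro sum.cong) auto
  qed
  finally show ?thesis by (simp add: sum_distrib_left mult.assoc)
qed

text \<open>A linear functional on a convex hull is bounded by its values at the exponents, which
  are the weights of the monomials. The last premise is a congruence: outside \<open>{1..n}\<close>
  the scaled point and \<open>scale\<close> may differ.\<close>

lemma Jsmall_if_represents:
  assumes "J \<noteq> I" "\<And>x. x \<in> gens \<Longrightarrow> leval P x = wWt N lam \<sigma> I J (\<lambda>a. x (Z a)) (x H)"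
    and "\<And>z z' h. (\<And>a. a \<in> {1..n} \<Longrightarrow> z a = z' a) \<Longrightarrow> wWt N lam \<sigma> I J z h = wWt N lam \<sigma> I J z' h"
  shows "Jsmall N lam J P"
proof -
  have bound: "wdeg (wJ c) m \<le> d" if m: "m \<in> ks P"
    and d: "\<And>\<pi>. \<pi> \<in> symperms N lam \<Longrightarrow> (\<Sum>k\<in>{1..N-1}. \<Sum>j\<in>{1..n}. \<Sum>j'\<in>{1..n}. rdeg (\<lambda>j. c * int (\<phi> j)) \<pi> k j j') \<le> d"
    for c d m
  proof (rule wdeg_bound[OF _ m])
    fix x assume x: "x \<in> gpts"
    have gen: "gen n (\<lambda>a. x (Z a)) (x H)" using x gpts_gens by (auto simp: gens_def)
    let ?y = "\<lambda>t v. x v * complex_of_real t powi wJ c v"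
    let ?w = "\<lambda>j. c * int (\<phi> j)"
    obtain L where L: "asymp_pow (\<lambda>t. wWt N lam \<sigma> I J (scale ?w (\<lambda>a. x (Z a)) t) (x H)) d L"
      using asymp_wWt[OF gen d] by blast
    have "\<forall>\<^sub>F t in at_top. wWt N lam \<sigma> I J (scale ?w (\<lambda>a. x (Z a)) t) (x H) = leval P (?y t)"
      using eventually_gen_scale[OF gen, of ?w] eventually_gt_at_top[of "0::real"]
    proof eventually_elim
      fix t :: real assume t: "gen n (scale ?w (\<lambda>a. x (Z a)) t) (x H)" "0 < t"
      have sc: "scale ?w (\<lambda>a. x (Z a)) t a = ?y t (Z a)" if "a \<in> {1..n}" for a
        using that by (simp add: scale_def wJ_def)
      have H: "?y t H = x H" by (simp add: wJ_def)
      have "?y t \<in> torus" using x t(2) by (auto simp: torus_def gpts_def)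
      moreover have "gen n (\<lambda>a. ?y t (Z a)) (?y t H)"
        using t(1) unfolding gen_def H by (simp add: sc)
      ultimately have "?y t \<in> gens" by (simp add: gens_def)
      then have "leval P (?y t) = wWt N lam \<sigma> I J (\<lambda>a. ?y t (Z a)) (x H)"
        using assms(2)[of "?y t"] unfolding H by blast
      also have "\<dots> = wWt N lam \<sigma> I J (scale ?w (\<lambda>a. x (Z a)) t) (x H)"
        by (rule assms(3)) (simp only: sc)
      finally show "wWt N lam \<sigma> I J (scale ?w (\<lambda>a. x (Z a)) t) (x H) = leval P (?y t)" by simp
    qed
    from asymp_eventually[OF this L] show "\<exists>L. asymp_pow (\<lambda>t. leval P (?y t)) d L" by blast
  qed
  define D where "D m = (\<Sum>k\<in>{1..N}. \<Sum>a\<in>J k. real k * real_of_int (lk m (Z a)))" for m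
  have up: "D m \<le> real (Dbound N lam) - 1" if "m \<in> ks P" for m
  proof -
    have "wdeg (wJ 1) m \<le> int (Dbound N lam) - 1"
      by (rule bound[OF that]) (use rdeg_pos[OF assms(1)] in simp)
    then have "real_of_int (wdeg (wJ 1) m) \<le> real_of_int (int (Dbound N lam) - 1)" by (simp only: of_int_le_iff)
    then show ?thesis unfolding wdeg_wJ by (simp add: D_def)
  qed
  have lo: "0 \<le> D m" if "m \<in> ks P" for m
  proof -
    have "wdeg (wJ (- 1)) m \<le> 0"
      by (rule bound[OF that]) (use rdeg_neg in simp)
    then have "real_of_int (wdeg (wJ (- 1)) m) \<le> 0" by simp
    then show ?thesis unfolding wdeg_wJ by (simp add: D_def)
  qed
  show ?thesis unfolding Jsmall_def
  proof (rule image_subsetI)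
    fix y assume "y \<in> newton P"
    then obtain c where c: "\<forall>m\<in>ks P. 0 \<le> c m" "(\<Sum>m\<in>ks P. c m) = 1"
      "y = (\<lambda>a. \<Sum>m\<in>ks P. c m * real_of_int (lk m (Z a)))" unfolding newton_def by blast
    have "phiJ N J y = (\<Sum>k\<in>{1..N}. \<Sum>a\<in>J k. \<Sum>m\<in>ks P. c m * (real k * real_of_int (lk m (Z a))))"
      by (simp add: phiJ_def c(3) sum_distrib_left mult.left_commute)
    also have "\<dots> = (\<Sum>k\<in>{1..N}. \<Sum>m\<in>ks P. \<Sum>a\<in>J k. c m * (real k * real_of_int (lk m (Z a))))"
      by (intro sum.cong refl sum.swap)
    also have "\<dots> = (\<Sum>m\<in>ks P. c m * D m)"
      by (subst sum.swap) (simp add: D_def sum_distrib_left)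
    finally have y: "phiJ N J y = (\<Sum>m\<in>ks P. c m * D m)" .
    have "(\<Sum>m\<in>ks P. c m * D m) \<le> (\<Sum>m\<in>ks P. c m * (real (Dbound N lam) - 1))"
      using c(1) up by (intro sum_mono mult_left_mono) auto
    also have "\<dots> = real (Dbound N lam) - 1" using c(2) by (simp flip: sum_distrib_right)
    finally have "phiJ N J y \<le> real (Dbound N lam) - 1" by (simp add: y)
    moreover have "0 \<le> phiJ N J y" unfolding y using c(1) lo by (intro sum_nonneg mult_nonneg_nonneg) auto
    ultimately show "phiJ N J y \<in> {0..real (Dbound N lam) - 1}" by simp
  qed
qed

end

section \<open>Interpolation\<close>

subsection \<open>Vandermonde products\<close>

definition ltpairs :: "nat \<Rightarrow> (nat \<times> nat) set" where
  "ltpairs m = Sigma {1..m} (\<lambda>a. {a+1..m})"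

lemma finite_ltpairs: "finite (ltpairs m)"
  by (simp add: ltpairs_def)

lemma mem_ltpairs: "(a, b) \<in> ltpairs m \<longleftrightarrow> a \<in> {1..m} \<and> b \<in> {1..m} \<and> a < b"
  by (auto simp: ltpairs_def)

definition opair :: "nat \<times> nat \<Rightarrow> nat \<times> nat" where
  "opair p = (min (fst p) (snd p), max (fst p) (snd p))"

lemma inj_on_opair:
  assumes "\<forall>(a, b)\<in>Q. a \<noteq> b \<and> (b, a) \<notin> Q" shows "inj_on opair Q"
proof (rule inj_onI, clarify)
  fix a b c d assume *: "(a, b) \<in> Q" "(c, d) \<in> Q" "opair (a, b) = opair (c, d)"
  then have "(a, b) = (c, d) \<or> (a, b) = (d, c)" by (auto simp: opair_def min_def max_def split: if_splits)
  then show "a = c \<and> b = d" using * assms by auto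
qed

text \<open>The constant is a product of signs, one for each decreasing pair. Its independence of
  \<open>t\<close> lets it pass through \<open>laur\<close>.\<close>

lemma orient_differences:
  assumes "finite Q" "\<forall>(a, b)\<in>Q. a \<noteq> b \<and> (b, a) \<notin> Q"
  shows "\<exists>c. c \<noteq> 0 \<and> (\<forall>t :: nat \<Rightarrow> complex.
    (\<Prod>(a, b)\<in>Q. t a - t b) = c * (\<Prod>(a, b)\<in>opair ` Q. t a - t b))"
proof (intro exI conjI allI)
  let ?c = "\<Prod>(a, b)\<in>Q. if a < b then 1 else (- 1 :: complex)"
  show "?c \<noteq> 0" using assms(1) by (auto split: if_splits)
  fix t :: "nat \<Rightarrow> complex"
  have "(\<Prod>(a, b)\<in>opair ` Q. t a - t b) = (\<Prod>p\<in>Q. case opair p of (a, b) \<Rightarrow> t a - t b)"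
    by (simp add: prod.reindex[OF inj_on_opair[OF assms(2)]])
  then have "?c * (\<Prod>(a, b)\<in>opair ` Q. t a - t b)
      = (\<Prod>p\<in>Q. (case p of (a, b) \<Rightarrow> if a < b then 1 else - 1) * (case opair p of (a, b) \<Rightarrow> t a - t b))"
    by (simp add: prod.distrib)
  also have "\<dots> = (\<Prod>(a, b)\<in>Q. t a - t b)"
    by (intro prod.cong refl) (auto simp: opair_def min_def max_def split: prod.split)
  finally show "(\<Prod>(a, b)\<in>Q. t a - t b) = ?c * (\<Prod>(a, b)\<in>opair ` Q. t a - t b)" by simp
qed

lemma vandermonde_permute:
  assumes "\<pi> permutes {1..m}"
  shows "\<exists>c. c \<noteq> 0 \<and> (\<forall>t :: nat \<Rightarrow> complex.
    (\<Prod>(a, b)\<in>ltpairs m. t (\<pi> a) - t (\<pi> b)) = c * (\<Prod>(a, b)\<in>ltpairs m. t a - t b))"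
proof -
  define Q where "Q = (\<lambda>(a, b). (\<pi> a, \<pi> b)) ` ltpairs m"
  have inj: "inj \<pi>" using assms by (rule permutes_inj)
  then have injp: "inj_on (\<lambda>(a, b). (\<pi> a, \<pi> b)) (ltpairs m)" by (auto simp: inj_on_def inj_def)
  have Q: "\<forall>(a, b)\<in>Q. a \<noteq> b \<and> (b, a) \<notin> Q"
    using inj by (auto simp: Q_def mem_ltpairs inj_eq image_iff)
  have in_range: "\<pi> a \<in> {1..m}" if "a \<in> {1..m}" for a using permutes_in_image[OF assms] that by blast
  have "opair ` Q \<subseteq> ltpairs m"
  proof (rule image_subsetI)
    fix p assume "p \<in> Q"
    moreover obtain a b where p: "p = (a, b)" by (cases p)
    ultimately have "(a, b) \<in> Q" by simp
    then obtain a' b' where ab: "(a', b') \<in> ltpairs m" "a = \<pi> a'" "b = \<pi> b'" by (auto simp: Q_def)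
    then have "a \<in> {1..m}" "b \<in> {1..m}" "a \<noteq> b"
      using in_range inj by (auto simp: mem_ltpairs inj_eq)
    then show "opair p \<in> ltpairs m" unfolding p by (auto simp: opair_def mem_ltpairs min_def max_def)
  qed
  moreover have "card (opair ` Q) = card (ltpairs m)"
    using card_image[OF inj_on_opair[OF Q]] card_image[OF injp] by (simp add: Q_def)
  ultimately have eq: "opair ` Q = ltpairs m" by (intro card_subset_eq finite_ltpairs)
  have "finite Q" by (simp add: Q_def finite_ltpairs)
  from orient_differences[OF this Q] obtain c where c: "c \<noteq> 0"
    "\<And>t :: nat \<Rightarrow> complex. (\<Prod>(a, b)\<in>Q. t a - t b) = c * (\<Prod>(a, b)\<in>ltpairs m. t a - t b)"
    unfolding eq by blast
  have "(\<Prod>(a, b)\<in>ltpairs m. t (\<pi> a) - t (\<pi> b)) = (\<Prod>(a, b)\<in>Q. t a - t b)" for t :: "nat \<Rightarrow> complex"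
    unfolding Q_def prod.reindex[OF injp] by (simp add: case_prod_beta)
  then show ?thesis using c by auto
qed

subsection \<open>The weight function is a symmetric Laurent polynomial\<close>

context flag_type
begin

lemma wU_cong:
  assumes "\<And>k a. k \<in> {1..N} \<Longrightarrow> a \<in> {1..lamc lam k} \<Longrightarrow> T k a = T' k a"
  shows "wU N lam L T h = wU N lam L T' h"
  unfolding wU_def
proof (intro prod.cong refl arg_cong2[of _ _ _ _ "(*)"])
  fix k a c assume "k \<in> {1..N-1}" "a \<in> {1..lamc lam k}" "c \<in> {1..lamc lam (k+1)}"
  then have "T k a = T' k a" "T (k+1) c = T' (k+1) c" by (intro assms; auto)+
  then show "(if elt (cup L (k+1)) c < elt (cup L k) a then 1 - h * T (k+1) c / T k a
           else if elt (cup L (k+1)) c > elt (cup L k) a then 1 - T (k+1) c / T k a else 1)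
    = (if elt (cup L (k+1)) c < elt (cup L k) a then 1 - h * T' (k+1) c / T' k a
           else if elt (cup L (k+1)) c > elt (cup L k) a then 1 - T' (k+1) c / T' k a else 1)"
    by (simp only:)
next
  fix k a b assume "k \<in> {1..N-1}" "a \<in> {1..lamc lam k}" "b \<in> {a+1..lamc lam k}"
  then have "T k a = T' k a" "T k b = T' k b" by (intro assms; auto)+
  then show "(1 - h * T k b / T k a) / (1 - T k b / T k a) = (1 - h * T' k b / T' k a) / (1 - T' k b / T' k a)"
    by (simp only:)
qed

lemma wW_cong:
  assumes "\<And>k a. k \<in> {1..N-1} \<Longrightarrow> a \<in> {1..lamc lam k} \<Longrightarrow> t k a = t' k a"
    and "\<And>a. a \<in> {1..n} \<Longrightarrow> z a = z' a"
  shows "wW N lam L t z h = wW N lam L t' z' h"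
proof -
  have "tfull N t z k (\<pi> k a) = tfull N t' z' k (\<pi> k a)"
    if \<pi>: "\<pi> \<in> symperms N lam" and k: "k \<in> {1..N}" and a: "a \<in> {1..lamc lam k}" for \<pi> k a
  proof (cases "k = N")
    case True
    then have "\<pi> k = id" using symperms_id[OF \<pi>, of N] N_pos by auto
    then show ?thesis using True a assms(2) lamc_N by (simp add: tfull_def)
  next
    case False
    then have k': "k \<in> {1..N-1}" using k by auto
    have "\<pi> k a \<in> {1..lamc lam k}" using permutes_in_image[OF symperms_permutes[OF \<pi> k']] a by blast
    then show ?thesis using assms(1)[OF k'] False by (simp add: tfull_def)
  qed
  then have "wU N lam L (\<lambda>k a. tfull N t z k (\<pi> k a)) h = wU N lam L (\<lambda>k a. tfull N t' z' k (\<pi> k a)) h"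
    if "\<pi> \<in> symperms N lam" for \<pi>
    using that by (intro wU_cong)
  then show ?thesis unfolding wW_def by (intro arg_cong2[of _ _ _ _ "(*)"] sum.cong refl)
qed

lemma wW_symmetric:
  assumes "\<rho> \<in> symperms N lam"
  shows "wW N lam L (\<lambda>k a. t k (\<rho> k a)) z h = wW N lam L t z h"
proof -
  have "\<rho> N = id" using symperms_id[OF assms, of N] N_pos by auto
  then have eq: "(\<lambda>k a. tfull N (\<lambda>k a. t k (\<rho> k a)) z k (\<pi> k a)) = (\<lambda>k a. tfull N t z k ((\<rho> k \<circ> \<pi> k) a))" for \<pi>
    by (intro ext) (simp add: tfull_def)
  have "(\<Sum>\<pi>\<in>symperms N lam. wU N lam L (\<lambda>k a. tfull N (\<lambda>k a. t k (\<rho> k a)) z k (\<pi> k a)) h)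
    = (\<Sum>\<pi>\<in>symperms N lam. wU N lam L (\<lambda>k a. tfull N t z k ((\<rho> k \<circ> \<pi> k) a)) h)"
    by (rule sum.cong[OF refl], rule arg_cong[of _ _ "\<lambda>T. wU N lam L T h"], rule eq)
  also have "\<dots> = (\<Sum>\<pi>\<in>symperms N lam. wU N lam L (\<lambda>k a. tfull N t z k (\<pi> k a)) h)"
    using assms unfolding symperms_def
    by (intro sum.reindex_bij_betw[OF perm_families_compose, where g = "\<lambda>\<pi>. wU N lam L (\<lambda>k a. tfull N t z k (\<pi> k a)) h"]) blast
  finally show ?thesis by (simp add: wW_def)
qed

lemma wE_symmetric:
  assumes "\<rho> \<in> symperms N lam"
  shows "wE N lam (\<lambda>k a. t k (\<rho> k a)) h = wE N lam t h"
  unfolding wE_def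
proof (rule prod.cong[OF refl])
  fix k assume "k \<in> {1..N-1}"
  then have \<rho>: "\<rho> k permutes {1..lamc lam k}" by (rule symperms_permutes[OF assms])
  have "(\<Prod>a\<in>{1..lamc lam k}. \<Prod>b\<in>{1..lamc lam k}. 1 - h * t k (\<rho> k b) / t k (\<rho> k a))
     = (\<Prod>a\<in>{1..lamc lam k}. \<Prod>b\<in>{1..lamc lam k}. 1 - h * t k b / t k (\<rho> k a))"
    using prod.permute[OF \<rho>, of "\<lambda>b. 1 - h * t k b / t k (\<rho> k a)" for a] by (simp add: o_def)
  also have "\<dots> = (\<Prod>a\<in>{1..lamc lam k}. \<Prod>b\<in>{1..lamc lam k}. 1 - h * t k b / t k a)"
    using prod.permute[OF \<rho>, of "\<lambda>a. \<Prod>b\<in>{1..lamc lam k}. 1 - h * t k b / t k a"] by (simp add: o_def)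
  finally show "(\<Prod>a\<in>{1..lamc lam k}. \<Prod>b\<in>{1..lamc lam k}. 1 - h * t k (\<rho> k b) / t k (\<rho> k a))
     = (\<Prod>a\<in>{1..lamc lam k}. \<Prod>b\<in>{1..lamc lam k}. 1 - h * t k b / t k a)" .
qed

lemma wE_cong:
  assumes "\<And>k a. k \<in> {1..N-1} \<Longrightarrow> a \<in> {1..lamc lam k} \<Longrightarrow> t k a = t' k a"
  shows "wE N lam t h = wE N lam t' h"
  unfolding wE_def by (intro prod.cong refl) (simp only: assms)

text \<open>Here \<open>Gam k a\<close> stands for the variable \<open>t\<close> of level
  \<open>k\<close>, with \<open>a\<close> running up to \<open>lamc lam k\<close>, and not for a
  \<gamma> of block \<open>k\<close> as in \<open>Kvars\<close>.\<close>

definition tvars :: "var set" where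
  "tvars = {Gam k a | k a. k \<in> {1..N-1} \<and> a \<in> {1..lamc lam k}} \<union> ZHvars n"

definition tgens :: "(var \<Rightarrow> complex) set" where
  "tgens = {x \<in> torus. \<forall>k\<in>{1..N-1}. inj_on (\<lambda>a. x (Gam k a)) {1..lamc lam k}}"

lemma tgens_torus: "tgens \<subseteq> torus"
  by (auto simp: tgens_def)

lemma gpts_tgens: "gpts \<subseteq> tgens"
  by (auto simp: gpts_def tgens_def torus_def inj_on_def inj_def)

definition tdiff :: "(var \<Rightarrow> complex) \<Rightarrow> complex" where
  "tdiff x = (\<Prod>k\<in>{1..N-1}. \<Prod>(a, b)\<in>ltpairs (lamc lam k). x (Gam k a) - x (Gam k b))"

text \<open>The denominators are \<open>1 - t_b / t_a = (t_a - t_b) / t_a\<close>. Permuting the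
  variables of a level changes the product of its differences only by a nonzero constant, so the
  same \<open>tdiff\<close> clears every term of the symmetrisation.\<close>

lemma laur_wU_tdiff:
  assumes \<pi>: "\<pi> \<in> symperms N lam"
  shows "laur tgens tvars (\<lambda>x. wU N lam L (\<lambda>k a. tfull N (\<lambda>k a. x (Gam k a)) (\<lambda>a. x (Z a)) k (\<pi> k a)) (x H) * tdiff x)"
proof -
  define tv where "tv k a = (if k = N then Z a else Gam k (\<pi> k a))" for k a
  have T: "tfull N (\<lambda>k a. x (Gam k a)) (\<lambda>a. x (Z a)) k (\<pi> k a) = x (tv k a)" for x k a
    using symperms_id[OF \<pi>, of N] N_pos by (auto simp: tv_def tfull_def)
  have tv: "tv k a \<in> tvars" if "k \<in> {1..N}" "a \<in> {1..lamc lam k}" for k a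
  proof (cases "k = N")
    case True then show ?thesis using that lamc_N by (simp add: tv_def tvars_def ZHvars_def)
  next
    case False
    then have k': "k \<in> {1..N-1}" using that by auto
    have "\<pi> k a \<in> {1..lamc lam k}" using permutes_in_image[OF symperms_permutes[OF \<pi> k']] that by blast
    then show ?thesis using k' False by (auto simp: tv_def tvars_def)
  qed
  have H: "H \<in> tvars" by (simp add: tvars_def ZHvars_def)
  have "\<forall>k\<in>{1..N-1}. \<exists>c. c \<noteq> 0 \<and> (\<forall>t :: nat \<Rightarrow> complex.
    (\<Prod>(a, b)\<in>ltpairs (lamc lam k). t (\<pi> k a) - t (\<pi> k b)) = c * (\<Prod>(a, b)\<in>ltpairs (lamc lam k). t a - t b))"
    using vandermonde_permute symperms_permutes[OF \<pi>] by blast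
  then obtain c where c: "\<And>k. k \<in> {1..N-1} \<Longrightarrow> c k \<noteq> 0"
    "\<And>k (t :: nat \<Rightarrow> complex). k \<in> {1..N-1} \<Longrightarrow>
      (\<Prod>(a, b)\<in>ltpairs (lamc lam k). t (\<pi> k a) - t (\<pi> k b)) = c k * (\<Prod>(a, b)\<in>ltpairs (lamc lam k). t a - t b)"
    by metis
  define A where "A k a x = (\<Prod>c\<in>{1..lamc lam (k+1)}.
          (if elt (cup L (k+1)) c < elt (cup L k) a then 1 - x H * x (tv (k+1) c) / x (tv k a)
           else if elt (cup L (k+1)) c > elt (cup L k) a then 1 - x (tv (k+1) c) / x (tv k a)
           else 1))" for k a and x :: "var \<Rightarrow> complex"
  define B where "B k a b x = (1 - x H * x (tv k b) / x (tv k a)) * x (tv k a)" for k a b and x :: "var \<Rightarrow> complex"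
  define G where "G x = (\<Prod>k\<in>{1..N-1}. (\<Prod>a\<in>{1..lamc lam k}. A k a x) * (\<Prod>(a, b)\<in>ltpairs (lamc lam k). B k a b x) * (1 / c k))" for x :: "var \<Rightarrow> complex"
  have lA: "laur tgens tvars (A k a)" if k: "k \<in> {1..N-1}" and a: "a \<in> {1..lamc lam k}" for k a
    unfolding A_def
  proof (rule laur_prod[OF tgens_torus])
    fix c assume c: "c \<in> {1..lamc lam (k+1)}"
    have v: "tv k a \<in> tvars" "tv (k+1) c \<in> tvars" using k a c by (intro tv; auto)+
    have "laur tgens tvars (\<lambda>x. 1 - x H * x (tv (k+1) c) / x (tv k a))"
      "laur tgens tvars (\<lambda>x. 1 - x (tv (k+1) c) / x (tv k a))"
      using v H by (intro laur_diff laur_const laur_divide_var laur_mult laur_var tgens_torus; simp)+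
    then show "laur tgens tvars (\<lambda>x. if elt (cup L (k+1)) c < elt (cup L k) a then 1 - x H * x (tv (k+1) c) / x (tv k a)
           else if elt (cup L (k+1)) c > elt (cup L k) a then 1 - x (tv (k+1) c) / x (tv k a) else 1)"
      by (cases "elt (cup L (k+1)) c" "elt (cup L k) a" rule: linorder_cases) auto
  qed
  have lB: "laur tgens tvars (\<lambda>x. case p of (a, b) \<Rightarrow> B k a b x)" if k: "k \<in> {1..N-1}" and p: "p \<in> ltpairs (lamc lam k)" for k p
  proof -
    obtain a b where p': "p = (a, b)" by (cases p)
    then have v: "tv k a \<in> tvars" "tv k b \<in> tvars" using k p by (intro tv; auto simp: mem_ltpairs)+
    have "laur tgens tvars (B k a b)" unfolding B_def
      using v H by (intro laur_mult laur_diff laur_const laur_divide_var laur_var tgens_torus; simp)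
    then show ?thesis by (simp add: p')
  qed
  have "laur tgens tvars G"
    unfolding G_def by (intro laur_prod laur_mult tgens_torus lA lB laur_const)
  moreover have "wU N lam L (\<lambda>k a. tfull N (\<lambda>k a. x (Gam k a)) (\<lambda>a. x (Z a)) k (\<pi> k a)) (x H) * tdiff x = G x"
    if x: "x \<in> tgens" for x
    unfolding wU_def T tdiff_def G_def prod.distrib[symmetric]
  proof (rule prod.cong[OF refl])
    fix k assume k: "k \<in> {1..N-1}"
    let ?P = "ltpairs (lamc lam k)"
    have kN: "k \<noteq> N" using k by auto
    have nz: "x v \<noteq> 0" for v using x by (simp add: tgens_def torus_def)
    have V: "(\<Prod>(a, b)\<in>?P. x (Gam k a) - x (Gam k b)) \<noteq> 0"
    proof -
      have inj: "inj_on (\<lambda>a. x (Gam k a)) {1..lamc lam k}" using x k by (simp add: tgens_def)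
      have "x (Gam k a) - x (Gam k b) \<noteq> 0" if "(a, b) \<in> ?P" for a b
        using inj_onD[OF inj, of a b] that by (auto simp: mem_ltpairs)
      then show ?thesis by (auto simp: prod_zero_iff finite_ltpairs)
    qed
    have cV: "(\<Prod>(a, b)\<in>?P. x (tv k a) - x (tv k b)) = c k * (\<Prod>(a, b)\<in>?P. x (Gam k a) - x (Gam k b))"
      using c(2)[OF k, of "\<lambda>a. x (Gam k a)"] kN by (simp add: tv_def)
    have "(\<Prod>a\<in>{1..lamc lam k}. \<Prod>b\<in>{a+1..lamc lam k}. (1 - x H * x (tv k b) / x (tv k a)) / (1 - x (tv k b) / x (tv k a)))
        = (\<Prod>(a, b)\<in>?P. (1 - x H * x (tv k b) / x (tv k a)) / (1 - x (tv k b) / x (tv k a)))"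
      unfolding ltpairs_def by (rule prod.Sigma) auto
    also have "\<dots> = (\<Prod>(a, b)\<in>?P. B k a b x / (x (tv k a) - x (tv k b)))"
      by (intro prod.cong refl) (auto simp: B_def field_simps nz)
    also have "\<dots> = (\<Prod>(a, b)\<in>?P. B k a b x) / (\<Prod>(a, b)\<in>?P. x (tv k a) - x (tv k b))"
      by (simp add: case_prod_beta prod_dividef)
    finally have R: "(\<Prod>a\<in>{1..lamc lam k}. \<Prod>b\<in>{a+1..lamc lam k}. (1 - x H * x (tv k b) / x (tv k a)) / (1 - x (tv k b) / x (tv k a)))
        = (\<Prod>(a, b)\<in>?P. B k a b x) / (c k * (\<Prod>(a, b)\<in>?P. x (Gam k a) - x (Gam k b)))"
      unfolding cV .
    show "(\<Prod>a\<in>{1..lamc lam k}. (\<Prod>c\<in>{1..lamc lam (k+1)}.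
          (if elt (cup L (k+1)) c < elt (cup L k) a then 1 - x H * x (tv (k+1) c) / x (tv k a)
           else if elt (cup L (k+1)) c > elt (cup L k) a then 1 - x (tv (k+1) c) / x (tv k a)
           else 1)) * (\<Prod>b\<in>{a+1..lamc lam k}. (1 - x H * x (tv k b) / x (tv k a)) / (1 - x (tv k b) / x (tv k a))))
        * (\<Prod>(a, b)\<in>?P. x (Gam k a) - x (Gam k b))
      = (\<Prod>a\<in>{1..lamc lam k}. A k a x) * (\<Prod>(a, b)\<in>?P. B k a b x) * (1 / c k)"
      unfolding prod.distrib R A_def[symmetric] using V c(1)[OF k] by simp
  qed
  ultimately show ?thesis by (subst laur_cong[of tgens _ G])
qed

text \<open>\<open>tdiff\<close> contains each difference once, so the poles are at most simple, and
  symmetry in the variables of each level removes them.\<close>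

lemma laur_wW: "laur tgens tvars (\<lambda>x. wW N lam L (\<lambda>k a. x (Gam k a)) (\<lambda>a. x (Z a)) (x H))"
proof -
  define f where "f x = wW N lam L (\<lambda>k a. x (Gam k a)) (\<lambda>a. x (Z a)) (x H)" for x
  define S where "S = Sigma {1..N-1} (\<lambda>k. ltpairs (lamc lam k))"
  define e where "e p = (case p of (k, a, b) \<Rightarrow> (Gam k a, Gam k b))" for p :: "nat \<times> nat \<times> nat"
  define A where "A = e ` S"
  have S: "finite S" by (simp add: S_def finite_ltpairs)
  have inj: "inj_on e S" by (auto simp: inj_on_def e_def)
  have prodA: "(\<Prod>(u, v)\<in>A. x u - x v) = tdiff x" for x :: "var \<Rightarrow> complex"
  proof -
    have "(\<Prod>(u, v)\<in>A. x u - x v) = (\<Prod>(k, p)\<in>S. case p of (a, b) \<Rightarrow> x (Gam k a) - x (Gam k b))"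
      unfolding A_def prod.reindex[OF inj] by (intro prod.cong refl) (auto simp: e_def)
    also have "\<dots> = tdiff x" unfolding S_def tdiff_def by (rule prod.Sigma[symmetric]) (auto simp: finite_ltpairs)
    finally show ?thesis .
  qed
  have A: "\<exists>k a b. u = Gam k a \<and> v = Gam k b \<and> k \<in> {1..N-1} \<and> a \<in> {1..lamc lam k} \<and> b \<in> {1..lamc lam k} \<and> a < b"
    if "(u, v) \<in> A" for u v
    using that by (auto simp: A_def e_def S_def mem_ltpairs)
  have "laur tgens tvars f"
  proof (rule laur_symmetric_poles[of A])
    show "finite A" using S by (simp add: A_def)
    show "tgens \<subseteq> torus" "gpts \<subseteq> tgens" by (fact tgens_torus gpts_tgens)+
    show "\<forall>(u, v)\<in>A. u \<noteq> v \<and> (v, u) \<notin> A \<and> u \<in> tvars \<and> v \<in> tvars"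
    proof clarify
      fix u v assume uv: "(u, v) \<in> A"
      have "(v, u) \<notin> A" using A[OF uv] A[of v u] by force
      then show "u \<noteq> v \<and> (v, u) \<notin> A \<and> u \<in> tvars \<and> v \<in> tvars"
        using A[OF uv] by (auto simp: tvars_def)
    qed
    show "\<forall>(u, v)\<in>A. \<forall>x\<in>tgens. x u \<noteq> x v \<and> x \<circ> transpose u v \<in> tgens \<and> f (x \<circ> transpose u v) = f x"
    proof clarify
      fix u v x assume uv: "(u, v) \<in> A" and x: "x \<in> tgens"
      obtain k a b where k: "u = Gam k a" "v = Gam k b" "k \<in> {1..N-1}" "a \<in> {1..lamc lam k}" "b \<in> {1..lamc lam k}" "a < b"
        using A[OF uv] by blast
      define \<rho> where "\<rho> l = (if l = k then transpose a b else id)" for l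
      have \<rho>: "\<rho> \<in> symperms N lam"
        unfolding symperms_def \<rho>_def using k(3) permutes_swap_id[OF k(4,5)] by (simp add: permutes_id)
      have G: "(x \<circ> transpose u v) (Gam l c) = x (Gam l (\<rho> l c))" for l c
        by (auto simp: k \<rho>_def transpose_def)
      have ZH: "(x \<circ> transpose u v) (Z c) = x (Z c)" "(x \<circ> transpose u v) H = x H" for c
        by (auto simp: k transpose_def)
      have xi: "inj_on (\<lambda>a. x (Gam l a)) {1..lamc lam l}" if "l \<in> {1..N-1}" for l
        using x that by (simp add: tgens_def)
      have "x u \<noteq> x v" using inj_onD[OF xi[OF k(3)] _ k(4,5)] k(1,2,6) by auto
      moreover have "x \<circ> transpose u v \<in> tgens"
      proof -
        have "inj_on (\<lambda>c. (x \<circ> transpose u v) (Gam l c)) {1..lamc lam l}" if l: "l \<in> {1..N-1}" for l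
        proof -
          have \<rho>l: "\<rho> l permutes {1..lamc lam l}" by (rule symperms_permutes[OF \<rho> l])
          have "inj_on ((\<lambda>a. x (Gam l a)) \<circ> \<rho> l) {1..lamc lam l}"
            using xi[OF l] permutes_image[OF \<rho>l] permutes_inj_on[OF \<rho>l] by (intro comp_inj_on) simp_all
          then show ?thesis unfolding G by (simp add: o_def)
        qed
        then show ?thesis using x by (simp add: tgens_def torus_def)
      qed
      moreover have "f (x \<circ> transpose u v) = f x"
        unfolding f_def G ZH by (rule wW_symmetric[OF \<rho>])
      ultimately show "x u \<noteq> x v \<and> x \<circ> transpose u v \<in> tgens \<and> f (x \<circ> transpose u v) = f x" by blast
    qed
    have "laur tgens tvars (\<lambda>x. (1 - x H) ^ lam1 N lam * (\<Sum>\<pi>\<in>symperms N lam.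
        wU N lam L (\<lambda>k a. tfull N (\<lambda>k a. x (Gam k a)) (\<lambda>a. x (Z a)) k (\<pi> k a)) (x H) * tdiff x))"
      by (intro laur_mult laur_power laur_diff laur_const laur_var laur_sum laur_wU_tdiff tgens_torus)
        (simp add: tvars_def ZHvars_def)
    then show "laur tgens tvars (\<lambda>x. f x * (\<Prod>(u, v)\<in>A. x u - x v))"
      by (simp add: f_def wW_def prodA sum_distrib_right mult.assoc)
  qed
  then show ?thesis by (simp add: f_def[abs_def])
qed

end

subsection \<open>The interpolating class\<close>

context flag_type
begin

lemma flag_pairI: "\<sigma> permutes {1..n} \<Longrightarrow> ordpart N n lam I \<Longrightarrow> ordpart N n lam J \<Longrightarrow> flag_pair N n lam \<sigma> I J"
  by unfold_locales

section \<open>Lagrange kernels and their denominators\<close>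

definition parts :: "(nat \<Rightarrow> nat set) set" where
  "parts = {J. ordpart N n lam J}"

lemma finite_parts: "finite parts"
proof (rule inj_on_finite)
  show "inj_on (\<lambda>J. restrict J {1..N}) parts"
  proof (rule inj_onI, rule ext)
    fix J L k assume *: "J \<in> parts" "L \<in> parts" "restrict J {1..N} = restrict L {1..N}"
    show "J k = L k"
    proof (cases "k \<in> {1..N}")
      case True then show ?thesis using *(3) by (metis restrict_apply')
    next
      case False then show ?thesis using * by (simp add: parts_def ordpart_def)
    qed
  qed
  show "(\<lambda>J. restrict J {1..N}) ` parts \<subseteq> PiE {1..N} (\<lambda>_. Pow {1..n})"
    by (auto simp: parts_def ordpart_def)
  show "finite (PiE {1..N} (\<lambda>_. Pow {1..n}))" by (intro finite_PiE) auto
qed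

definition kern :: "(nat \<Rightarrow> nat set) \<Rightarrow> (var \<Rightarrow> complex) \<Rightarrow> complex" where
  "kern J x = (\<Prod>k\<in>{1..N}. \<Prod>l\<in>{k<..N}. \<Prod>a\<in>{1..lam k}. \<Prod>b\<in>J l. x (Gam k a) - x (Z b))"

definition euler :: "(nat \<Rightarrow> nat set) \<Rightarrow> (var \<Rightarrow> complex) \<Rightarrow> complex" where
  "euler J x = (\<Prod>k\<in>{1..N}. \<Prod>l\<in>{k<..N}. \<Prod>a\<in>J k. \<Prod>b\<in>J l. x (Z a) - x (Z b))"

definition blkpairs :: "(nat \<Rightarrow> nat set) \<Rightarrow> (nat \<times> nat) set" where
  "blkpairs J = {(a, b) \<in> {1..n} \<times> {1..n}. blk J a < blk J b}"

lemma finite_blkpairs: "finite (blkpairs J)"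
  by (rule finite_subset[of _ "{1..n} \<times> {1..n}"]) (auto simp: blkpairs_def)

lemma prod_filtered_pairs:
  fixes g :: "nat \<Rightarrow> nat \<Rightarrow> 'a::comm_monoid_mult"
  shows "(\<Prod>(a, b)\<in>{(a, b) \<in> {1..n} \<times> {1..n}. R a b}. g a b)
    = (\<Prod>a\<in>{1..n}. \<Prod>b\<in>{1..n}. if R a b then g a b else 1)"
proof -
  have "{(a, b) \<in> {1..n} \<times> {1..n}. R a b} = {p \<in> {1..n} \<times> {1..n}. case p of (a, b) \<Rightarrow> R a b}" by auto
  then have "(\<Prod>(a, b)\<in>{(a, b) \<in> {1..n} \<times> {1..n}. R a b}. g a b)
      = (\<Prod>p\<in>{1..n} \<times> {1..n}. if (case p of (a, b) \<Rightarrow> R a b) then (case p of (a, b) \<Rightarrow> g a b) else 1)"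
    by (simp only: prod.inter_filter finite_cartesian_product finite_atLeastAtMost)
  also have "\<dots> = (\<Prod>a\<in>{1..n}. \<Prod>b\<in>{1..n}. if R a b then g a b else 1)"
    unfolding prod.cartesian_product by (intro prod.cong refl) auto
  finally show ?thesis .
qed

lemma euler_eq:
  assumes "ordpart N n lam J"
  shows "euler J x = (\<Prod>(a, b)\<in>blkpairs J. x (Z a) - x (Z b))"
proof -
  interpret P: flag_pair N n lam id J J by (rule flag_pairI) (simp_all add: assms permutes_id)
  have J: "J k = {a \<in> {1..n}. id a \<in> J k}" if "k \<in> {1..N}" for k
  proof -
    have "J k \<subseteq> {1..n}" using assms that by (simp add: ordpart_def)
    then show ?thesis by auto
  qed
  have "euler J x = (\<Prod>k\<in>{1..N}. \<Prod>l\<in>{k<..N}. \<Prod>a\<in>{a\<in>{1..n}. id a \<in> J k}.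
      \<Prod>b\<in>{b\<in>{1..n}. id b \<in> J l \<and> True}. x (Z (id a)) - x (Z (id b)))"
    unfolding euler_def using J by (intro prod.cong refl) auto
  also have "\<dots> = (\<Prod>j\<in>{1..n}. \<Prod>j'\<in>{1..n}. if blk J j < blk J j' \<and> True then x (Z j) - x (Z j') else 1)"
    by (rule P.block_prod)
  also have "\<dots> = (\<Prod>(a, b)\<in>blkpairs J. x (Z a) - x (Z b))"
    unfolding blkpairs_def prod_filtered_pairs by simp
  finally show ?thesis .
qed

lemma gens_distinct: "x \<in> gens \<Longrightarrow> a \<in> {1..n} \<Longrightarrow> b \<in> {1..n} \<Longrightarrow> a \<noteq> b \<Longrightarrow> x (Z a) - x (Z b) \<noteq> 0"
  unfolding gens_def gen_def by (simp del: One_nat_def)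

lemma euler_nonzero:
  assumes "ordpart N n lam J" "x \<in> gens" shows "euler J x \<noteq> 0"
proof -
  have "x (Z a) - x (Z b) \<noteq> 0" if "(a, b) \<in> blkpairs J" for a b
    using that by (intro gens_distinct[OF assms(2)]) (auto simp: blkpairs_def)
  then show ?thesis unfolding euler_eq[OF assms(1)] by (auto simp: prod_zero_iff finite_blkpairs)
qed

lemma laur_diff_Z: "a \<in> {1..n} \<Longrightarrow> b \<in> {1..n} \<Longrightarrow> ZHvars n \<subseteq> V \<Longrightarrow> laur gens V (\<lambda>x. x (Z a) - x (Z b))"
  using Z_ZHvars by (intro laur_diff laur_var) auto

text \<open>Up to sign, \<open>euler J\<close> is a product of distinct factors of the Vandermonde
  product. Hence the latter clears all denominators of the interpolation sum at the cost of simple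
  poles only.\<close>

lemma laur_vandermonde_euler:
  assumes "ordpart N n lam J" "ZHvars n \<subseteq> V"
  shows "laur gens V (\<lambda>x. (\<Prod>(a, b)\<in>ltpairs n. x (Z a) - x (Z b)) / euler J x)"
proof -
  let ?Q = "blkpairs J"
  have Q: "\<forall>(a, b)\<in>?Q. a \<noteq> b \<and> (b, a) \<notin> ?Q" by (auto simp: blkpairs_def)
  obtain c where c: "c \<noteq> 0" "\<And>t :: nat \<Rightarrow> complex. (\<Prod>(a, b)\<in>?Q. t a - t b) = c * (\<Prod>(a, b)\<in>opair ` ?Q. t a - t b)"
    using orient_differences[OF finite_blkpairs Q] by blast
  have sub: "opair ` ?Q \<subseteq> ltpairs n"
  proof (rule image_subsetI)
    fix p assume p: "p \<in> ?Q"
    obtain a b where ab: "p = (a, b)" by (cases p)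
    then have "a \<in> {1..n}" "b \<in> {1..n}" "a \<noteq> b" using p by (auto simp: blkpairs_def)
    then show "opair p \<in> ltpairs n" unfolding ab by (auto simp: opair_def mem_ltpairs min_def max_def)
  qed
  have "laur gens V (\<lambda>x. (1 / c) * (\<Prod>p\<in>ltpairs n - opair ` ?Q. case p of (a, b) \<Rightarrow> x (Z a) - x (Z b)))"
  proof (intro laur_mult laur_const laur_prod gens_torus)
    fix p assume "p \<in> ltpairs n - opair ` ?Q"
    then obtain a b where "p = (a, b)" "a \<in> {1..n}" "b \<in> {1..n}" by (cases p) (auto simp: mem_ltpairs)
    then show "laur gens V (\<lambda>x. case p of (a, b) \<Rightarrow> x (Z a) - x (Z b))"
      using laur_diff_Z assms(2) by simp
  qed
  moreover have "(\<Prod>(a, b)\<in>ltpairs n. x (Z a) - x (Z b)) / euler J x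
      = (1 / c) * (\<Prod>p\<in>ltpairs n - opair ` ?Q. case p of (a, b) \<Rightarrow> x (Z a) - x (Z b))" if x: "x \<in> gens" for x
  proof -
    have e: "euler J x = c * (\<Prod>(a, b)\<in>opair ` ?Q. x (Z a) - x (Z b))"
      unfolding euler_eq[OF assms(1)] by (rule c(2))
    have "(\<Prod>(a, b)\<in>ltpairs n. x (Z a) - x (Z b)) = (\<Prod>(a, b)\<in>ltpairs n - opair ` ?Q. x (Z a) - x (Z b))
        * (\<Prod>(a, b)\<in>opair ` ?Q. x (Z a) - x (Z b))"
      by (rule prod.subset_diff[OF sub finite_ltpairs])
    then show ?thesis using e euler_nonzero[OF assms(1) x] by (simp add: field_simps)
  qed
  ultimately show ?thesis by (subst laur_cong)
qed

text \<open>Ordered pairs are used, so that every \<open>euler J\<close> is a subproduct of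
  \<open>allz 1\<close> without sign corrections.\<close>

definition allz :: "nat \<Rightarrow> (var \<Rightarrow> complex) \<Rightarrow> complex" where
  "allz m x = (\<Prod>j\<in>{1..n}. \<Prod>j'\<in>{1..n}. if j \<noteq> j' then (x (Z j) - x (Z j')) ^ m else 1)"

lemma zdiff_allz: "zdiff x = allz (N - 1) x"
  unfolding zdiff_def allz_def by (intro prod.cong refl) auto

lemma laur_allz_euler:
  assumes "ordpart N n lam J" "ZHvars n \<subseteq> V"
  shows "laur gens V (\<lambda>x. allz 1 x / euler J x)"
proof -
  let ?R = "{(a, b) \<in> {1..n} \<times> {1..n}. a \<noteq> b}"
  have sub: "blkpairs J \<subseteq> ?R" by (auto simp: blkpairs_def)
  have fin: "finite ?R" by (rule finite_subset[of _ "{1..n} \<times> {1..n}"]) auto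
  have "laur gens V (\<lambda>x. \<Prod>p\<in>?R - blkpairs J. case p of (a, b) \<Rightarrow> x (Z a) - x (Z b))"
  proof (intro laur_prod gens_torus)
    fix p assume "p \<in> ?R - blkpairs J"
    then obtain a b where "p = (a, b)" "a \<in> {1..n}" "b \<in> {1..n}" by (cases p) auto
    then show "laur gens V (\<lambda>x. case p of (a, b) \<Rightarrow> x (Z a) - x (Z b))"
      using laur_diff_Z assms(2) by simp
  qed
  moreover have "allz 1 x / euler J x = (\<Prod>p\<in>?R - blkpairs J. case p of (a, b) \<Rightarrow> x (Z a) - x (Z b))"
    if x: "x \<in> gens" for x
  proof -
    have "allz 1 x = (\<Prod>(a, b)\<in>?R. x (Z a) - x (Z b))"
      unfolding prod_filtered_pairs allz_def power_one_right ..
    also have "\<dots> = (\<Prod>(a, b)\<in>?R - blkpairs J. x (Z a) - x (Z b)) * euler J x"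
      unfolding euler_eq[OF assms(1)] by (rule prod.subset_diff[OF sub fin])
    finally show ?thesis using euler_nonzero[OF assms(1) x] by simp
  qed
  ultimately show ?thesis by (subst laur_cong)
qed

lemma laur_kern:
  assumes "ordpart N n lam J" "Kvars N n lam \<subseteq> V"
  shows "laur gens V (kern J)"
  unfolding kern_def
proof (intro laur_prod gens_torus laur_diff laur_var)
  fix k l a b assume *: "k \<in> {1..N}" "l \<in> {k<..N}" "a \<in> {1..lam k}" "b \<in> J l"
  have "J l \<subseteq> {1..n}" using assms(1) * by (auto simp: ordpart_def)
  then have "b \<in> {1..n}" using * by blast
  then show "Gam k a \<in> V" "Z b \<in> V" using * assms(2) by (auto simp: Kvars_def ZHvars_def)
qed

definition restrmap :: "(nat \<Rightarrow> nat set) \<Rightarrow> var \<Rightarrow> var" where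
  "restrmap J v = (case v of Gam k a \<Rightarrow> Z (elt (J k) a) | _ \<Rightarrow> v)"

lemma restr_eq: "restr J F = lsubst (restrmap J) F"
  by (simp add: restr_def restrmap_def[abs_def])

lemma elt_block_bij:
  assumes "ordpart N n lam J" "k \<in> {1..N}"
  shows "bij_betw (elt (J k)) {1..lam k} (J k)"
proof -
  have "J k \<subseteq> {1..n}" "card (J k) = lam k" using assms by (auto simp: ordpart_def)
  then show ?thesis using elt_bij[of "J k"] finite_subset by auto
qed

text \<open>For \<open>J \<noteq> L\<close> some index lies in block \<open>k\<close> of
  \<open>L\<close> and in a later block of \<open>J\<close>; otherwise each \<open>cup L k\<close>
  would lie in \<open>cup J k\<close>. That index yields a vanishing factor.\<close>

lemma kern_restr:
  assumes J: "ordpart N n lam J" and L: "ordpart N n lam L"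
  shows "kern J (x \<circ> restrmap L) = (if J = L then euler L x else 0)"
proof -
  have k: "kern J (x \<circ> restrmap L) = (\<Prod>k\<in>{1..N}. \<Prod>l\<in>{k<..N}. \<Prod>a\<in>L k. \<Prod>b\<in>J l. x (Z a) - x (Z b))"
    unfolding kern_def
  proof (rule prod.cong[OF refl], rule prod.cong[OF refl])
    fix k l assume "k \<in> {1..N}"
    from prod.reindex_bij_betw[OF elt_block_bij[OF L this], of "\<lambda>a. \<Prod>b\<in>J l. x (Z a) - x (Z b)"]
    show "(\<Prod>a\<in>{1..lam k}. \<Prod>b\<in>J l. (x \<circ> restrmap L) (Gam k a) - (x \<circ> restrmap L) (Z b))
        = (\<Prod>a\<in>L k. \<Prod>b\<in>J l. x (Z a) - x (Z b))" by (simp add: restrmap_def)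
  qed
  show ?thesis
  proof (cases "J = L")
    case True
    then show ?thesis using k by (simp add: euler_def)
  next
    case False
    have "\<exists>k\<in>{1..N}. \<exists>l\<in>{k<..N}. L k \<inter> J l \<noteq> {}"
    proof (rule ccontr)
      assume neg: "\<not> ?thesis"
      have "J = L"
      proof (rule ordpart_eqI[OF L J])
        fix k assume k: "k \<in> {1..N}"
        show "cup L k \<subseteq> cup J k"
        proof
          fix i assume "i \<in> cup L k"
          then have i: "i \<in> {1..n}" "blk L i \<le> k" using mem_cup_iff[OF L, of k i] k by auto
          have "\<not> blk L i < blk J i"
            using neg blk_in[OF L i(1)] blk_in[OF J i(1)] by fastforce
          then show "i \<in> cup J k" using i k mem_cup_iff[OF J, of k i] by auto
        qed
      qed
      then show False using False by simp
    qed
    then obtain k0 l0 i where kl: "k0 \<in> {1..N}" "l0 \<in> {k0<..N}" "i \<in> L k0" "i \<in> J l0" by blast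
    have fin: "finite (L k0)" "finite (J l0)"
    proof -
      have "L k0 \<subseteq> {1..n}" "J l0 \<subseteq> {1..n}" using L J kl by (auto simp: ordpart_def)
      then show "finite (L k0)" "finite (J l0)" by (auto intro: finite_subset)
    qed
    have "(\<Prod>b\<in>J l0. x (Z i) - x (Z b)) = 0" using kl fin by (intro prod_zero) auto
    then have "(\<Prod>a\<in>L k0. \<Prod>b\<in>J l0. x (Z a) - x (Z b)) = 0" using kl fin by (intro prod_zero) blast+
    then have "(\<Prod>l\<in>{k0<..N}. \<Prod>a\<in>L k0. \<Prod>b\<in>J l. x (Z a) - x (Z b)) = 0" using kl by (intro prod_zero) blast+
    then have "(\<Prod>k\<in>{1..N}. \<Prod>l\<in>{k<..N}. \<Prod>a\<in>L k. \<Prod>b\<in>J l. x (Z a) - x (Z b)) = 0" using kl by (intro prod_zero) blast+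
    then show ?thesis using False k by simp
  qed
qed

lemma restrmap_gens: "x \<in> gens \<Longrightarrow> x \<circ> restrmap J \<in> gens"
  by (simp add: gens_def torus_def restrmap_def)

lemma lvars_restr:
  assumes "lvars F \<subseteq> Kvars N n lam" "ordpart N n lam J" shows "lvars (restr J F) \<subseteq> ZHvars n"
proof -
  have "restrmap J v \<in> ZHvars n" if v: "v \<in> Kvars N n lam" for v
  proof -
    have "elt (J k) a \<in> {1..n}" if "k \<in> {1..N}" "a \<in> {1..lam k}" for k a
    proof -
      have "J k \<subseteq> {1..n}" using assms(2) that by (simp add: ordpart_def)
      then show ?thesis using bij_betw_apply[OF elt_block_bij[OF assms(2) that(1)] that(2)] by blast
    qed
    then show ?thesis using v by (auto simp: Kvars_def ZHvars_def restrmap_def)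
  qed
  then show ?thesis using lvars_lsubst[of "restrmap J" F] assms(1) unfolding restr_eq by blast
qed

text \<open>The second slot of the weight function is not symmetric in \<open>z\<close>; with independent variables
  \<open>Gam 0 a\<close> in that slot the interpolation sum becomes symmetric in \<open>z\<close>, so that its poles cancel.\<close>

definition yw :: "(nat \<Rightarrow> nat set) \<Rightarrow> (nat \<Rightarrow> nat set) \<Rightarrow> (var \<Rightarrow> complex) \<Rightarrow> complex" where
  "yw L J x = wW N lam L (\<lambda>k a. x (Z (elt (cup J k) a))) (\<lambda>a. x (Gam 0 a)) (x H)
     / wE N lam (\<lambda>k a. x (Z (elt (cup J k) a))) (x H)"

text \<open>A common multiple of the localisations of \<open>E\<close> at all \<open>J\<close>: it
  does not depend on \<open>J\<close> and is symmetric in the \<open>z\<close>.\<close>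

definition hprod :: "(var \<Rightarrow> complex) \<Rightarrow> complex" where
  "hprod x = (\<Prod>k\<in>{1..N-1}. \<Prod>a\<in>{1..n}. \<Prod>b\<in>{1..n}. 1 - x H * x (Z b) / x (Z a))"

definition yinterp :: "(nat \<Rightarrow> nat set) \<Rightarrow> (var \<Rightarrow> complex) \<Rightarrow> complex" where
  "yinterp L x = (\<Sum>J\<in>parts. yw L J x * kern J x / euler J x)"

abbreviation "yvars \<equiv> Kvars N n lam \<union> {Gam 0 a | a. a \<in> {1..n}}"

text \<open>A renaming of variables in the weight function: \<open>t\<close> becomes
  \<open>z\<close>, while the former \<open>z\<close> move to \<open>Gam 0\<close>. The index 0 is
  free because the blocks of \<gamma> start at 1.\<close>

lemma laur_yw_wE:
  assumes J: "ordpart N n lam J"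
  shows "laur gens yvars (\<lambda>x. wW N lam L (\<lambda>k a. x (Z (elt (cup J k) a))) (\<lambda>a. x (Gam 0 a)) (x H))"
proof -
  define g where "g v = (case v of Gam k a \<Rightarrow> Z (elt (cup J k) a) | Z a \<Rightarrow> Gam 0 a | H \<Rightarrow> H)" for v
  have el: "elt (cup J k) a \<in> {1..n}" if "k \<le> N" "a \<in> {1..lamc lam k}" for k a
  proof -
    have "elt (cup J k) a \<in> cup J k"
      using bij_betw_apply[OF elt_bij[OF ordpart_cup(2)[OF J that(1)]]] ordpart_cup(3)[OF J that(1)] that(2) by simp
    then show ?thesis using ordpart_cup(1)[OF J that(1)] by blast
  qed
  have "x \<circ> g \<in> tgens" if x: "x \<in> gens" for x
  proof -
    have "inj_on (\<lambda>a. (x \<circ> g) (Gam k a)) {1..lamc lam k}" if k: "k \<in> {1..N-1}" for k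
    proof (rule inj_onI)
      fix a b assume ab: "a \<in> {1..lamc lam k}" "b \<in> {1..lamc lam k}" "(x \<circ> g) (Gam k a) = (x \<circ> g) (Gam k b)"
      have kN: "k \<le> N" using k by auto
      have "elt (cup J k) a = elt (cup J k) b"
        using gens_distinct[OF x el[OF kN ab(1)] el[OF kN ab(2)]] ab(3) by (auto simp: g_def)
      then show "a = b"
        using inj_onD[OF bij_betw_imp_inj_on[OF elt_bij[OF ordpart_cup(2)[OF J kN]]]] ab(1,2)
        unfolding ordpart_cup(3)[OF J kN] by blast
    qed
    then show ?thesis using x by (auto simp: tgens_def gens_def torus_def)
  qed
  moreover have "g ` tvars \<subseteq> yvars"
  proof
    fix v assume "v \<in> g ` tvars"
    then obtain u where u: "u \<in> tvars" "v = g u" by blast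
    then consider k a where "u = Gam k a" "k \<le> N" "a \<in> {1..lamc lam k}" | "u \<in> ZHvars n"
      by (auto simp: tvars_def)
    then show "v \<in> yvars"
      using el u by cases (auto simp: g_def Kvars_def ZHvars_def)
  qed
  ultimately have "laur gens yvars (\<lambda>x. wW N lam L (\<lambda>k a. (x \<circ> g) (Gam k a)) (\<lambda>a. (x \<circ> g) (Z a)) ((x \<circ> g) H))"
    by (rule laur_subst[OF gens_torus laur_wW])
  then show ?thesis by (simp add: g_def)
qed

lemma laur_hprod_wE:
  assumes J: "ordpart N n lam J" and V: "ZHvars n \<subseteq> V"
  shows "laur gens V (\<lambda>x. hprod x / wE N lam (\<lambda>k a. x (Z (elt (cup J k) a))) (x H))"
proof -
  interpret P: flag_pair N n lam id J J by (rule flag_pairI) (simp_all add: J permutes_id)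
  have "laur gens V (\<lambda>x. \<Prod>k\<in>{1..N-1}. \<Prod>a\<in>{1..n}. \<Prod>b\<in>{1..n}.
      if blk J a \<le> k \<and> blk J b \<le> k then 1 else 1 - x H * x (Z b) / x (Z a))"
  proof (intro laur_prod gens_torus)
    fix k a b assume "a \<in> {1..n}" "b \<in> {1..n}"
    then have "Z a \<in> V" "Z b \<in> V" "H \<in> V" using V by (auto simp: ZHvars_def)
    then have "laur gens V (\<lambda>x. 1 - x H * x (Z b) / x (Z a))"
      by (intro laur_diff laur_const laur_divide_var laur_mult laur_var gens_torus)
    then show "laur gens V (\<lambda>x. if blk J a \<le> k \<and> blk J b \<le> k then 1 else 1 - x H * x (Z b) / x (Z a))"
      by (cases "blk J a \<le> k"; cases "blk J b \<le> k") simp_all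
  qed
  moreover have "hprod x / wE N lam (\<lambda>k a. x (Z (elt (cup J k) a))) (x H)
     = (\<Prod>k\<in>{1..N-1}. \<Prod>a\<in>{1..n}. \<Prod>b\<in>{1..n}.
      if blk J a \<le> k \<and> blk J b \<le> k then 1 else 1 - x H * x (Z b) / x (Z a))" if x: "x \<in> gens" for x
  proof -
    have gen: "gen n (\<lambda>a. x (Z a)) (x H)" using x by (simp add: gens_def)
    show ?thesis
      unfolding hprod_def P.wE_eq[of "\<lambda>a. x (Z a)" "x H"] prod_dividef[symmetric]
      using P.hf_nonzero[OF gen] by (intro prod.cong refl) auto
  qed
  ultimately show ?thesis by (subst laur_cong)
qed

text \<open>Permuting the \<open>z\<close> moves the localisation from \<open>J\<close> to its
  image, up to the order of the variables within a level; the symmetry of \<open>wW\<close> and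
  \<open>wE\<close> absorbs that order.\<close>

lemma yw_permute:
  assumes J: "ordpart N n lam J" and \<tau>: "\<tau> permutes {1..n}"
  shows "yw L J (x \<circ> zperm \<tau>) = yw L (\<lambda>k. \<tau> ` J k) x"
proof -
  let ?J = "\<lambda>k. \<tau> ` J k"
  have J': "ordpart N n lam ?J" using ordpart_image[OF J \<tau>] .
  have "\<exists>\<rho>. \<rho> permutes {1..lamc lam k} \<and> (\<forall>a\<in>{1..lamc lam k}. elt (cup ?J k) (\<rho> a) = \<tau> (elt (cup J k) a))"
    if k: "k \<in> {1..N-1}" for k
  proof -
    have kN: "k \<le> N" using k by auto
    have 1: "bij_betw (elt (cup J k)) {1..lamc lam k} (cup J k)" "bij_betw (elt (cup ?J k)) {1..lamc lam k} (cup ?J k)"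
      using elt_bij[OF ordpart_cup(2)[OF J kN]] elt_bij[OF ordpart_cup(2)[OF J' kN]]
        ordpart_cup(3)[OF J kN] ordpart_cup(3)[OF J' kN] by simp_all
    have "bij_betw \<tau> (cup J k) (cup ?J k)"
      using permutes_inj[OF \<tau>] by (auto simp: bij_betw_def cup_image intro: inj_on_subset)
    from matching_permutation[OF 1(2) bij_betw_trans[OF 1(1) this]] show ?thesis by (metis comp_apply)
  qed
  then obtain \<rho>0 where \<rho>0: "\<And>k. k \<in> {1..N-1} \<Longrightarrow> \<rho>0 k permutes {1..lamc lam k}"
    "\<And>k a. k \<in> {1..N-1} \<Longrightarrow> a \<in> {1..lamc lam k} \<Longrightarrow> elt (cup ?J k) (\<rho>0 k a) = \<tau> (elt (cup J k) a)" by metis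
  define \<rho> where "\<rho> k = (if k \<in> {1..N-1} then \<rho>0 k else id)" for k
  have \<rho>: "\<rho> \<in> symperms N lam" using \<rho>0(1) by (auto simp: symperms_def \<rho>_def permutes_id)
  define t where "t k a = x (Z (elt (cup ?J k) a))" for k a
  have t: "(x \<circ> zperm \<tau>) (Z (elt (cup J k) a)) = t k (\<rho> k a)" if "k \<in> {1..N-1}" "a \<in> {1..lamc lam k}" for k a
    using \<rho>0(2)[OF that] that(1) by (simp add: zperm_def t_def \<rho>_def)
  have W: "wW N lam L (\<lambda>k a. (x \<circ> zperm \<tau>) (Z (elt (cup J k) a))) z h = wW N lam L t z h" for z h
  proof -
    have "wW N lam L (\<lambda>k a. (x \<circ> zperm \<tau>) (Z (elt (cup J k) a))) z h = wW N lam L (\<lambda>k a. t k (\<rho> k a)) z h"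
      by (rule wW_cong) (simp_all only: t)
    then show ?thesis using wW_symmetric[OF \<rho>] by simp
  qed
  have E: "wE N lam (\<lambda>k a. (x \<circ> zperm \<tau>) (Z (elt (cup J k) a))) h = wE N lam t h" for h
  proof -
    have "wE N lam (\<lambda>k a. (x \<circ> zperm \<tau>) (Z (elt (cup J k) a))) h = wE N lam (\<lambda>k a. t k (\<rho> k a)) h"
      by (rule wE_cong) (simp only: t)
    then show ?thesis using wE_symmetric[OF \<rho>] by simp
  qed
  show ?thesis unfolding yw_def W E by (simp add: t_def[abs_def] zperm_def)
qed

lemma kern_permute:
  assumes "\<tau> permutes {1..n}" shows "kern J (x \<circ> zperm \<tau>) = kern (\<lambda>k. \<tau> ` J k) x"
proof -
  have inj: "inj_on \<tau> S" for S using permutes_inj[OF assms] by (rule inj_on_subset) simp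
  show ?thesis unfolding kern_def prod.reindex[OF inj] by (simp add: zperm_def)
qed

lemma euler_permute:
  assumes "\<tau> permutes {1..n}" shows "euler J (x \<circ> zperm \<tau>) = euler (\<lambda>k. \<tau> ` J k) x"
proof -
  have inj: "inj_on \<tau> S" for S using permutes_inj[OF assms] by (rule inj_on_subset) simp
  show ?thesis unfolding euler_def prod.reindex[OF inj] by (simp add: zperm_def)
qed

lemma hprod_permute:
  assumes \<tau>: "\<tau> permutes {1..n}" shows "hprod (x \<circ> zperm \<tau>) = hprod x"
proof -
  have "(\<Prod>a\<in>{1..n}. \<Prod>b\<in>{1..n}. 1 - x H * x (Z (\<tau> b)) / x (Z (\<tau> a)))
     = (\<Prod>a\<in>{1..n}. \<Prod>b\<in>{1..n}. 1 - x H * x (Z b) / x (Z (\<tau> a)))"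
    using prod.permute[OF \<tau>, of "\<lambda>b. 1 - x H * x (Z b) / x (Z (\<tau> a))" for a] by (simp add: o_def)
  also have "\<dots> = (\<Prod>a\<in>{1..n}. \<Prod>b\<in>{1..n}. 1 - x H * x (Z b) / x (Z a))"
    using prod.permute[OF \<tau>, of "\<lambda>a. \<Prod>b\<in>{1..n}. 1 - x H * x (Z b) / x (Z a)"] by (simp add: o_def)
  finally show ?thesis by (simp add: hprod_def zperm_def)
qed

lemma yinterp_permute:
  assumes \<tau>: "\<tau> permutes {1..n}" shows "yinterp L (x \<circ> zperm \<tau>) = yinterp L x"
proof -
  have bij: "bij_betw (\<lambda>J k. \<tau> ` J k) parts parts"
    by (rule bij_betwI[where g = "\<lambda>J k. inv \<tau> ` J k"])
       (auto simp: parts_def ordpart_image[OF _ \<tau>] ordpart_image[OF _ permutes_inv[OF \<tau>]]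
          image_image permutes_inverses[OF \<tau>])
  have "yinterp L (x \<circ> zperm \<tau>) = (\<Sum>J\<in>parts. yw L (\<lambda>k. \<tau> ` J k) x * kern (\<lambda>k. \<tau> ` J k) x / euler (\<lambda>k. \<tau> ` J k) x)"
    unfolding yinterp_def kern_permute[OF \<tau>] euler_permute[OF \<tau>]
    by (intro sum.cong refl) (simp add: yw_permute[OF _ \<tau>] parts_def)
  also have "\<dots> = yinterp L x" unfolding yinterp_def
    by (rule sum.reindex_bij_betw[OF bij, of "\<lambda>J. yw L J x * kern J x / euler J x"])
  finally show ?thesis .
qed

text \<open>\<open>hprod\<close> clears the localisations of \<open>E\<close> and the Vandermonde
  product clears \<open>euler J\<close>. The product of \<open>hprod\<close> and the sum is
  symmetric in the \<open>z\<close>, so the simple poles left by the Vandermonde product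
  disappear.\<close>

lemma laur_yinterp: "laur gens yvars (\<lambda>x. hprod x * yinterp L x)"
proof -
  define A where "A = (\<lambda>(a, b). (Z a, Z b)) ` ltpairs n"
  have prodA: "(\<Prod>(u, v)\<in>A. x u - x v) = (\<Prod>(a, b)\<in>ltpairs n. x (Z a) - x (Z b))" for x :: "var \<Rightarrow> complex"
    unfolding A_def by (subst prod.reindex) (auto simp: inj_on_def case_prod_beta)
  have memA: "\<exists>a b. u = Z a \<and> v = Z b \<and> a \<in> {1..n} \<and> b \<in> {1..n} \<and> a < b" if "(u, v) \<in> A" for u v
    using that by (auto simp: A_def mem_ltpairs)
  have ZHK: "ZHvars n \<subseteq> yvars" using ZH_Kvars by blast
  show ?thesis
  proof (rule laur_symmetric_poles[of A])
    show "finite A" by (simp add: A_def finite_ltpairs)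
    show "gens \<subseteq> torus" "gpts \<subseteq> gens" by (fact gens_torus gpts_gens)+
    show "\<forall>(u, v)\<in>A. u \<noteq> v \<and> (v, u) \<notin> A \<and> u \<in> yvars \<and> v \<in> yvars"
    proof clarify
      fix u v assume uv: "(u, v) \<in> A"
      have "(v, u) \<notin> A" using memA[OF uv] memA[of v u] by force
      then show "u \<noteq> v \<and> (v, u) \<notin> A \<and> u \<in> yvars \<and> v \<in> yvars"
        using memA[OF uv] by (auto simp: Kvars_def ZHvars_def)
    qed
    show "\<forall>(u, v)\<in>A. \<forall>x\<in>gens. x u \<noteq> x v \<and> x \<circ> transpose u v \<in> gens
        \<and> hprod (x \<circ> transpose u v) * yinterp L (x \<circ> transpose u v) = hprod x * yinterp L x"
    proof clarify
      fix u v x assume uv: "(u, v) \<in> A" and x: "x \<in> gens"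
      obtain a b where ab: "u = Z a" "v = Z b" "a \<in> {1..n}" "b \<in> {1..n}" "a < b" using memA[OF uv] by blast
      define \<tau> where "\<tau> = transpose a b"
      have \<tau>: "\<tau> permutes {1..n}" unfolding \<tau>_def by (rule permutes_swap_id[OF ab(3,4)])
      have tz: "transpose u v = zperm \<tau>"
        by (rule ext) (auto simp: zperm_def \<tau>_def ab transpose_def split: var.split)
      have "x u \<noteq> x v" using gens_distinct[OF x ab(3,4)] ab by simp
      moreover have "x \<circ> zperm \<tau> \<in> gens"
      proof -
        have in_n: "\<tau> c \<in> {1..n}" if "c \<in> {1..n}" for c using permutes_in_image[OF \<tau>] that by blast
        have inj: "\<tau> c = \<tau> d \<longleftrightarrow> c = d" for c d using permutes_inj[OF \<tau>] by (simp add: inj_eq)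
        have g: "gen n (\<lambda>a. x (Z a)) (x H)" using x by (simp add: gens_def)
        have "gen n (\<lambda>a. x (Z (\<tau> a))) (x H)"
          using g in_n inj unfolding gen_def by (metis (no_types, lifting))
        then show ?thesis using x by (simp add: gens_def torus_def zperm_def)
      qed
      ultimately show "x u \<noteq> x v \<and> x \<circ> transpose u v \<in> gens
        \<and> hprod (x \<circ> transpose u v) * yinterp L (x \<circ> transpose u v) = hprod x * yinterp L x"
        unfolding tz hprod_permute[OF \<tau>] yinterp_permute[OF \<tau>] by blast
    qed
    have "laur gens yvars (\<lambda>x. \<Sum>J\<in>parts.
        wW N lam L (\<lambda>k a. x (Z (elt (cup J k) a))) (\<lambda>a. x (Gam 0 a)) (x H)
        * (hprod x / wE N lam (\<lambda>k a. x (Z (elt (cup J k) a))) (x H)) * kern J x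
        * ((\<Prod>(a, b)\<in>ltpairs n. x (Z a) - x (Z b)) / euler J x))"
      by (intro laur_sum laur_mult gens_torus laur_yw_wE laur_hprod_wE laur_kern laur_vandermonde_euler ZHK)
         (auto simp: parts_def)
    then show "laur gens yvars (\<lambda>x. hprod x * yinterp L x * (\<Prod>(u, v)\<in>A. x u - x v))"
      unfolding prodA yinterp_def yw_def
      by (simp add: sum_distrib_left sum_distrib_right mult_ac)
  qed
qed

section \<open>Specialisation and removal of the remaining poles\<close>

definition interp :: "(nat \<Rightarrow> nat) \<Rightarrow> (nat \<Rightarrow> nat set) \<Rightarrow> (var \<Rightarrow> complex) \<Rightarrow> complex" where
  "interp \<sigma> I x = (\<Sum>J\<in>parts. wWt N lam \<sigma> I J (\<lambda>a. x (Z a)) (x H) * kern J x / euler J x)"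

text \<open>The auxiliary variable \<open>Gam 0 a\<close> is set to \<open>Z (\<sigma> a)\<close>
  only now: this destroys the symmetry, but the poles at equal \<open>z\<close> are already
  gone.\<close>

lemma laur_hprod_interp:
  assumes \<sigma>: "\<sigma> permutes {1..n}"
  shows "laur gens (Kvars N n lam) (\<lambda>x. hprod x * interp \<sigma> I x)"
proof -
  define g where "g v = (case v of Gam k a \<Rightarrow> if k = 0 then Z (\<sigma> a) else Gam k a | _ \<Rightarrow> v)" for v
  have "x \<circ> g \<in> gens" if "x \<in> gens" for x
    using that by (simp add: gens_def torus_def g_def)
  moreover have "g ` yvars \<subseteq> Kvars N n lam"
    using permutes_in_image[OF \<sigma>] by (auto simp: g_def Kvars_def ZHvars_def)
  ultimately have "laur gens (Kvars N n lam) (\<lambda>x. hprod (x \<circ> g) * yinterp (\<lambda>k. inv \<sigma> ` I k) (x \<circ> g))"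
    by (rule laur_subst[OF gens_torus laur_yinterp])
  moreover have "hprod (x \<circ> g) = hprod x" "kern J (x \<circ> g) = kern J x" "euler J (x \<circ> g) = euler J x"
    "yw (\<lambda>k. inv \<sigma> ` I k) J (x \<circ> g) = wWt N lam \<sigma> I J (\<lambda>a. x (Z a)) (x H)" for x J
    by (simp_all add: hprod_def kern_def euler_def yw_def wWt_def Let_def g_def o_def)
  ultimately show ?thesis by (simp add: yinterp_def interp_def)
qed

text \<open>The polynomial of \<open>allz m\<close>. Powers are written as repetitions over
  \<open>{..<m}\<close>, the form that \<open>coprime_differences_dvd\<close> treats.\<close>

definition dpoly :: "nat \<Rightarrow> lpoly" where
  "dpoly m = (\<Prod>i\<in>{(a, b) \<in> {1..n} \<times> {1..n}. a \<noteq> b} \<times> {..<m}. lX (Z (fst (fst i))) - lX (Z (snd (fst i))))"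

lemma leval_dpoly: "x \<in> torus \<Longrightarrow> leval (dpoly m) x = allz m x"
proof -
  assume x: "x \<in> torus"
  let ?R = "{(a, b) \<in> {1..n} \<times> {1..n}. a \<noteq> b}"
  have "leval (dpoly m) x = (\<Prod>i\<in>?R \<times> {..<m}. x (Z (fst (fst i))) - x (Z (snd (fst i))))"
    by (simp add: dpoly_def x)
  also have "\<dots> = (\<Prod>p\<in>?R. \<Prod>k\<in>{..<m}. x (Z (fst p)) - x (Z (snd p)))"
    unfolding prod.cartesian_product by (simp add: case_prod_beta)
  also have "\<dots> = (\<Prod>(a, b)\<in>?R. (x (Z a) - x (Z b)) ^ m)"
    by (intro prod.cong refl) auto
  also have "\<dots> = allz m x" unfolding prod_filtered_pairs allz_def ..
  finally show ?thesis .
qed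

lemma allz_nonzero:
  assumes "x \<in> gens" shows "allz m x \<noteq> 0"
  unfolding allz_def using gens_distinct[OF assms] by (auto simp: prod_zero_iff simp del: One_nat_def split: if_splits)

lemma finite_neq_pairs: "finite ({(a, b) \<in> {1..n} \<times> {1..n}. a \<noteq> b} \<times> {..<m::nat})"
  by (intro finite_cartesian_product finite_lessThan finite_subset[of _ "{1..n} \<times> {1..n}"]) auto

lemma dpoly_nonzero: "dpoly m \<noteq> 0"
  unfolding dpoly_def prod_zero_iff[OF finite_neq_pairs] using lX_diff_nonzero by fastforce

lemma dpoly_dvd:
  assumes "dpoly m * P = B * Q" "lvars Q \<subseteq> V" "ZHvars n \<subseteq> V"
    and "\<And>a b. lsubst (id(Z a := Z b)) B \<noteq> 0"
  shows "\<exists>Q'. lvars Q' \<subseteq> V \<and> Q = dpoly m * Q'"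
  unfolding dpoly_def
proof (rule coprime_differences_dvd)
  show "finite ({(a, b) \<in> {1..n} \<times> {1..n}. a \<noteq> b} \<times> {..<m})" by (rule finite_neq_pairs)
  show "(\<Prod>i\<in>{(a, b) \<in> {1..n} \<times> {1..n}. a \<noteq> b} \<times> {..<m}. lX (Z (fst (fst i))) - lX (Z (snd (fst i)))) * P = B * Q"
    using assms(1) unfolding dpoly_def .
  show "lsubst (id(Z (fst (fst i)) := Z (snd (fst i)))) B \<noteq> 0" for i :: "(nat \<times> nat) \<times> nat"
    by (rule assms(4))
qed (use assms(2,3) Z_ZHvars in auto)

lemma one_minus_lmon_nonzero: "lk m H \<noteq> 0 \<Longrightarrow> 1 - lmon 1 m \<noteq> 0"
proof
  assume "lk m H \<noteq> 0" "1 - lmon 1 m = 0"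
  then have "lk (1 :: lpoly) m = lk (lmon 1 m) m" by simp
  moreover have "m \<noteq> 0" using \<open>lk m H \<noteq> 0\<close> by auto
  ultimately show False by (simp add: lmon_def lookup_one)
qed

text \<open>Even if the substitution merges the two \<open>z\<close> indices, \<open>1 - h\<close>
  is left: the exponent of \<open>H\<close> stays 1.\<close>

lemma hfactor_subst_nonzero: "lsubst (id(Z a := Z b)) (1 - lmon 1 (ex H + ex (Z c) - ex (Z d))) \<noteq> 0"
proof -
  have "lsubst (id(Z a := Z b)) (1 - lmon 1 (ex H + ex (Z c) - ex (Z d)))
      = 1 - lmon 1 (ex H + ex ((id(Z a := Z b)) (Z c)) - ex ((id(Z a := Z b)) (Z d)))"
    by (simp add: lsubst_diff mono_map_add mono_map_diff del: fun_upd_apply) simp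
  moreover have "lk (ex H + ex u - ex v) H = 1" if "u \<noteq> H" "v \<noteq> H" for u v
    using that by (simp add: lookup_add lookup_minus ex_def)
  then have "1 - lmon 1 (ex H + ex u - ex v) \<noteq> 0" if "u \<noteq> H" "v \<noteq> H" for u v
    using that by (intro one_minus_lmon_nonzero) simp
  moreover have "(id(Z a := Z b)) (Z c) \<noteq> H" "(id(Z a := Z b)) (Z d) \<noteq> H" by auto
  ultimately show ?thesis by (simp only: not_False_eq_True)
qed

lemma evert_subst_nonzero: "lsubst (id(Z a := Z b)) (evert N n \<sigma> J) \<noteq> 0"
  unfolding evert_def lsubst_prod using hfactor_subst_nonzero by (simp add: prod_zero_iff)

text \<open>Multiplied by \<open>hprod\<close> the sum is a polynomial \<open>P\<close>; multiplied
  by \<open>allz N\<close> it is a polynomial \<open>Q\<close>. Comparing both,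
  \<open>dpoly N * P = B * Q\<close>, and no factor of \<open>B\<close> vanishes under
  \<open>z_a := z_b\<close>. So \<open>dpoly N\<close> divides \<open>Q\<close>, and the quotient is
  \<open>F\<close>.\<close>

lemma ex_interp_poly:
  assumes \<sigma>: "\<sigma> permutes {1..n}" and I: "ordpart N n lam I"
  shows "\<exists>F. lvars F \<subseteq> Kvars N n lam \<and> (\<forall>x\<in>gens. leval F x = interp \<sigma> I x)"
proof -
  let ?K = "Kvars N n lam"
  define B where "B = (\<Prod>k\<in>{1..N-1}. \<Prod>a\<in>{1..n}. \<Prod>b\<in>{1..n}. 1 - lmon 1 (ex H + ex (Z b) - ex (Z a)))"
  obtain P where P: "\<And>x. x \<in> gens \<Longrightarrow> hprod x * interp \<sigma> I x = leval P x"
    using laur_hprod_interp[OF \<sigma>, of I] unfolding laur_def by blast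
  have "laur gens ?K (\<lambda>x. \<Sum>J\<in>parts. wWt N lam \<sigma> I J (\<lambda>a. x (Z a)) (x H) * zdiff x * kern J x * (allz 1 x / euler J x))"
  proof (rule laur_sum)
    fix J assume "J \<in> parts"
    then have J: "ordpart N n lam J" by (simp add: parts_def)
    interpret P: flag_pair N n lam \<sigma> I J by (rule flag_pairI[OF \<sigma> I J])
    obtain R where R: "lvars R \<subseteq> ZHvars n"
      "\<And>x. x \<in> gens \<Longrightarrow> wWt N lam \<sigma> I J (\<lambda>a. x (Z a)) (x H) * zdiff x = leval (evert N n \<sigma> J) x * leval R x"
      using P.wWt_vert by blast
    have "lvars (evert N n \<sigma> J) \<subseteq> ?K" unfolding evert_def
    proof (intro lvars_prod lvars_diff)
      fix k l a b assume "k \<in> {1..N}" "a \<in> {a \<in> {1..n}. \<sigma> a \<in> J k}" "b \<in> {b \<in> {1..n}. \<sigma> b \<in> J l \<and> b < a}"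
      then have "\<sigma> a \<in> {1..n}" "\<sigma> b \<in> {1..n}" using permutes_in_image[OF \<sigma>] by auto
      then have "{H, Z (\<sigma> a), Z (\<sigma> b)} \<subseteq> ?K" using ZH_Kvars H_ZHvars Z_ZHvars by blast
      moreover have "ks (ex H + ex (Z (\<sigma> b)) - ex (Z (\<sigma> a))) \<subseteq> {H, Z (\<sigma> a), Z (\<sigma> b)}"
        using keys_diff[of "ex H + ex (Z (\<sigma> b))" "ex (Z (\<sigma> a))"] keys_add[of "ex H" "ex (Z (\<sigma> b))"] by auto
      ultimately show "lvars (lmon 1 (ex H + ex (Z (\<sigma> b)) - ex (Z (\<sigma> a)))) \<subseteq> ?K"
        using lvars_lmon[of 1 "ex H + ex (Z (\<sigma> b)) - ex (Z (\<sigma> a))"] by (meson order_trans)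
    qed simp
    moreover have "lvars R \<subseteq> ?K" using R(1) ZH_Kvars by blast
    ultimately have "lvars (evert N n \<sigma> J * R) \<subseteq> ?K" by (rule lvars_mult)
    then have "laur gens ?K (\<lambda>x. wWt N lam \<sigma> I J (\<lambda>a. x (Z a)) (x H) * zdiff x)"
      by (rule laurI) (simp add: R(2) subsetD[OF gens_torus])
    from laur_mult[OF gens_torus laur_mult[OF gens_torus this laur_kern[OF J order_refl]]
        laur_allz_euler[OF J ZH_Kvars]]
    show "laur gens ?K (\<lambda>x. wWt N lam \<sigma> I J (\<lambda>a. x (Z a)) (x H) * zdiff x * kern J x * (allz 1 x / euler J x))" .
  qed
  then obtain Q where Q: "lvars Q \<subseteq> ?K" "\<And>x. x \<in> gens \<Longrightarrow>
      (\<Sum>J\<in>parts. wWt N lam \<sigma> I J (\<lambda>a. x (Z a)) (x H) * zdiff x * kern J x * (allz 1 x / euler J x)) = leval Q x"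
    by (auto simp: laur_def)
  have allzN: "zdiff x * allz 1 x = allz N x" for x
  proof -
    \<comment> \<open>\<open>N - 1\<close> powers of the differences clear the weight function, and
      one more clears \<open>euler J\<close>.\<close>
    have "N = (N - 1) + 1" using N_pos by simp
    then have "(x (Z a) - x (Z b)) ^ N = (x (Z a) - x (Z b)) ^ (N - 1) * (x (Z a) - x (Z b)) ^ 1" for a b
      by (metis power_add)
    then show ?thesis unfolding zdiff_allz allz_def prod.distrib[symmetric] by (intro prod.cong refl) auto
  qed
  have Qx: "leval Q x = allz N x * interp \<sigma> I x" if "x \<in> gens" for x
    unfolding Q(2)[OF that, symmetric] interp_def sum_distrib_left allzN[symmetric]
    by (intro sum.cong refl) simp
  have "dpoly N * P = B * Q"
  proof (rule lpoly_eqI[OF gpts_gens])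
    fix x assume x: "x \<in> gens"
    then have t: "x \<in> torus" using gens_torus by blast
    have "leval B x = hprod x"
      unfolding B_def hprod_def leval_prod[OF t] by (intro prod.cong refl) (simp add: t meval_add meval_diff)
    then show "leval (dpoly N * P) x = leval (B * Q) x"
      using x by (simp add: t leval_dpoly Qx flip: P)
  qed
  moreover have "lsubst (id(Z a := Z b)) B \<noteq> 0" for a b
    unfolding B_def lsubst_prod using hfactor_subst_nonzero by (simp add: prod_zero_iff)
  ultimately obtain F where F: "lvars F \<subseteq> ?K" "Q = dpoly N * F"
    using dpoly_dvd[OF _ Q(1) ZH_Kvars] by blast
  have "leval F x = interp \<sigma> I x" if x: "x \<in> gens" for x
  proof -
    have t: "x \<in> torus" using x gens_torus by blast
    have "allz N x * leval F x = allz N x * interp \<sigma> I x"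
      using Qx[OF x] by (simp add: F(2) t leval_dpoly)
    then show ?thesis using allz_nonzero[OF x] by simp
  qed
  then show ?thesis using F(1) by blast
qed

text \<open>\<open>pt\<close> gives the \<gamma> the value 0 and so lies outside
  \<open>torus\<close>. The values off \<open>ZHvars n\<close> are replaced by 1.\<close>

lemma gens_representative:
  assumes "gen n z h"
  obtains x where "x \<in> gens" "\<And>v. v \<in> ZHvars n \<Longrightarrow> x v = pt z h v" "\<And>a. a \<in> {1..n} \<Longrightarrow> x (Z a) = z a" "x H = h"
proof
  define x where "x v = (if v \<in> ZHvars n then pt z h v else 1)" for v
  show xv: "x v = pt z h v" if "v \<in> ZHvars n" for v using that by (simp add: x_def)
  show xZ: "x (Z a) = z a" if "a \<in> {1..n}" for a using xv[OF Z_ZHvars[OF that]] by (simp add: pt_def)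
  show xH: "x H = h" using xv[OF H_ZHvars] by (simp add: pt_def)
  have "gen n (\<lambda>a. x (Z a)) (x H)" using assms unfolding gen_def xH by (simp add: xZ)
  moreover have "x v \<noteq> 0" for v
    using assms by (auto simp: x_def pt_def ZHvars_def gen_def split: var.split)
  ultimately show "x \<in> gens" by (simp add: gens_def torus_def)
qed

end

context flag_pair
begin

lemma wWt_cong:
  assumes "\<And>a. a \<in> {1..n} \<Longrightarrow> z a = z' a"
  shows "wWt N lam \<sigma> I J z h = wWt N lam \<sigma> I J z' h"
proof -
  have el: "elt (cup J k) a \<in> {1..n}" if "k \<in> {1..N-1}" "a \<in> {1..lamc lam k}" for k a
  proof -
    have kN: "k \<le> N" using that by auto
    show ?thesis using bij_betw_apply[OF elt_cup_bij[OF J kN] that(2)] ordpart_cup(1)[OF J kN] by blast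
  qed
  have "wW N lam I' (\<lambda>k a. z (elt (cup J k) a)) (z \<circ> \<sigma>) h = wW N lam I' (\<lambda>k a. z' (elt (cup J k) a)) (z' \<circ> \<sigma>) h"
    using el permutes_in_image[OF \<sigma>] by (intro wW_cong) (auto intro!: assms)
  moreover have "wE N lam (\<lambda>k a. z (elt (cup J k) a)) h = wE N lam (\<lambda>k a. z' (elt (cup J k) a)) h"
    using el by (intro wE_cong assms)
  ultimately show ?thesis by (simp only: wWt_def Let_def)
qed

end

theorem theorem6p7:
  fixes N n :: nat and lam \<sigma> :: "nat \<Rightarrow> nat" and I :: "nat \<Rightarrow> nat set"
  assumes "1 \<le> N" and "(\<Sum>k\<in>{1..N}. lam k) = n" and "\<sigma> permutes {1..n}" and "ordpart N n lam I"
  shows "\<exists>F. in_K N n lam F \<and>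
    (\<forall>J. ordpart N n lam J \<longrightarrow>
       (\<forall>z h. gen n z h \<longrightarrow> leval (restr J F) (pt z h) = wWt N lam \<sigma> I J z h)) \<and>
    (\<forall>F'. in_K N n lam F' \<and>
       (\<forall>J. ordpart N n lam J \<longrightarrow>
          (\<forall>z h. gen n z h \<longrightarrow> leval (restr J F') (pt z h) = wWt N lam \<sigma> I J z h))
       \<longrightarrow> in_ideal N n lam (F' - F)) \<and>
    (\<forall>J. ordpart N n lam J \<longrightarrow> (\<exists>Q. lvars Q \<subseteq> ZHvars n \<and> restr J F = evert N n \<sigma> J * Q)) \<and>
    restr I F = Pfac N n \<sigma> I * efac N n \<sigma> I \<and>
    (\<forall>J. ordpart N n lam J \<and> J \<noteq> I \<longrightarrow> Jsmall N lam J (restr J F))"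
proof -
  interpret flag_type N n lam using assms by unfold_locales
  have pair: "flag_pair N n lam \<sigma> I J" if "ordpart N n lam J" for J
    using flag_pairI[OF assms(3,4) that] .
  obtain F where lvF: "lvars F \<subseteq> Kvars N n lam" and F: "\<And>x. x \<in> gens \<Longrightarrow> leval F x = interp \<sigma> I x"
    using ex_interp_poly[OF assms(3,4)] by blast
  have rF: "leval (restr J F) x = wWt N lam \<sigma> I J (\<lambda>a. x (Z a)) (x H)"
    if J: "ordpart N n lam J" and x: "x \<in> gens" for J x
  proof -
    have ZH: "(x \<circ> restrmap J) (Z a) = x (Z a)" "(x \<circ> restrmap J) H = x H" for a by (simp_all add: restrmap_def)
    have "euler L (x \<circ> restrmap J) = euler L x" for L unfolding euler_def ZH ..
    \<comment> \<open>All kernels but that of \<open>J\<close> vanish at the fixed point, and that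
      one cancels its own denominator.\<close>
    then have "interp \<sigma> I (x \<circ> restrmap J)
        = (\<Sum>L\<in>parts. if L = J then wWt N lam \<sigma> I J (\<lambda>a. x (Z a)) (x H) else 0)"
      unfolding interp_def ZH
      using euler_nonzero[OF J x] by (intro sum.cong refl) (auto simp: kern_restr J parts_def)
    also have "\<dots> = wWt N lam \<sigma> I J (\<lambda>a. x (Z a)) (x H)" using J finite_parts by (simp add: parts_def)
    finally show ?thesis
      using F[OF restrmap_gens[OF x]] subsetD[OF gens_torus x] by (simp add: restr_eq leval_lsubst)
  qed
  have inK: "in_K N n lam F"
    unfolding in_K_def
  proof (intro conjI allI impI lvF)
    fix \<rho> assume \<rho>: "\<forall>k\<in>{1..N}. \<rho> k permutes {1..lam k}"
    show "lsubst (gamperm \<rho>) F = F"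
    proof (rule lpoly_eqI[OF gpts_gens])
      fix x assume x: "x \<in> gens"
      have ZH: "(x \<circ> gamperm \<rho>) (Z a) = x (Z a)" "(x \<circ> gamperm \<rho>) H = x H" for a by (simp_all add: gamperm_def)
      have "x \<circ> gamperm \<rho> \<in> gens" using x by (simp add: gens_def torus_def gamperm_def)
      \<comment> \<open>The \<gamma> enter the interpolation sum through the kernels alone, so block
        symmetry is checked there.\<close>
      moreover have "kern J (x \<circ> gamperm \<rho>) = kern J x" for J
        unfolding kern_def
      proof (rule prod.cong[OF refl], rule prod.cong[OF refl])
        fix k l assume "k \<in> {1..N}"
        then have "\<rho> k permutes {1..lam k}" using \<rho> by blast
        from prod.permute[OF this, of "\<lambda>a. \<Prod>b\<in>J l. x (Gam k a) - x (Z b)"]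
        show "(\<Prod>a\<in>{1..lam k}. \<Prod>b\<in>J l. (x \<circ> gamperm \<rho>) (Gam k a) - (x \<circ> gamperm \<rho>) (Z b))
            = (\<Prod>a\<in>{1..lam k}. \<Prod>b\<in>J l. x (Gam k a) - x (Z b))" by (simp add: gamperm_def o_def)
      qed
      moreover have "euler J (x \<circ> gamperm \<rho>) = euler J x" for J unfolding euler_def ZH ..
      ultimately have "leval F (x \<circ> gamperm \<rho>) = leval F x"
        using F[of "x \<circ> gamperm \<rho>"] F[OF x] by (simp only: interp_def ZH)
      then show "leval (lsubst (gamperm \<rho>) F) x = leval F x"
        using subsetD[OF gens_torus x] by (simp add: leval_lsubst)
    qed
  qed
  have ev: "leval (restr J F) (pt z h) = wWt N lam \<sigma> I J z h" if J: "ordpart N n lam J" and g: "gen n z h" for J z h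
  proof -
    interpret flag_pair N n lam \<sigma> I J by (rule pair[OF J])
    obtain x where x: "x \<in> gens" "\<And>v. v \<in> ZHvars n \<Longrightarrow> x v = pt z h v"
       "\<And>a. a \<in> {1..n} \<Longrightarrow> x (Z a) = z a" "x H = h" using gens_representative[OF g] by blast
    have "leval (restr J F) (pt z h) = leval (restr J F) x"
      using lvars_restr[OF lvF J] x(2) by (intro leval_cong) auto
    also have "\<dots> = wWt N lam \<sigma> I J (\<lambda>a. x (Z a)) h" using rF[OF J x(1)] x(4) by simp
    also have "\<dots> = wWt N lam \<sigma> I J z h" by (rule wWt_cong) (rule x(3))
    finally show ?thesis .
  qed
  have uniq: "in_ideal N n lam (F' - F)"
    if F': "in_K N n lam F'" and ev': "\<forall>J. ordpart N n lam J \<longrightarrow>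
          (\<forall>z h. gen n z h \<longrightarrow> leval (restr J F') (pt z h) = wWt N lam \<sigma> I J z h)" for F'
  proof (rule in_ideal_if_restrictions_vanish)
    show "in_K N n lam (F' - F)"
      using F' inK by (simp add: in_K_def lvars_diff lsubst_diff)
    fix J assume J: "ordpart N n lam J"
    have "restr J F' = restr J F"
    proof (rule lpoly_eqI[OF gpts_gens])
      fix x assume x: "x \<in> gens"
      have g: "gen n (\<lambda>a. x (Z a)) (x H)" using x by (simp add: gens_def)
      have eq: "x v = pt (\<lambda>a. x (Z a)) (x H) v" if "v \<in> ZHvars n" for v
        using that by (auto simp: ZHvars_def pt_def)
      have "leval (restr J F') x = leval (restr J F') (pt (\<lambda>a. x (Z a)) (x H))"
        using lvars_restr[OF _ J, of F'] F' by (intro leval_cong eq) (auto simp: in_K_def)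
      also have "\<dots> = wWt N lam \<sigma> I J (\<lambda>a. x (Z a)) (x H)" using ev' J g by blast
      finally show "leval (restr J F') x = leval (restr J F) x" using rF[OF J x] by simp
    qed
    then show "restr J (F' - F) = 0" by (simp add: restr_eq lsubst_diff)
  qed
  have vert: "\<exists>Q. lvars Q \<subseteq> ZHvars n \<and> restr J F = evert N n \<sigma> J * Q" if J: "ordpart N n lam J" for J
  proof -
    interpret flag_pair N n lam \<sigma> I J by (rule pair[OF J])
    obtain P where P: "lvars P \<subseteq> ZHvars n" "\<And>x. x \<in> gens \<Longrightarrow>
        wWt N lam \<sigma> I J (\<lambda>a. x (Z a)) (x H) * zdiff x = leval (evert N n \<sigma> J) x * leval P x"
      using wWt_vert by blast
    \<comment> \<open>With \<open>restr J F\<close> known to be a polynomial, this is divisibility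
      up to \<open>dpoly (N - 1)\<close>, which has no common factor with \<open>evert\<close> and
      therefore divides \<open>P\<close>.\<close>
    have "dpoly (N - 1) * restr J F = evert N n \<sigma> J * P"
    proof (rule lpoly_eqI[OF gpts_gens])
      fix x assume x: "x \<in> gens"
      then show "leval (dpoly (N - 1) * restr J F) x = leval (evert N n \<sigma> J * P) x"
        using P(2)[OF x] rF[OF J x] subsetD[OF gens_torus x]
        by (simp add: leval_dpoly zdiff_allz mult.commute)
    qed
    moreover from this obtain Q where Q: "lvars Q \<subseteq> ZHvars n" "P = dpoly (N - 1) * Q"
      using dpoly_dvd[OF _ P(1) order_refl evert_subst_nonzero] by blast
    ultimately have "dpoly (N - 1) * restr J F = dpoly (N - 1) * (evert N n \<sigma> J * Q)"
      by (simp add: mult.left_commute)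
    then have "restr J F = evert N n \<sigma> J * Q" using dpoly_nonzero by simp
    then show ?thesis using Q(1) by blast
  qed
  have diag: "restr I F = Pfac N n \<sigma> I * efac N n \<sigma> I"
  proof (rule lpoly_eqI[OF gpts_gens])
    interpret flag_pair N n lam \<sigma> I I by (rule pair[OF assms(4)])
    fix x assume x: "x \<in> gens"
    then have "gen n (\<lambda>a. x (Z a)) (x H)" by (simp add: gens_def)
    then show "leval (restr I F) x = leval (Pfac N n \<sigma> I * efac N n \<sigma> I) x"
      unfolding leval_Pfac_efac[OF x] rF[OF assms(4) x] by (rule wWt_diagonal[OF refl])
  qed
  have small: "Jsmall N lam J (restr J F)" if Jp: "ordpart N n lam J" "J \<noteq> I" for J
  proof -
    interpret flag_pair N n lam \<sigma> I J by (rule pair[OF Jp(1)])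
    show ?thesis by (rule Jsmall_if_represents[OF Jp(2) rF[OF Jp(1)] wWt_cong])
  qed
  show ?thesis
    by (rule exI[of _ F]) (use inK ev uniq vert diag small in blast)
qed

end
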